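(* Let $M$ be a surface in the Euclidean space $\mathbb R^3$ given locally as the graph of an analytic function $z=f(x,y)$ with $$\begin{array}{rl}f=&\frac{\kappa}{2}(x^2+y^2)+\frac a6x^3+\frac b2xy^2+\frac c6y^3+\frac{d_{40}}{24}x^4+\frac{d_{31}}6x^3y+\frac{d_{22}}4x^2y^2+\frac{d_{13}}6xy^3+\frac{d_{04}}{24}y^4\\&+\frac{d_{50}}{120}x^5+\frac{d_{41}}{24}x^4y+\frac{d_{32}}{12}x^3y^2+\frac{d_{23}}{12}x^2y^3+\frac{d_{14}}{24}xy^4+\frac{d_{05}}{120}y^5+O(6),\end{array}$$ so that the origin is an umbilic point ${\rm p}$. Put $\chi=c\,d_{31}-(d_{22}-d_{40}+2\kappa^3)b$ and $\xi=12\kappa^2b^3+(d_{32}-d_{50})b^2+(3d_{31}^2-3d_{31}d_{13}-c\,d_{41})b+3c\,d_{31}(d_{22}-\kappa^3)$. Then: - if ${\rm p}$ is of type ${\rm D}^2_1$ ($c=0$ and $a=2b\neq0$), then $m_u({\rm p})=1$; - if ${\rm p}$ is of type ${\rm D}^2_{2p}$ ($a=b\neq0$, $\chi=0$, $\xi\neq0$ and $\xi b<0$), then $m_u({\rm p})=3$; - if ${\rm p}$ is of type ${\rm D}^2_3$ ($a=b\neq0$, $\chi=0$, $\xi\neq0$ and $\xi b>0$), then $m_u({\rm p})=3$; - if ${\rm p}$ is of type ${\rm D}^2_h$ (either $a=b=0$ and $c\,d_{31}\neq0$, or $b=c=0$ and $a\,d_{13}\neq0$), then $m_u({\rm p})=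2$.
   Context: For a surface in Euclidean space with local parametrisation $\mathbf x(x,y)=(x,y,f(x,y))$, let $E,F,G$ and $l,m,n$ be the coefficients of the first and second fundamental forms, and $\mathfrak a=Fn-Gm$, $\mathfrak b=En-Gl$, $\mathfrak c=Em-Fl$ the coefficients of the equation of the lines of principal curvature $\mathfrak a\,dy^2+\mathfrak b\,dx\,dy+\mathfrak c\,dx^2=0$. The multiplicity of the umbilic point at the origin (which counts the maximum number of umbilic points into which it can split under deformations of the surface) is $$m_u({\rm p})=\dim_{\mathbb C}\mathcal O_2/\langle\mathfrak b,\mathfrak c\rangle$$ (as $E\neq0$), where $\mathcal O_2$ is the ring of germs at the origin of holomorphic functions in two variables and $\mathfrak b,\mathfrak c$ are complexified. *)

theory Defs
  imports
    "HOL-Analysis.Analysis"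
    "HOL-Library.Landau_Symbols"
    "HOL-Library.Extended_Nat"
    "HOL-Algebra.QuotRing"
    "HOL-Algebra.Embedded_Algebras"
begin

section \<open>Fundamental forms of a parametrised surface\<close>

definition pdx :: "(real \<times> real \<Rightarrow> 'a::real_normed_vector) \<Rightarrow> real \<times> real \<Rightarrow> 'a" where
  "pdx h p = vector_derivative (\<lambda>t. h (t, snd p)) (at (fst p))"

definition pdy :: "(real \<times> real \<Rightarrow> 'a::real_normed_vector) \<Rightarrow> real \<times> real \<Rightarrow> 'a" where
  "pdy h p = vector_derivative (\<lambda>t. h (fst p, t)) (at (snd p))"

definition graph_patch :: "(real \<times> real \<Rightarrow> real) \<Rightarrow> real \<times> real \<Rightarrow> real^3" where
  "graph_patch f p = vector [fst p, snd p, f p]"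

definition unit_normal :: "(real \<times> real \<Rightarrow> real^3) \<Rightarrow> real \<times> real \<Rightarrow> real^3" where
  "unit_normal X p = sgn (cross3 (pdx X p) (pdy X p))"

definition form1_E :: "(real \<times> real \<Rightarrow> real^3) \<Rightarrow> real \<times> real \<Rightarrow> real" where
  "form1_E X p = pdx X p \<bullet> pdx X p"

definition form1_F :: "(real \<times> real \<Rightarrow> real^3) \<Rightarrow> real \<times> real \<Rightarrow> real" where
  "form1_F X p = pdx X p \<bullet> pdy X p"

definition form1_G :: "(real \<times> real \<Rightarrow> real^3) \<Rightarrow> real \<times> real \<Rightarrow> real" where
  "form1_G X p = pdy X p \<bullet> pdy X p"

definition form2_l :: "(real \<times> real \<Rightarrow> real^3) \<Rightarrow> real \<times> real \<Rightarrow> real" where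
  "form2_l X p = unit_normal X p \<bullet> pdx (pdx X) p"

definition form2_m :: "(real \<times> real \<Rightarrow> real^3) \<Rightarrow> real \<times> real \<Rightarrow> real" where
  "form2_m X p = unit_normal X p \<bullet> pdy (pdx X) p"

definition form2_n :: "(real \<times> real \<Rightarrow> real^3) \<Rightarrow> real \<times> real \<Rightarrow> real" where
  "form2_n X p = unit_normal X p \<bullet> pdy (pdy X) p"

definition umbilic :: "(real \<times> real \<Rightarrow> real^3) \<Rightarrow> real \<times> real \<Rightarrow> bool" where
  "umbilic X p \<longleftrightarrow>
    (\<exists>k. form2_l X p = k * form1_E X p \<and> form2_m X p = k * form1_F X p \<and>
         form2_n X p = k * form1_G X p)"

text \<open>The coefficients of \<open>dx dy\<close> and \<open>dx\<^sup>2\<close> in the equation of the lines of principal curvature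
  \<open>(Fn - Gm) dy\<^sup>2 + (En - Gl) dx dy + (Em - Fl) dx\<^sup>2 = 0\<close>.\<close>

definition curv_b :: "(real \<times> real \<Rightarrow> real^3) \<Rightarrow> real \<times> real \<Rightarrow> real" where
  "curv_b X p = form1_E X p * form2_n X p - form1_G X p * form2_l X p"

definition curv_c :: "(real \<times> real \<Rightarrow> real^3) \<Rightarrow> real \<times> real \<Rightarrow> real" where
  "curv_c X p = form1_E X p * form2_m X p - form1_F X p * form2_l X p"

section \<open>Analytic and holomorphic functions near the origin\<close>

definition analytic_at_origin :: "(real \<times> real \<Rightarrow> real) \<Rightarrow> bool" where
  "analytic_at_origin f \<longleftrightarrow>
    (\<exists>(A :: nat \<Rightarrow> nat \<Rightarrow> real) r. r > 0 \<and>
      (\<forall>x y. \<bar>x\<bar> < r \<and> \<bar>y\<bar> < r \<longrightarrow>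
        ((\<lambda>(i, j). A i j * x ^ i * y ^ j) has_sum f (x, y)) UNIV))"

text \<open>Complex differentiability on a neighbourhood of the origin of \<open>\<complex>\<^sup>2\<close>: the real Frechet
  derivative exists and is complex linear.\<close>

definition holomorphic_at_origin :: "(complex \<times> complex \<Rightarrow> complex) \<Rightarrow> bool" where
  "holomorphic_at_origin F \<longleftrightarrow>
    (\<exists>U. open U \<and> 0 \<in> U \<and>
      (\<forall>p\<in>U. \<exists>\<alpha> \<beta>. (F has_derivative (\<lambda>(h, k). \<alpha> * h + \<beta> * k)) (at p)))"

section \<open>The ring of germs\<close>

text \<open>A \<open>germ\<close> is the germ at the origin of an arbitrary function; the holomorphic ones
  are cut out as the carrier of \<open>O2\<close>.\<close>

quotient_type germ = "complex \<times> complex \<Rightarrow> complex" /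
  "\<lambda>F G. eventually (\<lambda>p. F p = G p) (nhds 0)"
proof (rule equivpI)
  show "reflp (\<lambda>F G :: complex \<times> complex \<Rightarrow> complex. eventually (\<lambda>p. F p = G p) (nhds 0))"
    by (simp add: reflp_def)
  show "symp (\<lambda>F G :: complex \<times> complex \<Rightarrow> complex. eventually (\<lambda>p. F p = G p) (nhds 0))"
    by (simp add: symp_def eq_commute)
  show "transp (\<lambda>F G :: complex \<times> complex \<Rightarrow> complex. eventually (\<lambda>p. F p = G p) (nhds 0))"
    by (rule transpI) (erule (1) eventually_elim2, simp)
qed

instantiation germ :: comm_ring_1
begin

lift_definition zero_germ :: germ is "\<lambda>_. 0" .
lift_definition one_germ :: germ is "\<lambda>_. 1" .
lift_definition plus_germ :: "germ \<Rightarrow> germ \<Rightarrow> germ" is "\<lambda>F G p. F p + G p"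
  by (erule (1) eventually_elim2) simp
lift_definition minus_germ :: "germ \<Rightarrow> germ \<Rightarrow> germ" is "\<lambda>F G p. F p - G p"
  by (erule (1) eventually_elim2) simp
lift_definition uminus_germ :: "germ \<Rightarrow> germ" is "\<lambda>F p. - F p"
  by (elim eventually_mono) simp
lift_definition times_germ :: "germ \<Rightarrow> germ \<Rightarrow> germ" is "\<lambda>F G p. F p * G p"
  by (erule (1) eventually_elim2) simp

instance
proof
  show "(0 :: germ) \<noteq> 1"
    by transfer (simp add: eventually_False)
qed (transfer; simp add: algebra_simps)+

end

lift_definition const_germ :: "complex \<Rightarrow> germ" is "\<lambda>z _. z" .

lemma holomorphic_at_origin_cong:
  assumes "eventually (\<lambda>p. F p = G p) (nhds 0)" "holomorphic_at_origin F"
  shows "holomorphic_at_origin G"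
proof -
  obtain U where U: "open U" "0 \<in> U"
    "\<forall>p\<in>U. \<exists>\<alpha> \<beta>. (F has_derivative (\<lambda>(h, k). \<alpha> * h + \<beta> * k)) (at p)"
    using assms(2) unfolding holomorphic_at_origin_def by (elim exE conjE)
  obtain V where V: "open V" "0 \<in> V" "\<forall>p\<in>V. F p = G p"
    using assms(1) unfolding eventually_nhds by (elim exE conjE)
  have "\<exists>\<alpha> \<beta>. (G has_derivative (\<lambda>(h, k). \<alpha> * h + \<beta> * k)) (at p)" if "p \<in> U \<inter> V" for p
  proof -
    from bspec[OF U(3) IntD1[OF that]]
    obtain \<alpha> \<beta> where "(F has_derivative (\<lambda>(h, k). \<alpha> * h + \<beta> * k)) (at p)" by (elim exE)
    then have "(G has_derivative (\<lambda>(h, k). \<alpha> * h + \<beta> * k)) (at p)"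
      by (rule has_derivative_transform_within_open[of _ _ _ _ V]) (use V that in auto)
    then show ?thesis by (intro exI)
  qed
  then show ?thesis
    unfolding holomorphic_at_origin_def using U V by (intro exI[of _ "U \<inter> V"] conjI ballI) auto
qed

lift_definition holomorphic_germ :: "germ \<Rightarrow> bool" is holomorphic_at_origin
proof -
  fix F G :: "complex \<times> complex \<Rightarrow> complex"
  assume eq: "eventually (\<lambda>p. F p = G p) (nhds 0)"
  then have "eventually (\<lambda>p. G p = F p) (nhds 0)" by (simp add: eq_commute)
  with eq show "holomorphic_at_origin F = holomorphic_at_origin G"
    by (intro iffI) (erule (1) holomorphic_at_origin_cong)+
qed

definition O2 :: "germ ring" where
  "O2 = \<lparr>carrier = {\<phi>. holomorphic_germ \<phi>}, mult = (*), one = 1, zero = 0, add = (+)\<rparr>"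

lemma O2_simps [simp]:
  "carrier O2 = {\<phi>. holomorphic_germ \<phi>}" "mult O2 = (*)" "one O2 = 1" "zero O2 = 0" "add O2 = (+)"
  by (simp_all add: O2_def)

lemma holomorphic_germ_const [simp]: "holomorphic_germ (const_germ z)"
proof -
  have "((\<lambda>_. z) has_derivative (\<lambda>(h, k). 0 * h + 0 * k)) (at p)" for p :: "complex \<times> complex"
    by (rule has_derivative_eq_rhs[OF has_derivative_const]) auto
  then have "holomorphic_at_origin (\<lambda>_. z)"
    unfolding holomorphic_at_origin_def
    by (intro exI[of _ UNIV] conjI ballI exI) (rule open_UNIV UNIV_I | assumption)+
  then show ?thesis by transfer
qed

lemma holomorphic_germ_0 [simp]: "holomorphic_germ 0"
  and holomorphic_germ_1 [simp]: "holomorphic_germ 1"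
proof -
  have "const_germ 0 = 0" "const_germ 1 = 1" by (transfer, simp)+
  then show "holomorphic_germ 0" "holomorphic_germ 1"
    using holomorphic_germ_const by metis+
qed

lemma holomorphic_at_origin_binop:
  assumes "holomorphic_at_origin F" "holomorphic_at_origin G"
    and op: "\<And>p \<alpha> \<beta> \<gamma> \<delta>. (F has_derivative (\<lambda>(h, k). \<alpha> * h + \<beta> * k)) (at p) \<Longrightarrow>
      (G has_derivative (\<lambda>(h, k). \<gamma> * h + \<delta> * k)) (at p) \<Longrightarrow>
      \<exists>\<epsilon> \<zeta>. (H has_derivative (\<lambda>(h, k). \<epsilon> * h + \<zeta> * k)) (at p)"
  shows "holomorphic_at_origin H"
proof -
  obtain U where U: "open U" "0 \<in> U"
    "\<forall>p\<in>U. \<exists>\<alpha> \<beta>. (F has_derivative (\<lambda>(h, k). \<alpha> * h + \<beta> * k)) (at p)"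
    using assms(1) unfolding holomorphic_at_origin_def by (elim exE conjE)
  obtain V where V: "open V" "0 \<in> V"
    "\<forall>p\<in>V. \<exists>\<alpha> \<beta>. (G has_derivative (\<lambda>(h, k). \<alpha> * h + \<beta> * k)) (at p)"
    using assms(2) unfolding holomorphic_at_origin_def by (elim exE conjE)
  show ?thesis
    unfolding holomorphic_at_origin_def
  proof (intro exI[of _ "U \<inter> V"] conjI ballI)
    fix p assume p: "p \<in> U \<inter> V"
    from bspec[OF U(3) IntD1[OF p]]
    obtain \<alpha> \<beta> where F: "(F has_derivative (\<lambda>(h, k). \<alpha> * h + \<beta> * k)) (at p)" by (elim exE)
    from bspec[OF V(3) IntD2[OF p]]
    obtain \<gamma> \<delta> where G: "(G has_derivative (\<lambda>(h, k). \<gamma> * h + \<delta> * k)) (at p)" by (elim exE)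
    show "\<exists>\<epsilon> \<zeta>. (H has_derivative (\<lambda>(h, k). \<epsilon> * h + \<zeta> * k)) (at p)"
      by (rule op[OF F G])
  qed (use U V in auto)
qed

lemma holomorphic_at_origin_add:
  assumes "holomorphic_at_origin F" "holomorphic_at_origin G"
  shows "holomorphic_at_origin (\<lambda>p. F p + G p)"
proof (rule holomorphic_at_origin_binop[OF assms])
  fix p \<alpha> \<beta> \<gamma> \<delta>
  assume "(F has_derivative (\<lambda>(h, k). \<alpha> * h + \<beta> * k)) (at p)"
    "(G has_derivative (\<lambda>(h, k). \<gamma> * h + \<delta> * k)) (at p)"
  from has_derivative_add[OF this]
  have "((\<lambda>p. F p + G p) has_derivative (\<lambda>(h, k). (\<alpha> + \<gamma>) * h + (\<beta> + \<delta>) * k)) (at p)"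
    by (rule has_derivative_eq_rhs) (auto simp: algebra_simps)
  then show "\<exists>\<epsilon> \<zeta>. ((\<lambda>p. F p + G p) has_derivative (\<lambda>(h, k). \<epsilon> * h + \<zeta> * k)) (at p)"
    by (intro exI)
qed

lemma holomorphic_at_origin_mult:
  assumes "holomorphic_at_origin F" "holomorphic_at_origin G"
  shows "holomorphic_at_origin (\<lambda>p. F p * G p)"
proof (rule holomorphic_at_origin_binop[OF assms])
  fix p \<alpha> \<beta> \<gamma> \<delta>
  assume "(F has_derivative (\<lambda>(h, k). \<alpha> * h + \<beta> * k)) (at p)"
    "(G has_derivative (\<lambda>(h, k). \<gamma> * h + \<delta> * k)) (at p)"
  from has_derivative_mult[OF this]
  have "((\<lambda>p. F p * G p) has_derivative
      (\<lambda>(h, k). (F p * \<gamma> + \<alpha> * G p) * h + (F p * \<delta> + \<beta> * G p) * k)) (at p)"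
    by (rule has_derivative_eq_rhs) (auto simp: algebra_simps)
  then show "\<exists>\<epsilon> \<zeta>. ((\<lambda>p. F p * G p) has_derivative (\<lambda>(h, k). \<epsilon> * h + \<zeta> * k)) (at p)"
    by (intro exI)
qed

lemma holomorphic_germ_add [simp]:
  "holomorphic_germ \<phi> \<Longrightarrow> holomorphic_germ \<psi> \<Longrightarrow> holomorphic_germ (\<phi> + \<psi>)"
  by transfer (rule holomorphic_at_origin_add)

lemma holomorphic_germ_mult [simp]:
  "holomorphic_germ \<phi> \<Longrightarrow> holomorphic_germ \<psi> \<Longrightarrow> holomorphic_germ (\<phi> * \<psi>)"
  by transfer (rule holomorphic_at_origin_mult)

lemma holomorphic_germ_uminus [simp]: "holomorphic_germ (- \<phi>)" if "holomorphic_germ \<phi>"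
proof -
  have "- \<phi> = const_germ (- 1) * \<phi>" by transfer simp
  then show ?thesis using that by simp
qed

lemma cring_O2: "cring O2"
proof (rule cringI)
  show "abelian_group O2"
  proof (rule abelian_groupI)
    show "\<exists>\<psi>\<in>carrier O2. \<psi> \<oplus>\<^bsub>O2\<^esub> \<phi> = \<zero>\<^bsub>O2\<^esub>" if "\<phi> \<in> carrier O2" for \<phi>
      using that by (intro bexI[of _ "- \<phi>"]) auto
  qed (auto simp: algebra_simps)
  show "Group.comm_monoid O2"
    by (rule comm_monoidI) (auto simp: algebra_simps)
qed (auto simp: algebra_simps)

definition const_cosets :: "germ set \<Rightarrow> germ set set" where
  "const_cosets I = (\<lambda>z. I +>\<^bsub>O2\<^esub> const_germ z) ` UNIV"

text \<open>The dimension over \<open>\<complex>\<close> of the quotient of \<open>O2\<close> by an ideal, the field of scalars being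
  identified with the set of cosets of constant germs.\<close>

definition quot_dim :: "germ set \<Rightarrow> enat" where
  "quot_dim I =
    (if ring.finite_dimension (O2 Quot I) (const_cosets I) (carrier (O2 Quot I))
     then enat (ring.dim (O2 Quot I) (const_cosets I) (carrier (O2 Quot I)))
     else \<infinity>)"

text \<open>By the identity theorem at most one holomorphic germ restricts to a given function
  on \<open>\<real>\<^sup>2\<close>.\<close>

definition complexification :: "(real \<times> real \<Rightarrow> real) \<Rightarrow> germ" where
  "complexification g =
    (THE \<phi>. \<exists>G. \<phi> = abs_germ G \<and> holomorphic_at_origin G \<and>
      eventually (\<lambda>p. G (of_real (fst p), of_real (snd p)) = of_real (g p)) (nhds 0))"

definition umbilic_mult :: "(real \<times> real \<Rightarrow> real^3) \<Rightarrow> enat" where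
  "umbilic_mult X =
    quot_dim (Idl\<^bsub>O2\<^esub> {complexification (curv_b X), complexification (curv_c X)})"

end

theory Submission
  imports Defs "HOL-Complex_Analysis.Complex_Analysis"
begin

text \<open>
  Write \<open>B\<close> and \<open>C\<close> for the numerators \<open>(1 + f\<^sub>x\<^sup>2) f\<^sub>y\<^sub>y - (1 + f\<^sub>y\<^sup>2) f\<^sub>x\<^sub>x\<close> and
  \<open>(1 + f\<^sub>x\<^sup>2) f\<^sub>x\<^sub>y - f\<^sub>x f\<^sub>y f\<^sub>x\<^sub>x\<close> of the two curvature coefficients of the graph. The common
  denominator is the square root of \<open>1 + f\<^sub>x\<^sup>2 + f\<^sub>y\<^sup>2\<close>, whose complexification is a unit of the local
  ring, so the ideal in the definition of the multiplicity is generated by \<open>B\<close> and \<open>C\<close>.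

  The idea is to find in each case a smooth curve germ \<open>T = 0\<close> with local parameter \<open>u\<close> and an
  exponent \<open>n\<close> such that \<open>B = s T + t u\<^sup>n\<close> and \<open>C = p T + q u\<^sup>n\<close>, where the determinant \<open>s q - t p\<close>
  does not vanish at the origin. By Cramer's rule (\<open>genideal_eq_ideal_of_pair\<close>) the ideal is then
  generated by \<open>T\<close> and \<open>u\<^sup>n\<close>, and the quotient has the basis \<open>1, u, \<dots>, u\<^sup>n\<^sup>-\<^sup>1\<close>
  (\<open>quot_dim_curve\<close>): these powers span because \<open>T = 0\<close> eliminates the other coordinate, and they are
  independent because restriction to the curve turns a relation among them into a polynomial of
  degree below \<open>n\<close> that vanishes to order \<open>n\<close>.

  In the case \<open>D\<^sup>2\<^sub>1\<close> the curve is the \<open>x\<close>-axis and \<open>n = 1\<close>: the linear parts of \<open>B\<close> and \<open>C\<close> are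
  independent. In the two cases \<open>D\<^sup>2\<^sub>h\<close> it is a coordinate axis and \<open>n = 2\<close>. In the cases
  \<open>D\<^sup>2\<^sub>2\<^sub>p\<close> and \<open>D\<^sup>2\<^sub>3\<close> the linear parts are both multiples of \<open>y\<close>. The
  parabola \<open>y = \<alpha> x\<^sup>2\<close> with \<open>\<alpha> = - d\<^sub>3\<^sub>1 / (2 b)\<close> osculates the curve \<open>C = 0\<close>; on it, the
  coefficient of \<open>x\<^sup>2\<close> in \<open>B\<close> is \<open>- \<chi> / (2 b)\<close>, which vanishes, and for \<open>n = 3\<close> the determinant
  equals \<open>- \<xi> / (6 b)\<close> up to terms vanishing at the origin. It suffices to know \<open>B\<close> and \<open>C\<close>
  modulo the ideal generated by \<open>x\<^sup>4, x\<^sup>2 y, x y\<^sup>2, y\<^sup>3\<close> (\<open>curv_b_jet\<close>, \<open>curv_c_jet\<close>).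

  The origin is umbilic because there \<open>f\<^sub>x = f\<^sub>y = f\<^sub>x\<^sub>y = 0\<close> and \<open>f\<^sub>x\<^sub>x = f\<^sub>y\<^sub>y = \<kappa>\<close>.

  The analytic input connects the real surface with germs of holomorphic functions. A power series
  in two real variables extends to a holomorphic function, partial derivatives of the extension
  extend the real partial derivatives, and the extension is unique. Partial derivatives and the
  Hadamard quotients \<open>\<phi>\<^sub>1, \<phi>\<^sub>2\<close> in \<open>\<phi> = \<phi>(0) + x \<phi>\<^sub>1 + y \<phi>\<^sub>2\<close> are again holomorphic. Finally, a germ
  whose real restriction is \<open>O(|p|\<^sup>k)\<close> lies in the \<open>k\<close>-th power of the maximal ideal
  (\<open>extends_bigo_imp_max_power\<close>), so the remainder in the expansion of \<open>f\<close> may be differentiated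
  twice with the expected loss of two orders.
\<close>

section \<open>Holomorphic functions on bidiscs\<close>

text \<open>Continuous and separately holomorphic. By Osgood's lemma, proved below as
  \<open>holomorphic_at_origin_iff_bidisc\<close>, this is equivalent to complex differentiability, and it
  allows one-variable theory to be applied to each slice.\<close>

definition bidisc_holomorphic :: "real \<Rightarrow> (complex \<times> complex \<Rightarrow> complex) \<Rightarrow> bool" where
  "bidisc_holomorphic r F \<longleftrightarrow>
    continuous_on (ball 0 r \<times> ball 0 r) F \<and>
    (\<forall>w\<in>ball 0 r. (\<lambda>z. F (z, w)) holomorphic_on ball 0 r) \<and>
    (\<forall>z\<in>ball 0 r. (\<lambda>w. F (z, w)) holomorphic_on ball 0 r)"

definition pderiv1 :: "(complex \<times> complex \<Rightarrow> complex) \<Rightarrow> complex \<times> complex \<Rightarrow> complex" where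
  "pderiv1 F p = deriv (\<lambda>z. F (z, snd p)) (fst p)"

definition pderiv2 :: "(complex \<times> complex \<Rightarrow> complex) \<Rightarrow> complex \<times> complex \<Rightarrow> complex" where
  "pderiv2 F p = deriv (\<lambda>w. F (fst p, w)) (snd p)"

lemma bidisc_holomorphic_swap:
  assumes "bidisc_holomorphic r F"
  shows "bidisc_holomorphic r (\<lambda>p. F (snd p, fst p))"
proof -
  have "continuous_on (ball 0 r \<times> ball 0 r) F"
    using assms by (simp add: bidisc_holomorphic_def)
  then have "continuous_on (ball 0 r \<times> ball 0 r) (\<lambda>p. F (snd p, fst p))"
    by (rule continuous_on_compose2) (auto intro!: continuous_intros)
  then show ?thesis using assms by (simp add: bidisc_holomorphic_def)
qed

lemma pderiv1_swap: "pderiv1 (\<lambda>p. F (snd p, fst p)) p = pderiv2 F (snd p, fst p)"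
  by (simp add: pderiv1_def pderiv2_def)

lemma bidisc_holomorphic_subset:
  assumes "bidisc_holomorphic r F" "s \<le> r"
  shows "bidisc_holomorphic s F"
proof -
  have sub: "ball 0 s \<subseteq> ball (0::complex) r" using assms(2) by auto
  show ?thesis
    unfolding bidisc_holomorphic_def
  proof (intro conjI ballI)
    show "continuous_on (ball 0 s \<times> ball 0 s) F"
      using assms(1) Sigma_mono[OF sub sub] continuous_on_subset
      unfolding bidisc_holomorphic_def by blast
    show "(\<lambda>z. F (z, w)) holomorphic_on ball 0 s" "(\<lambda>z. F (w, z)) holomorphic_on ball 0 s"
      if "w \<in> ball 0 s" for w
      using assms(1) subsetD[OF sub that] holomorphic_on_subset[OF _ sub]
      by (simp_all add: bidisc_holomorphic_def)
  qed
qed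

text \<open>Cauchy's formula for the first derivative in the first variable, written as an integral over
  the parameter interval of the circle so that continuity and differentiability in the other
  variable follow from theorems on parameter integrals.\<close>

lemma pderiv1_integral:
  assumes F: "bidisc_holomorphic r F" and z: "norm z < s" and s: "s < r" and w: "norm w < r"
  shows "pderiv1 F (z, w) = 1 / (2 * of_real pi * \<i>) *
    integral (cbox 0 1) (\<lambda>t. F (circlepath 0 s t, w) / (circlepath 0 s t - z)\<^sup>2 *
      (2 * of_real pi * \<i> * s * exp (2 * of_real pi * \<i> * t)))"
proof -
  have hol: "(\<lambda>z. F (z, w)) holomorphic_on ball 0 r"
    using F w by (auto simp: bidisc_holomorphic_def)
  have sub: "cball 0 s \<subseteq> ball (0::complex) r" using s by auto
  have "((\<lambda>z. F (z, w)) has_field_derivative 1 / (2 * of_real pi * \<i>) *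
      contour_integral (circlepath 0 s) (\<lambda>u. F (u, w) / (u - z)\<^sup>2)) (at z)"
    using z
    by (intro Cauchy_derivative_integral_circlepath holomorphic_on_imp_continuous_on
        holomorphic_on_subset[OF hol sub] holomorphic_on_subset[OF hol order_trans[OF ball_subset_cball sub]]) simp
  then show ?thesis
    unfolding pderiv1_def
    by (simp add: DERIV_imp_deriv contour_integral_integral vector_derivative_circlepath)
qed

lemma circlepath_minus_neq:
  assumes "norm z < s"
  shows "circlepath 0 s t - z \<noteq> 0"
proof
  assume "circlepath 0 s t - z = 0"
  then have "norm z = norm (circlepath 0 s t)" by simp
  also have "\<dots> = s" using assms norm_ge_zero[of z]
    by (simp add: circlepath norm_mult del: norm_ge_zero)
  finally show False using assms by simp
qed

lemma norm_circlepath: "0 \<le> s \<Longrightarrow> norm (circlepath 0 s t) = s"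
  by (simp add: circlepath norm_mult)

lemma continuous_on_circlepath [continuous_intros]:
  "continuous_on A g \<Longrightarrow> continuous_on A (\<lambda>x. circlepath z s (g x))"
  unfolding circlepath by (intro continuous_intros)

text \<open>The Cauchy integral has an integrand that is continuous in all variables jointly as long as the
  circle stays away from the point.\<close>

lemma continuous_on_pderiv1:
  assumes F: "bidisc_holomorphic r F"
  shows "continuous_on (ball 0 r \<times> ball 0 r) (pderiv1 F)"
proof (rule continuous_at_imp_continuous_on, rule ballI)
  fix p :: "complex \<times> complex" assume p: "p \<in> ball 0 r \<times> ball 0 r"
  then have "norm (fst p) < r" by auto
  then obtain s where s: "norm (fst p) < s" "s < r" using dense by blast
  have s0: "0 < s" using s(1) norm_ge_zero[of "fst p"] by linarith
  have contF: "continuous_on (ball 0 r \<times> ball 0 r) F" using F by (simp add: bidisc_holomorphic_def)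
  have "continuous_on (ball 0 s \<times> ball 0 r) (\<lambda>p. integral (cbox 0 1)
      (\<lambda>t. F (circlepath 0 s t, snd p) / (circlepath 0 s t - fst p)\<^sup>2 *
      (2 * of_real pi * \<i> * s * exp (2 * of_real pi * \<i> * t))))"
    unfolding split_beta
    by (intro integral_continuous_on_param, unfold split_beta, intro continuous_intros continuous_on_compose2[OF contF])
      (use s s0 circlepath_minus_neq in \<open>auto simp: norm_circlepath\<close>)
  then have "continuous_on (ball 0 s \<times> ball 0 r) (\<lambda>p. 1 / (2 * of_real pi * \<i>) * integral (cbox 0 1)
      (\<lambda>t. F (circlepath 0 s t, snd p) / (circlepath 0 s t - fst p)\<^sup>2 *
      (2 * of_real pi * \<i> * s * exp (2 * of_real pi * \<i> * t))))"
    by (rule continuous_on_mult_left)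
  moreover have "1 / (2 * of_real pi * \<i>) * integral (cbox 0 1)
      (\<lambda>t. F (circlepath 0 s t, snd q) / (circlepath 0 s t - fst q)\<^sup>2 *
      (2 * of_real pi * \<i> * s * exp (2 * of_real pi * \<i> * t))) = pderiv1 F q"
    if "q \<in> ball 0 s \<times> ball 0 r" for q
    using pderiv1_integral[OF F, of "fst q" s "snd q"] that s by auto
  ultimately have "continuous_on (ball 0 s \<times> ball 0 r) (pderiv1 F)"
    using continuous_on_cong by (metis (no_types, lifting))
  moreover have "open (ball 0 s \<times> ball (0::complex) r)" "p \<in> ball 0 s \<times> ball 0 r"
    using p s by (auto intro: open_Times)
  ultimately show "isCont (pderiv1 F) p"
    by (metis continuous_on_eq_continuous_at)
qed

lemma continuous_on_pderiv2:
  assumes F: "bidisc_holomorphic r F"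
  shows "continuous_on (ball 0 r \<times> ball 0 r) (pderiv2 F)"
proof -
  have "continuous_on (ball 0 r \<times> ball 0 r) (\<lambda>p. pderiv1 (\<lambda>p. F (snd p, fst p)) (snd p, fst p))"
    by (rule continuous_on_compose2[OF continuous_on_pderiv1[OF bidisc_holomorphic_swap[OF F]]])
      (auto intro!: continuous_intros)
  then show ?thesis by (simp add: pderiv1_swap)
qed

lemma DERIV_pderiv1:
  assumes "bidisc_holomorphic r F" "norm z < r" "norm w < r"
  shows "((\<lambda>z. F (z, w)) has_field_derivative pderiv1 F (z, w)) (at z)"
  using holomorphic_derivI[of "\<lambda>z. F (z, w)" "ball 0 r" z] assms
  by (simp add: bidisc_holomorphic_def pderiv1_def)

lemma DERIV_pderiv2:
  assumes "bidisc_holomorphic r F" "norm z < r" "norm w < r"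
  shows "((\<lambda>w. F (z, w)) has_field_derivative pderiv2 F (z, w)) (at w)"
  using holomorphic_derivI[of "\<lambda>w. F (z, w)" "ball 0 r" w] assms
  by (simp add: bidisc_holomorphic_def pderiv2_def)

text \<open>In the second variable one differentiates the Cauchy integral under the integral sign; this
  needs the joint continuity of the second partial derivative.\<close>

lemma bidisc_holomorphic_pderiv1:
  assumes F: "bidisc_holomorphic r F"
  shows "bidisc_holomorphic r (pderiv1 F)"
  unfolding bidisc_holomorphic_def
proof (intro conjI ballI)
  show "continuous_on (ball 0 r \<times> ball 0 r) (pderiv1 F)" by (rule continuous_on_pderiv1[OF F])
next
  fix w :: complex assume w: "w \<in> ball 0 r"
  then have "deriv (\<lambda>z. F (z, w)) holomorphic_on ball 0 r"
    using F by (intro holomorphic_deriv) (auto simp: bidisc_holomorphic_def)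
  then show "(\<lambda>z. pderiv1 F (z, w)) holomorphic_on ball 0 r"
    by (simp add: pderiv1_def)
next
  fix z :: complex assume z: "z \<in> ball 0 r"
  then have "norm z < r" by auto
  then obtain s where s: "norm z < s" "s < r" using dense by blast
  have s0: "0 < s" using s(1) norm_ge_zero[of z] by linarith
  have contF: "continuous_on (ball 0 r \<times> ball 0 r) F" using F by (simp add: bidisc_holomorphic_def)
  have cont2: "continuous_on (ball 0 r \<times> ball 0 r) (pderiv2 F)" by (rule continuous_on_pderiv2[OF F])
  define K where "K t = (2 * of_real pi * \<i> * s * exp (2 * of_real pi * \<i> * t)) / (circlepath 0 s t - z)\<^sup>2"
    for t :: real
  have K: "continuous_on A K" for A
    unfolding K_def by (intro continuous_intros) (use circlepath_minus_neq[OF s(1)] in auto)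
  have "((\<lambda>w. integral (cbox 0 1) (\<lambda>t. F (circlepath 0 s t, w) * K t)) has_field_derivative
      integral (cbox 0 1) (\<lambda>t. pderiv2 F (circlepath 0 s t, w) * K t)) (at w within ball 0 r)"
    if w: "w \<in> ball 0 r" for w
  proof (rule leibniz_rule_field_derivative[OF _ _ _ w])
    fix w :: complex and t :: real assume "w \<in> ball 0 r" "t \<in> cbox 0 1"
    then show "((\<lambda>w. F (circlepath 0 s t, w) * K t) has_field_derivative
        pderiv2 F (circlepath 0 s t, w) * K t) (at w within ball 0 r)"
      using s s0
      by (intro DERIV_cmult_right has_field_derivative_at_within[OF DERIV_pderiv2[OF F]])
        (auto simp: norm_circlepath)
  next
    fix w :: complex assume "w \<in> ball 0 r"
    then show "(\<lambda>t. F (circlepath 0 s t, w) * K t) integrable_on cbox 0 1"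
      by (intro integrable_continuous continuous_intros K continuous_on_compose2[OF contF])
        (use s s0 in \<open>auto simp: norm_circlepath\<close>)
  next
    show "continuous_on (ball 0 r \<times> cbox 0 1) (\<lambda>(w, t). pderiv2 F (circlepath 0 s t, w) * K t)"
      unfolding split_beta
      by (intro continuous_intros continuous_on_compose2[OF K] continuous_on_compose2[OF cont2])
        (use s s0 in \<open>auto simp: norm_circlepath\<close>)
  qed auto
  then have "(\<lambda>w. integral (cbox 0 1) (\<lambda>t. F (circlepath 0 s t, w) * K t)) holomorphic_on ball 0 r"
    unfolding holomorphic_on_def field_differentiable_def by blast
  then have "(\<lambda>w. 1 / (2 * of_real pi * \<i>) * integral (cbox 0 1) (\<lambda>t. F (circlepath 0 s t, w) * K t))
      holomorphic_on ball 0 r"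
    by (intro holomorphic_intros) auto
  then show "(\<lambda>w. pderiv1 F (z, w)) holomorphic_on ball 0 r"
    by (rule holomorphic_transform) (use s in \<open>auto simp: pderiv1_integral[OF F s] K_def\<close>)
qed

lemma bidisc_holomorphic_pderiv2:
  assumes F: "bidisc_holomorphic r F"
  shows "bidisc_holomorphic r (pderiv2 F)"
proof -
  have "bidisc_holomorphic r (\<lambda>p. pderiv1 (\<lambda>p. F (snd p, fst p)) (snd p, fst p))"
    by (rule bidisc_holomorphic_swap[OF bidisc_holomorphic_pderiv1[OF bidisc_holomorphic_swap[OF F]]])
  then show ?thesis by (simp add: pderiv1_swap)
qed

text \<open>Osgood's lemma: both partial derivatives exist and are jointly continuous.\<close>

lemma bidisc_holomorphic_has_derivative:
  assumes F: "bidisc_holomorphic r F" and p: "p \<in> ball 0 r \<times> ball 0 r"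
  shows "(F has_derivative (\<lambda>(h, k). pderiv1 F p * h + pderiv2 F p * k)) (at p)"
proof -
  obtain z w where [simp]: "p = (z, w)" by (cases p)
  have zw: "norm z < r" "norm w < r" using p by auto
  let ?D = "\<lambda>x y. blinfun_mult_right (pderiv2 F (x, y))"
  have "((\<lambda>(x, y). F (x, y)) has_derivative (\<lambda>(h, k). pderiv1 F (z, w) * h + ?D z w k))
      (at (z, w) within ball 0 r \<times> ball 0 r)"
  proof (rule has_derivative_partialsI)
    show "((\<lambda>x. F (x, w)) has_derivative (*) (pderiv1 F (z, w))) (at z within ball 0 r)"
      using DERIV_pderiv1[OF F zw] by (simp add: has_field_derivative_def has_derivative_at_withinI)
    show "((\<lambda>y. F (x, y)) has_derivative ?D x y) (at y within ball 0 r)"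
      if "x \<in> ball 0 r" "y \<in> ball 0 r" for x y
      using DERIV_pderiv2[OF F, of x y] that
      by (simp add: has_field_derivative_def has_derivative_at_withinI)
    have "continuous_on (ball 0 r \<times> ball 0 r) (\<lambda>p. blinfun_mult_right (pderiv2 F p))"
      by (intro bounded_linear.continuous_on[OF bounded_linear_blinfun_mult_right]
        continuous_on_pderiv2[OF F])
    moreover have "(\<lambda>(x, y). ?D x y) = (\<lambda>p. blinfun_mult_right (pderiv2 F p))" by auto
    ultimately show "continuous (at (z, w) within ball 0 r \<times> ball 0 r) (\<lambda>(x, y). ?D x y)"
      using zw by (simp add: continuous_on_eq_continuous_within)
  qed (use zw in auto)
  moreover have "at (z, w) within ball 0 r \<times> ball 0 r = at (z, w)"
    using zw by (intro at_within_open) (auto intro: open_Times)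
  ultimately show ?thesis by (simp add: split_beta)
qed

lemma holomorphic_at_origin_iff_bidisc:
  "holomorphic_at_origin F \<longleftrightarrow> (\<exists>r>0. bidisc_holomorphic r F)"
proof
  assume "holomorphic_at_origin F"
  then obtain U where U: "open U" "0 \<in> U"
    "\<forall>p\<in>U. \<exists>\<alpha> \<beta>. (F has_derivative (\<lambda>(h, k). \<alpha> * h + \<beta> * k)) (at p)"
    unfolding holomorphic_at_origin_def by (elim exE conjE)
  obtain A B where AB: "open A" "open B" "0 \<in> A \<times> B" "A \<times> B \<subseteq> U"
    by (rule open_prod_elim[OF U(1,2)])
  then have "open (A \<inter> B)" "0 \<in> A \<inter> B" by (simp_all add: zero_prod_def open_Int)
  then obtain r where r: "r > 0" "ball 0 r \<subseteq> A \<inter> B"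
    by (rule openE)
  have der: "\<exists>\<alpha> \<beta>. (F has_derivative (\<lambda>(h, k). \<alpha> * h + \<beta> * k)) (at (z, w))"
    if "norm z < r" "norm w < r" for z w
    proof -
    have "z \<in> A" "w \<in> B" using r(2) that by auto
    then have "(z, w) \<in> U" using AB(4) by blast
    then show ?thesis using U(3) by blast
  qed
  have "bidisc_holomorphic r F"
    unfolding bidisc_holomorphic_def
  proof (intro conjI ballI)
    show "continuous_on (ball 0 r \<times> ball 0 r) F"
    proof (rule continuous_at_imp_continuous_on, rule ballI)
      fix p :: "complex \<times> complex" assume "p \<in> ball 0 r \<times> ball 0 r"
      then show "isCont F p"
        using der[of "fst p" "snd p"] has_derivative_continuous[of F _ p UNIV] by auto
    qed
  next
    fix w :: complex assume w: "w \<in> ball 0 r"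
    show "(\<lambda>z. F (z, w)) holomorphic_on ball 0 r"
    proof (rule holomorphic_onI)
      fix z :: complex assume z: "z \<in> ball 0 r"
      obtain \<alpha> \<beta> where "(F has_derivative (\<lambda>(h, k). \<alpha> * h + \<beta> * k)) (at (z, w))"
        using der[of z w] z w by auto
      moreover have "((\<lambda>z. (z, w)) has_derivative (\<lambda>h. (h, 0))) (at z)"
        by (rule has_derivative_Pair[OF has_derivative_ident has_derivative_const])
      ultimately have "((\<lambda>z. F (z, w)) has_derivative (\<lambda>h. case (h, 0) of (h, k) \<Rightarrow> \<alpha> * h + \<beta> * k)) (at z)"
        by (rule has_derivative_compose[of "\<lambda>z. (z, w)" _ z UNIV F, rotated])
      then have "((\<lambda>z. F (z, w)) has_field_derivative \<alpha>) (at z)"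
        unfolding has_field_derivative_def by (rule has_derivative_eq_rhs) auto
      then show "(\<lambda>z. F (z, w)) field_differentiable at z within ball 0 r"
        using field_differentiable_at_within unfolding field_differentiable_def by blast
    qed
  next
    fix z :: complex assume z: "z \<in> ball 0 r"
    show "(\<lambda>w. F (z, w)) holomorphic_on ball 0 r"
    proof (rule holomorphic_onI)
      fix w :: complex assume w: "w \<in> ball 0 r"
      obtain \<alpha> \<beta> where "(F has_derivative (\<lambda>(h, k). \<alpha> * h + \<beta> * k)) (at (z, w))"
        using der[of z w] z w by auto
      moreover have "((\<lambda>w. (z, w)) has_derivative (\<lambda>k. (0, k))) (at w)"
        by (rule has_derivative_Pair[OF has_derivative_const has_derivative_ident])
      ultimately have "((\<lambda>w. F (z, w)) has_derivative (\<lambda>k. case (0, k) of (h, k) \<Rightarrow> \<alpha> * h + \<beta> * k)) (at w)"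
        by (rule has_derivative_compose[of "\<lambda>w. (z, w)" _ w UNIV F, rotated])
      then have "((\<lambda>w. F (z, w)) has_field_derivative \<beta>) (at w)"
        unfolding has_field_derivative_def by (rule has_derivative_eq_rhs) auto
      then show "(\<lambda>w. F (z, w)) field_differentiable at w within ball 0 r"
        using field_differentiable_at_within unfolding field_differentiable_def by blast
    qed
  qed
  with r(1) show "\<exists>r>0. bidisc_holomorphic r F" by blast
next
  assume "\<exists>r>0. bidisc_holomorphic r F"
  then obtain r where r: "r > 0" "bidisc_holomorphic r F" by blast
  have "open (ball 0 r \<times> ball (0::complex) r)" by (intro open_Times open_ball)
  moreover have "0 \<in> ball 0 r \<times> ball (0::complex) r" using r by (simp add: zero_prod_def)
  ultimately show "holomorphic_at_origin F"
    unfolding holomorphic_at_origin_def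
    by (intro exI[of _ "ball 0 r \<times> ball 0 r"] conjI ballI exI)
      (assumption | erule bidisc_holomorphic_has_derivative[OF r(2)])+
qed

section \<open>Radial means, the identity theorem and real power series\<close>

text \<open>Bidiscs form a neighbourhood basis. The statement is for general normed spaces because it is used
  both for the real and for the complex plane.\<close>

lemma eventually_nhds_0_bidisc:
  fixes P :: "'a::real_normed_vector \<times> 'b::real_normed_vector \<Rightarrow> bool"
  shows "eventually P (nhds 0) \<longleftrightarrow> (\<exists>r>0. \<forall>z w. norm z < r \<longrightarrow> norm w < r \<longrightarrow> P (z, w))"
proof
  assume "eventually P (nhds 0)"
  then obtain U where U: "open U" "0 \<in> U" "\<And>p. p \<in> U \<Longrightarrow> P p"
    unfolding eventually_nhds by blast
  obtain A B where AB: "open A" "open B" "0 \<in> A \<times> B" "A \<times> B \<subseteq> U"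
    by (rule open_prod_elim[OF U(1,2)])
  from AB have "0 \<in> A" "0 \<in> B" by (simp_all add: zero_prod_def)
  obtain r where r: "r > 0" "ball 0 r \<subseteq> A" by (rule openE[OF \<open>open A\<close> \<open>0 \<in> A\<close>])
  obtain s where s: "s > 0" "ball 0 s \<subseteq> B" by (rule openE[OF \<open>open B\<close> \<open>0 \<in> B\<close>])
  have "P (z, w)" if "norm z < min r s" "norm w < min r s" for z w
  proof -
    have "z \<in> ball 0 r" "w \<in> ball 0 s" using that by simp_all
    then have "z \<in> A" "w \<in> B" using r(2) s(2) by blast+
    then show ?thesis using AB U by blast
  qed
  then show "\<exists>r>0. \<forall>z w. norm z < r \<longrightarrow> norm w < r \<longrightarrow> P (z, w)"
    using r(1) s(1) by (intro exI[of _ "min r s"]) simp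
next
  assume "\<exists>r>0. \<forall>z w. norm z < r \<longrightarrow> norm w < r \<longrightarrow> P (z, w)"
  then obtain r where r: "r > 0" "\<forall>z w. norm z < r \<longrightarrow> norm w < r \<longrightarrow> P (z, w)" by blast
  have "open (ball (0::'a) r \<times> ball (0::'b) r)" by (intro open_Times open_ball)
  moreover have "0 \<in> ball (0::'a) r \<times> ball (0::'b) r" using r by (simp add: zero_prod_def)
  moreover have "\<forall>p\<in>ball (0::'a) r \<times> ball (0::'b) r. P p"
  proof
    fix p assume "p \<in> ball (0::'a) r \<times> ball (0::'b) r"
    then show "P p" using r(2) by (cases p) simp
  qed
  ultimately show "eventually P (nhds 0)"
    unfolding eventually_nhds by (intro exI[of _ "ball 0 r \<times> ball 0 r"] conjI)
qed

text \<open>The mean of a function over the segment from the origin to \<open>p\<close>; applied to the partial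
  derivatives it yields the quotients in Hadamard's lemma.\<close>

definition radial_mean :: "(complex \<times> complex \<Rightarrow> complex) \<Rightarrow> complex \<times> complex \<Rightarrow> complex" where
  "radial_mean F p = integral (cbox 0 1) (\<lambda>t. F (of_real t * fst p, of_real t * snd p))"

lemma norm_of_real_mult_less:
  assumes "t \<in> cbox 0 (1::real)" "norm (z::complex) < r"
  shows "norm (of_real t * z) < r"
proof -
  have "norm (of_real t * z) = t * norm z" using assms by (simp add: norm_mult)
  also have "\<dots> \<le> norm z" using assms by (simp add: mult_left_le_one_le)
  finally show ?thesis using assms by simp
qed

lemma bidisc_holomorphic_continuous_on_slice:
  assumes "bidisc_holomorphic r F" "norm z < r" "norm w < r"
  shows "continuous_on (cbox 0 1) (\<lambda>t. F (of_real t * z, of_real t * w))"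
proof -
  have "continuous_on (ball 0 r \<times> ball 0 r) F" using assms by (simp add: bidisc_holomorphic_def)
  moreover have "continuous_on (cbox 0 1) (\<lambda>t::real. (of_real t * z, of_real t * w))"
    by (intro continuous_intros)
  ultimately show ?thesis
    by (rule continuous_on_compose2) (use norm_of_real_mult_less assms in auto)
qed

lemma radial_mean_slice_holomorphic:
  assumes F: "bidisc_holomorphic r F" and w: "norm w < r"
  shows "(\<lambda>z. radial_mean F (z, w)) holomorphic_on ball 0 r"
proof -
  have cont1: "continuous_on (ball 0 r \<times> ball 0 r) (pderiv1 F)" by (rule continuous_on_pderiv1[OF F])
  have "((\<lambda>z. integral (cbox 0 1) (\<lambda>t. F (of_real t * z, of_real t * w))) has_field_derivative
      integral (cbox 0 1) (\<lambda>t. of_real t * pderiv1 F (of_real t * z, of_real t * w))) (at z within ball 0 r)"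
    if z: "z \<in> ball 0 r" for z
  proof (rule leibniz_rule_field_derivative[OF _ _ _ z])
    fix z :: complex and t :: real assume z: "z \<in> ball 0 r" and t: "t \<in> cbox 0 1"
    have "((\<lambda>z. of_real t * z) has_field_derivative of_real t) (at z)"
      by (auto intro!: derivative_eq_intros)
    from DERIV_chain2[OF DERIV_pderiv1[OF F] this] z w t norm_of_real_mult_less[OF t]
    have "((\<lambda>z. F (of_real t * z, of_real t * w)) has_field_derivative
        pderiv1 F (of_real t * z, of_real t * w) * of_real t) (at z)"
      by auto
    then show "((\<lambda>z. F (of_real t * z, of_real t * w)) has_field_derivative
        of_real t * pderiv1 F (of_real t * z, of_real t * w)) (at z within ball 0 r)"
      by (simp add: has_field_derivative_at_within mult.commute)
  next
    fix z :: complex assume "z \<in> ball 0 r"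
    then show "(\<lambda>t. F (of_real t * z, of_real t * w)) integrable_on cbox 0 1"
      by (intro integrable_continuous bidisc_holomorphic_continuous_on_slice[OF F _ w]) auto
  next
    have "continuous_on (ball 0 r \<times> cbox 0 1)
        (\<lambda>x. of_real (snd x) * pderiv1 F (of_real (snd x) * fst x, of_real (snd x) * w))"
      by (intro continuous_intros continuous_on_compose2[OF cont1])
        (use norm_of_real_mult_less w in auto)
    then show "continuous_on (ball 0 r \<times> cbox 0 1)
        (\<lambda>(z, t). of_real t * pderiv1 F (of_real t * z, of_real t * w))"
      by (simp add: split_beta)
  qed auto
  then show ?thesis
    unfolding holomorphic_on_def field_differentiable_def radial_mean_def fst_conv snd_conv by blast
qed

lemma radial_mean_swap:
  "radial_mean (\<lambda>p. F (snd p, fst p)) p = radial_mean F (snd p, fst p)"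
  by (simp add: radial_mean_def)

lemma bidisc_holomorphic_radial_mean:
  assumes F: "bidisc_holomorphic r F"
  shows "bidisc_holomorphic r (radial_mean F)"
proof -
  have contF: "continuous_on (ball 0 r \<times> ball 0 r) F" using F by (simp add: bidisc_holomorphic_def)
  have "continuous_on ((ball 0 r \<times> ball 0 r) \<times> cbox 0 1)
      (\<lambda>x. F (of_real (snd x) * fst (fst x), of_real (snd x) * snd (fst x)))"
    by (intro continuous_intros continuous_on_compose2[OF contF])
      (use norm_of_real_mult_less in auto)
  then have "continuous_on (ball 0 r \<times> ball 0 r) (radial_mean F)"
    unfolding radial_mean_def by (intro integral_continuous_on_param) (simp add: split_beta)
  moreover have "(\<lambda>w. radial_mean F (z, w)) holomorphic_on ball 0 r" if "norm z < r" for z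
    using radial_mean_slice_holomorphic[OF bidisc_holomorphic_swap[OF F] that]
    by (simp add: radial_mean_swap)
  ultimately show ?thesis
    using radial_mean_slice_holomorphic[OF F] by (simp add: bidisc_holomorphic_def)
qed

text \<open>The fundamental theorem of calculus along the segment from the origin to \<open>(z, w)\<close>.\<close>

lemma bidisc_holomorphic_hadamard:
  assumes F: "bidisc_holomorphic r F" and z: "norm z < r" and w: "norm w < r"
  shows "F (z, w) = F 0 + z * radial_mean (pderiv1 F) (z, w) + w * radial_mean (pderiv2 F) (z, w)"
proof -
  let ?\<gamma> = "\<lambda>t::real. (of_real t * z, of_real t * w)"
  let ?F' = "\<lambda>t. pderiv1 F (?\<gamma> t) * z + pderiv2 F (?\<gamma> t) * w"
  have "(?F' has_integral F (?\<gamma> 1) - F (?\<gamma> 0)) {0..1}"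
  proof (rule fundamental_theorem_of_calculus)
    fix t :: real assume t: "t \<in> {0..1}"
    have \<gamma>: "(?\<gamma> has_derivative (\<lambda>h. (of_real h * z, of_real h * w))) (at t within {0..1})"
      by (auto intro!: derivative_eq_intros)
    have "?\<gamma> t \<in> ball 0 r \<times> ball 0 r" using norm_of_real_mult_less t z w by auto
    from has_derivative_compose[OF \<gamma> bidisc_holomorphic_has_derivative[OF F this]]
    show "((\<lambda>t. F (?\<gamma> t)) has_vector_derivative ?F' t) (at t within {0..1})"
      unfolding has_vector_derivative_def
      by (rule has_derivative_eq_rhs) (auto simp: algebra_simps scaleR_conv_of_real)
  qed auto
  then have "integral (cbox 0 1) ?F' = F (z, w) - F 0"
    by (simp add: integral_unique zero_prod_def)
  moreover have "integral (cbox 0 1) ?F' =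
      radial_mean (pderiv1 F) (z, w) * z + radial_mean (pderiv2 F) (z, w) * w"
  proof -
    have i: "(\<lambda>t. pderiv1 F (?\<gamma> t)) integrable_on cbox 0 1" "(\<lambda>t. pderiv2 F (?\<gamma> t)) integrable_on cbox 0 1"
      by (rule integrable_continuous[OF bidisc_holomorphic_continuous_on_slice],
        (rule bidisc_holomorphic_pderiv1[OF F] bidisc_holomorphic_pderiv2[OF F] z w)+)+
    have "integral (cbox 0 1) ?F' = integral (cbox 0 1) (\<lambda>t. pderiv1 F (?\<gamma> t) * z) +
        integral (cbox 0 1) (\<lambda>t. pderiv2 F (?\<gamma> t) * w)"
      by (rule Henstock_Kurzweil_Integration.integral_add)
        (use i integrable_on_mult_left in blast)+
    then show ?thesis by (simp add: radial_mean_def)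
  qed
  ultimately show ?thesis by (simp add: algebra_simps)
qed

lemma islimpt_of_real_interval:
  assumes "0 < r"
  shows "(0::complex) islimpt of_real ` {-r<..<r}"
  unfolding islimpt_approachable
proof (intro allI impI)
  fix e :: real assume e: "0 < e"
  show "\<exists>x'\<in>of_real ` {-r<..<r}. x' \<noteq> 0 \<and> dist x' (0::complex) < e"
    using e assms by (intro bexI[of _ "of_real (min e r / 2)"] imageI) (auto simp: min_def)
qed

lemma holomorphic_zero_on_real_interval:
  assumes "g holomorphic_on ball 0 r" "\<And>x::real. \<bar>x\<bar> < r \<Longrightarrow> g (of_real x) = 0" "norm z < r"
  shows "g z = 0"
proof -
  have r: "0 < r" using assms(3) norm_ge_zero[of z] by linarith
  show ?thesis
  proof (rule analytic_continuation[OF assms(1)])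
    show "(0::complex) islimpt of_real ` {-r<..<r}" by (rule islimpt_of_real_interval[OF r])
    show "\<And>z. z \<in> of_real ` {-r<..<r} \<Longrightarrow> g z = 0" using assms(2) by (auto simp: abs_less_iff)
  qed (use r assms(3) in auto)
qed

text \<open>The one-variable identity theorem, applied first in \<open>z\<close> for real \<open>w\<close> and then in \<open>w\<close>.\<close>

lemma bidisc_holomorphic_zero_on_reals:
  assumes F: "bidisc_holomorphic r F"
    and zero: "\<And>x y::real. \<bar>x\<bar> < r \<Longrightarrow> \<bar>y\<bar> < r \<Longrightarrow> F (of_real x, of_real y) = 0"
    and z: "norm z < r" and w: "norm w < r"
  shows "F (z, w) = 0"
proof -
  have 1: "F (z, of_real y) = 0" if "\<bar>y\<bar> < r" for y
    using F that zero z
    by (intro holomorphic_zero_on_real_interval[of "\<lambda>z. F (z, of_real y)" r z])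
      (auto simp: bidisc_holomorphic_def)
  show ?thesis
    using F 1 z w
    by (intro holomorphic_zero_on_real_interval[of "\<lambda>w. F (z, w)" r w])
      (auto simp: bidisc_holomorphic_def)
qed

text \<open>On a smaller closed bidisc the series is dominated by its absolute values at a real corner, so the
  Weierstrass test gives uniform convergence of the complexified series.\<close>

lemma real_power_series_extends:
  fixes A :: "nat \<Rightarrow> nat \<Rightarrow> real"
  assumes r: "r > 0"
    and f: "\<And>x y. \<bar>x\<bar> < r \<Longrightarrow> \<bar>y\<bar> < r \<Longrightarrow> ((\<lambda>(i, j). A i j * x ^ i * y ^ j) has_sum f (x, y)) UNIV"
  obtains F s where "s > 0" "bidisc_holomorphic s F"
    "\<And>x y. \<bar>x\<bar> < s \<Longrightarrow> \<bar>y\<bar> < s \<Longrightarrow> F (of_real x, of_real y) = of_real (f (x, y))"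
proof -
  \<comment> \<open>Any radius below \<open>r\<close> works: the series has to converge at the corner \<open>(s, s)\<close>.\<close>
  define s where "s = r / 2"
  have s: "0 < s" "s < r" using r by (auto simp: s_def)
  define a where "a = (\<lambda>(i, j) (p :: complex \<times> complex). of_real (A i j) * fst p ^ i * snd p ^ j)"
  define M where "M = (\<lambda>(i, j). \<bar>A i j\<bar> * s ^ i * s ^ j)"
  define F where "F p = (\<Sum>\<^sub>\<infinity>k. a k p)" for p
  have "(\<lambda>(i, j). A i j * s ^ i * s ^ j) summable_on UNIV"
    using f[of s s] s has_sum_imp_summable by fastforce
  then have "(\<lambda>k. norm (case k of (i, j) \<Rightarrow> A i j * s ^ i * s ^ j)) summable_on UNIV"
    by (rule summable_on_iff_abs_summable_on_real[THEN iffD1])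
  moreover have "norm (case k of (i, j) \<Rightarrow> A i j * s ^ i * s ^ j) = M k" for k
    using s by (auto simp: M_def abs_mult split: prod.split)
  ultimately have M: "M summable_on UNIV" by simp
  have le: "norm (a k p) \<le> M k" if "p \<in> cball 0 s \<times> cball 0 s" for k p
  proof -
    have "norm (fst p) \<le> s" "norm (snd p) \<le> s" using that by auto
    then show ?thesis
      using s(1) unfolding a_def M_def
      by (simp add: norm_mult norm_power split_beta mult_mono power_mono)
  qed
  have lim: "uniform_limit (cball 0 s \<times> cball 0 s) (\<lambda>K p. \<Sum>k\<in>K. a k p) F (finite_subsets_at_top UNIV)"
    unfolding F_def by (rule Weierstrass_m_test_general[OF le M])
  have lim1: "uniform_limit (cball 0 s) (\<lambda>K z. \<Sum>k\<in>K. a k (z, w)) (\<lambda>z. F (z, w)) (finite_subsets_at_top UNIV)"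
    if "w \<in> cball 0 s" for w
    unfolding F_def by (rule Weierstrass_m_test_general[OF le M]) (use that in simp)
  have lim2: "uniform_limit (cball 0 s) (\<lambda>K w. \<Sum>k\<in>K. a k (z, w)) (\<lambda>w. F (z, w)) (finite_subsets_at_top UNIV)"
    if "z \<in> cball 0 s" for z
    unfolding F_def by (rule Weierstrass_m_test_general[OF le M]) (use that in simp)
  have "bidisc_holomorphic s F"
    unfolding bidisc_holomorphic_def
  proof (intro conjI ballI)
    have "continuous_on (cball 0 s \<times> cball 0 s) (\<lambda>p. \<Sum>k\<in>K. a k p)" for K
      unfolding a_def split_beta by (intro continuous_intros)
    then have "continuous_on (cball 0 s \<times> cball 0 s) F"
      by (intro uniform_limit_theorem[OF _ lim]) auto
    then show "continuous_on (ball 0 s \<times> ball 0 s) F"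
      by (rule continuous_on_subset) auto
  next
    fix w :: complex assume w: "w \<in> ball 0 s"
    have *: "continuous_on (cball 0 s) (\<lambda>z. \<Sum>k\<in>K. a k (z, w))" "(\<lambda>z. \<Sum>k\<in>K. a k (z, w)) holomorphic_on ball 0 s" for K
      unfolding a_def split_beta fst_conv snd_conv by (intro continuous_intros holomorphic_intros)+
    show "(\<lambda>z. F (z, w)) holomorphic_on ball 0 s"
      by (rule holomorphic_uniform_limit[OF _ lim1[of w]]) (use w * in \<open>simp_all\<close>)
  next
    fix z :: complex assume z: "z \<in> ball 0 s"
    have *: "continuous_on (cball 0 s) (\<lambda>w. \<Sum>k\<in>K. a k (z, w))" "(\<lambda>w. \<Sum>k\<in>K. a k (z, w)) holomorphic_on ball 0 s" for K
      unfolding a_def split_beta fst_conv snd_conv by (intro continuous_intros holomorphic_intros)+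
    show "(\<lambda>w. F (z, w)) holomorphic_on ball 0 s"
      by (rule holomorphic_uniform_limit[OF _ lim2[of z]]) (use z * in \<open>simp_all\<close>)
  qed
  moreover have "F (of_real x, of_real y) = of_real (f (x, y))" if "\<bar>x\<bar> < s" "\<bar>y\<bar> < s" for x y
  proof -
    have "((\<lambda>k. complex_of_real (case k of (i, j) \<Rightarrow> A i j * x ^ i * y ^ j)) has_sum of_real (f (x, y))) UNIV"
      using f[of x y] that s by (intro has_sum_of_real) auto
    moreover have "complex_of_real (case k of (i, j) \<Rightarrow> A i j * x ^ i * y ^ j) = a k (of_real x, of_real y)" for k
      by (simp add: a_def split: prod.split)
    ultimately show ?thesis unfolding F_def by (simp add: infsumI)
  qed
  ultimately show ?thesis using that s(1) by metis
qed

text \<open>Used for reciprocals, which give units of the local ring, and for the inverse square root in the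
  unit normal.\<close>

lemma holomorphic_at_origin_compose:
  assumes F: "holomorphic_at_origin F" and g: "g holomorphic_on S" "open S" "F 0 \<in> S"
  shows "holomorphic_at_origin (\<lambda>p. g (F p))"
proof -
  obtain r where r: "r > 0" "bidisc_holomorphic r F"
    using F unfolding holomorphic_at_origin_iff_bidisc by blast
  have "isCont F 0"
    using has_derivative_continuous[OF bidisc_holomorphic_has_derivative[OF r(2), of 0]] r(1)
    by (simp add: zero_prod_def)
  then have "eventually (\<lambda>p. F p \<in> S) (nhds 0)"
    using g(2,3) topological_tendstoD[of F "F 0" "nhds 0" S]
    by (simp add: isCont_def tendsto_at_iff_tendsto_nhds)
  then obtain s where s: "s > 0" "\<And>z w. norm z < s \<Longrightarrow> norm w < s \<Longrightarrow> F (z, w) \<in> S"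
    unfolding eventually_nhds_0_bidisc by blast
  define t where "t = min r s"
  have t: "t > 0" "t \<le> r" "t \<le> s" using r s by (auto simp: t_def)
  have Ft: "bidisc_holomorphic t F" by (rule bidisc_holomorphic_subset[OF r(2) t(2)])
  have S: "F (z, w) \<in> S" if "norm z < t" "norm w < t" for z w
    using s(2) that t by auto
  have "bidisc_holomorphic t (\<lambda>p. g (F p))"
    unfolding bidisc_holomorphic_def
  proof (intro conjI ballI)
    show "continuous_on (ball 0 t \<times> ball 0 t) (\<lambda>p. g (F p))"
      using Ft S
      by (intro continuous_on_compose2[OF holomorphic_on_imp_continuous_on[OF g(1)]])
        (auto simp: bidisc_holomorphic_def)
    show "(\<lambda>z. g (F (z, w))) holomorphic_on ball 0 t" if "w \<in> ball 0 t" for w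
      using Ft S that
      by (intro holomorphic_on_compose_gen[OF _ g(1), of "\<lambda>z. F (z, w)", unfolded o_def])
        (auto simp: bidisc_holomorphic_def)
    show "(\<lambda>w. g (F (z, w))) holomorphic_on ball 0 t" if "z \<in> ball 0 t" for z
      using Ft S that
      by (intro holomorphic_on_compose_gen[OF _ g(1), of "\<lambda>w. F (z, w)", unfolded o_def])
        (auto simp: bidisc_holomorphic_def)
  qed
  then show ?thesis using t(1) unfolding holomorphic_at_origin_iff_bidisc by blast
qed

section \<open>Germs, their partial derivatives and real restrictions\<close>

lift_definition coord_x :: germ is fst .
lift_definition coord_y :: germ is snd .

lift_definition germ_value :: "germ \<Rightarrow> complex" is "\<lambda>F. F 0"
  by (drule eventually_nhds_x_imp_x)

lemma pderiv_eventually_cong: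
  assumes "eventually (\<lambda>p. F p = G p) (nhds 0)"
  shows "eventually (\<lambda>p. pderiv1 F p = pderiv1 G p) (nhds 0)"
    and "eventually (\<lambda>p. pderiv2 F p = pderiv2 G p) (nhds 0)"
proof -
  have ev: "eventually (\<lambda>p. eventually (\<lambda>q. F q = G q) (nhds p)) (nhds 0)"
    using assms by (simp add: eventually_eventually)
  have lim1: "filterlim (\<lambda>z. (z, snd p)) (nhds p) (nhds (fst p))"
    and lim2: "filterlim (\<lambda>w. (fst p, w)) (nhds p) (nhds (snd p))" for p :: "complex \<times> complex"
    using tendsto_Pair[OF tendsto_ident_at tendsto_const]
    by (cases p; intro tendsto_eq_intros filterlim_ident; simp)+
  show "eventually (\<lambda>p. pderiv1 F p = pderiv1 G p) (nhds 0)"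
    using ev unfolding pderiv1_def
    by (rule eventually_mono) (intro deriv_cong_ev refl eventually_compose_filterlim[OF _ lim1])
  show "eventually (\<lambda>p. pderiv2 F p = pderiv2 G p) (nhds 0)"
    using ev unfolding pderiv2_def
    by (rule eventually_mono) (intro deriv_cong_ev refl eventually_compose_filterlim[OF _ lim2])
qed

lift_definition germ_dx :: "germ \<Rightarrow> germ" is pderiv1 by (rule pderiv_eventually_cong)
lift_definition germ_dy :: "germ \<Rightarrow> germ" is pderiv2 by (rule pderiv_eventually_cong)

definition of_real_pair :: "real \<times> real \<Rightarrow> complex \<times> complex" where
  "of_real_pair q = (of_real (fst q), of_real (snd q))"

lemma filterlim_of_real_pair: "filterlim of_real_pair (nhds 0) (nhds 0)"
proof -
  have "isCont of_real_pair 0"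
    unfolding of_real_pair_def by (intro continuous_intros)
  moreover have "of_real_pair 0 = 0" by (simp add: of_real_pair_def zero_prod_def)
  ultimately show ?thesis
    using tendsto_at_iff_tendsto_nhds[of of_real_pair 0] by (simp add: isCont_def)
qed

text \<open>The germ restricts on the real plane to the germ of a real function: its complexification, when
  the germ is holomorphic.\<close>

lift_definition extends :: "germ \<Rightarrow> (real \<times> real \<Rightarrow> real) \<Rightarrow> bool" is
  "\<lambda>F g. eventually (\<lambda>q. F (of_real_pair q) = of_real (g q)) (nhds 0)"
proof -
  fix F G :: "complex \<times> complex \<Rightarrow> complex"
  assume "eventually (\<lambda>p. F p = G p) (nhds 0)"
  then have "eventually (\<lambda>q. F (of_real_pair q) = G (of_real_pair q)) (nhds 0)"
    by (rule eventually_compose_filterlim[OF _ filterlim_of_real_pair])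
  then have "eventually (\<lambda>q. F (of_real_pair q) = of_real (g q)) (nhds 0) \<longleftrightarrow>
      eventually (\<lambda>q. G (of_real_pair q) = of_real (g q)) (nhds 0)" for g
    by (rule eventually_subst[OF eventually_mono]) simp
  then show "(\<lambda>g. eventually (\<lambda>q. F (of_real_pair q) = of_real (g q)) (nhds 0)) =
      (\<lambda>g. eventually (\<lambda>q. G (of_real_pair q) = of_real (g q)) (nhds 0))" by blast
qed

lemma holomorphic_at_origin_isCont:
  assumes "holomorphic_at_origin F"
  shows "isCont F 0"
proof -
  obtain r where r: "r > 0" "bidisc_holomorphic r F"
    using assms unfolding holomorphic_at_origin_iff_bidisc by blast
  then have "0 \<in> ball 0 r \<times> ball (0::complex) r" by (simp add: zero_prod_def)
  from bidisc_holomorphic_has_derivative[OF r(2) this] show ?thesis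
    by (rule has_derivative_continuous)
qed

lemma germ_value_simps [simp]:
  "germ_value 0 = 0" "germ_value 1 = 1" "germ_value (\<phi> + \<psi>) = germ_value \<phi> + germ_value \<psi>"
  "germ_value (\<phi> - \<psi>) = germ_value \<phi> - germ_value \<psi>" "germ_value (- \<phi>) = - germ_value \<phi>"
  "germ_value (\<phi> * \<psi>) = germ_value \<phi> * germ_value \<psi>" "germ_value (const_germ z) = z"
  "germ_value coord_x = 0" "germ_value coord_y = 0"
  by (transfer, simp)+

lemma germ_value_power [simp]: "germ_value (\<phi> ^ n) = germ_value \<phi> ^ n"
  by (induction n) simp_all

lemma holomorphic_germ_diff [simp]:
  "holomorphic_germ \<phi> \<Longrightarrow> holomorphic_germ \<psi> \<Longrightarrow> holomorphic_germ (\<phi> - \<psi>)"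
  using holomorphic_germ_add[of \<phi> "- \<psi>"] by simp

lemma holomorphic_germ_power [simp]: "holomorphic_germ \<phi> \<Longrightarrow> holomorphic_germ (\<phi> ^ n)"
  by (induction n) simp_all

lemma holomorphic_germ_coord [simp]: "holomorphic_germ coord_x" "holomorphic_germ coord_y"
proof -
  have "bidisc_holomorphic 1 fst" "bidisc_holomorphic 1 snd"
    unfolding bidisc_holomorphic_def by (auto intro!: continuous_intros holomorphic_intros)
  then have "holomorphic_at_origin fst" "holomorphic_at_origin snd"
    unfolding holomorphic_at_origin_iff_bidisc using zero_less_one by blast+
  then show "holomorphic_germ coord_x" "holomorphic_germ coord_y"
    by (simp_all add: coord_x.abs_eq coord_y.abs_eq holomorphic_germ.abs_eq)
qed

lemma holomorphic_germ_dx [simp]: "holomorphic_germ \<phi> \<Longrightarrow> holomorphic_germ (germ_dx \<phi>)"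
  by transfer (use holomorphic_at_origin_iff_bidisc bidisc_holomorphic_pderiv1 in blast)

lemma holomorphic_germ_dy [simp]: "holomorphic_germ \<phi> \<Longrightarrow> holomorphic_germ (germ_dy \<phi>)"
  by transfer (use holomorphic_at_origin_iff_bidisc bidisc_holomorphic_pderiv2 in blast)

text \<open>A property of points near the origin may be verified assuming that both functions are
  differentiable in each variable; this yields the sum and product rules for germs.\<close>

lemma holomorphic_at_origin_pderiv_eqI:
  assumes "holomorphic_at_origin F" "holomorphic_at_origin G"
    and "\<And>z w. ((\<lambda>z. F (z, w)) has_field_derivative pderiv1 F (z, w)) (at z) \<Longrightarrow>
      ((\<lambda>z. G (z, w)) has_field_derivative pderiv1 G (z, w)) (at z) \<Longrightarrow>
      ((\<lambda>w. F (z, w)) has_field_derivative pderiv2 F (z, w)) (at w) \<Longrightarrow>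
      ((\<lambda>w. G (z, w)) has_field_derivative pderiv2 G (z, w)) (at w) \<Longrightarrow> P (z, w)"
  shows "eventually P (nhds 0)"
proof -
  obtain r s where r: "r > 0" "bidisc_holomorphic r F" and s: "s > 0" "bidisc_holomorphic s G"
    using assms(1,2) unfolding holomorphic_at_origin_iff_bidisc by blast
  have "P (z, w)" if "norm z < min r s" "norm w < min r s" for z w
    using that by (intro assms(3) DERIV_pderiv1[OF r(2)] DERIV_pderiv1[OF s(2)]
        DERIV_pderiv2[OF r(2)] DERIV_pderiv2[OF s(2)]) simp_all
  moreover have "min r s > 0" using r s by simp
  ultimately show ?thesis unfolding eventually_nhds_0_bidisc by blast
qed

lemma germ_deriv_add [simp]:
  assumes "holomorphic_germ \<phi>" "holomorphic_germ \<psi>"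
  shows "germ_dx (\<phi> + \<psi>) = germ_dx \<phi> + germ_dx \<psi>" (is ?x)
    and "germ_dy (\<phi> + \<psi>) = germ_dy \<phi> + germ_dy \<psi>" (is ?y)
proof -
  have "eventually (\<lambda>p. pderiv1 (\<lambda>p. F p + G p) p = pderiv1 F p + pderiv1 G p) (nhds 0)"
    "eventually (\<lambda>p. pderiv2 (\<lambda>p. F p + G p) p = pderiv2 F p + pderiv2 G p) (nhds 0)"
    if "holomorphic_at_origin F" "holomorphic_at_origin G" for F G
    by (rule holomorphic_at_origin_pderiv_eqI[OF that],
      simp add: pderiv1_def[of "\<lambda>p. F p + G p"] pderiv2_def[of "\<lambda>p. F p + G p"],
      rule DERIV_imp_deriv, rule DERIV_add, assumption, assumption)+
  then show ?x ?y using assms by (transfer, blast)+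
qed

lemma germ_deriv_mult [simp]:
  assumes "holomorphic_germ \<phi>" "holomorphic_germ \<psi>"
  shows "germ_dx (\<phi> * \<psi>) = germ_dx \<phi> * \<psi> + germ_dx \<psi> * \<phi>" (is ?x)
    and "germ_dy (\<phi> * \<psi>) = germ_dy \<phi> * \<psi> + germ_dy \<psi> * \<phi>" (is ?y)
proof -
  have "eventually (\<lambda>p. pderiv1 (\<lambda>p. F p * G p) p = pderiv1 F p * G p + pderiv1 G p * F p) (nhds 0)"
    "eventually (\<lambda>p. pderiv2 (\<lambda>p. F p * G p) p = pderiv2 F p * G p + pderiv2 G p * F p) (nhds 0)"
    if "holomorphic_at_origin F" "holomorphic_at_origin G" for F G
    by (rule holomorphic_at_origin_pderiv_eqI[OF that],
      simp add: pderiv1_def[of "\<lambda>p. F p * G p"] pderiv2_def[of "\<lambda>p. F p * G p"],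
      rule DERIV_imp_deriv, rule DERIV_mult, assumption, assumption)+
  then show ?x ?y using assms by (transfer, blast)+
qed

lemma germ_deriv_simps [simp]:
  "germ_dx (const_germ z) = 0" "germ_dx coord_x = 1" "germ_dx coord_y = 0"
  "germ_dy (const_germ z) = 0" "germ_dy coord_x = 0" "germ_dy coord_y = 1"
  by (transfer; simp add: pderiv1_def pderiv2_def)+

text \<open>The maximal ideal of the local ring is generated by the two coordinates.\<close>

lemma germ_hadamard:
  assumes "holomorphic_germ \<phi>"
  obtains \<phi>1 \<phi>2 where "holomorphic_germ \<phi>1" "holomorphic_germ \<phi>2"
    "\<phi> = const_germ (germ_value \<phi>) + coord_x * \<phi>1 + coord_y * \<phi>2"
proof -
  have "\<exists>\<phi>1 \<phi>2. holomorphic_germ \<phi>1 \<and> holomorphic_germ \<phi>2 \<and>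
    \<phi> = const_germ (germ_value \<phi>) + coord_x * \<phi>1 + coord_y * \<phi>2"
    using assms
  proof transfer
    fix F :: "complex \<times> complex \<Rightarrow> complex" assume "holomorphic_at_origin F"
    then obtain r where r: "r > 0" "bidisc_holomorphic r F"
      unfolding holomorphic_at_origin_iff_bidisc by blast
    have "holomorphic_at_origin (radial_mean (pderiv1 F))" "holomorphic_at_origin (radial_mean (pderiv2 F))"
      unfolding holomorphic_at_origin_iff_bidisc
      using r(1) bidisc_holomorphic_radial_mean[OF bidisc_holomorphic_pderiv1[OF r(2)]]
        bidisc_holomorphic_radial_mean[OF bidisc_holomorphic_pderiv2[OF r(2)]] by blast+
    moreover have "eventually (\<lambda>p. F p = F 0 + fst p * radial_mean (pderiv1 F) p +
        snd p * radial_mean (pderiv2 F) p) (nhds 0)"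
      unfolding eventually_nhds_0_bidisc fst_conv snd_conv
      using r(1) bidisc_holomorphic_hadamard[OF r(2)] by blast
    ultimately show "\<exists>F1 F2. holomorphic_at_origin F1 \<and> holomorphic_at_origin F2 \<and>
        (\<forall>\<^sub>F p in nhds 0. F p = F 0 + fst p * F1 p + snd p * F2 p)"
      by blast
  qed
  then show ?thesis using that by blast
qed

lemma holomorphic_at_origin_inverse:
  assumes F: "holomorphic_at_origin F" "F 0 \<noteq> 0"
  shows "holomorphic_at_origin (\<lambda>p. inverse (F p))"
    and "eventually (\<lambda>p. F p * inverse (F p) = 1) (nhds 0)"
proof -
  have "inverse holomorphic_on - {0::complex}" by (intro holomorphic_intros) auto
  then show "holomorphic_at_origin (\<lambda>p. inverse (F p))"
    by (rule holomorphic_at_origin_compose[OF F(1)]) (use F(2) in auto)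
  have "(F \<longlongrightarrow> F 0) (nhds 0)"
    using holomorphic_at_origin_isCont[OF F(1)] tendsto_at_iff_tendsto_nhds[of F 0] by (simp add: isCont_def)
  then have "eventually (\<lambda>p. F p \<noteq> 0) (nhds 0)"
    using F(2) by (rule tendsto_imp_eventually_ne)
  then show "eventually (\<lambda>p. F p * inverse (F p) = 1) (nhds 0)"
    by (rule eventually_mono) (rule right_inverse)
qed

lemma holomorphic_germ_unit:
  assumes "holomorphic_germ \<phi>" "germ_value \<phi> \<noteq> 0"
  obtains \<psi> where "holomorphic_germ \<psi>" "\<phi> * \<psi> = 1"
proof -
  obtain F where F: "\<phi> = abs_germ F"
    by (induction \<phi> rule: germ.abs_induct) simp
  have "holomorphic_at_origin F" "F 0 \<noteq> 0"
    using assms by (simp_all add: F holomorphic_germ.abs_eq germ_value.abs_eq)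
  note inv = holomorphic_at_origin_inverse[OF this]
  show ?thesis
  proof (rule that)
    show "holomorphic_germ (abs_germ (\<lambda>p. inverse (F p)))"
      using inv(1) by (simp add: holomorphic_germ.abs_eq)
    show "\<phi> * abs_germ (\<lambda>p. inverse (F p)) = 1"
      unfolding F times_germ.abs_eq one_germ.abs_eq germ.abs_eq_iff by (rule inv(2))
  qed
qed

text \<open>Identity theorem on the real plane.\<close>

lemma extends_unique:
  assumes "holomorphic_germ \<phi>" "holomorphic_germ \<psi>" "extends \<phi> g" "extends \<psi> g"
  shows "\<phi> = \<psi>"
proof -
  have zero: "\<phi> = 0" if "holomorphic_germ \<phi>" "extends \<phi> (\<lambda>_. 0)" for \<phi>
    using that
  proof transfer
    fix F :: "complex \<times> complex \<Rightarrow> complex"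
    assume F: "holomorphic_at_origin F" and "\<forall>\<^sub>F q in nhds 0. F (of_real_pair q) = of_real 0"
    then obtain s where s: "s > 0" "\<forall>x y. norm x < s \<longrightarrow> norm y < s \<longrightarrow> F (of_real_pair (x, y)) = of_real 0"
      unfolding eventually_nhds_0_bidisc by (elim exE conjE)
    obtain r where r: "r > 0" "bidisc_holomorphic r F"
      using F unfolding holomorphic_at_origin_iff_bidisc by blast
    have F': "bidisc_holomorphic (min r s) F" by (rule bidisc_holomorphic_subset[OF r(2)]) simp
    have "F (z, w) = 0" if "norm z < min r s" "norm w < min r s" for z w
      by (rule bidisc_holomorphic_zero_on_reals[OF F' _ that])
        (use s(2) in \<open>simp add: of_real_pair_def\<close>)
    then show "\<forall>\<^sub>F p in nhds 0. F p = 0"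
      unfolding eventually_nhds_0_bidisc using r(1) s(1) by (intro exI[of _ "min r s"]) simp
  qed
  have "extends (\<phi> - \<psi>) (\<lambda>_. 0)"
    using assms(3,4) by transfer (erule (1) eventually_elim2, simp)
  then show ?thesis using zero[of "\<phi> - \<psi>"] assms(1,2) by simp
qed

lemma complexification_eqI:
  assumes "holomorphic_germ \<phi>" "extends \<phi> g"
  shows "complexification g = \<phi>"
proof -
  have "\<exists>G. \<phi> = abs_germ G \<and> holomorphic_at_origin G \<and>
      eventually (\<lambda>p. G (of_real (fst p), of_real (snd p)) = of_real (g p)) (nhds 0)"
  proof -
    obtain F where F: "\<phi> = abs_germ F"
      by (induction \<phi> rule: germ.abs_induct) simp
    show ?thesis
      by (rule exI[of _ F])
        (use assms in \<open>simp add: F holomorphic_germ.abs_eq extends.abs_eq of_real_pair_def\<close>)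
  qed
  moreover have "\<psi> = \<phi>"
    if ex: "\<exists>G. \<psi> = abs_germ G \<and> holomorphic_at_origin G \<and>
      eventually (\<lambda>p. G (of_real (fst p), of_real (snd p)) = of_real (g p)) (nhds 0)" for \<psi>
  proof -
    obtain G where "\<psi> = abs_germ G" "holomorphic_at_origin G"
      "eventually (\<lambda>p. G (of_real (fst p), of_real (snd p)) = of_real (g p)) (nhds 0)"
      using ex by (elim exE conjE)
    then have "holomorphic_germ \<psi>" "extends \<psi> g"
      by (simp_all add: holomorphic_germ.abs_eq extends.abs_eq of_real_pair_def)
    then show ?thesis using extends_unique assms by blast
  qed
  ultimately show ?thesis
    unfolding complexification_def by (rule the_equality)
qed

lemma extends_add: "extends \<phi> g \<Longrightarrow> extends \<psi> h \<Longrightarrow> extends (\<phi> + \<psi>) (\<lambda>q. g q + h q)"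
  by transfer (erule (1) eventually_elim2, simp)

lemma extends_diff: "extends \<phi> g \<Longrightarrow> extends \<psi> h \<Longrightarrow> extends (\<phi> - \<psi>) (\<lambda>q. g q - h q)"
  by transfer (erule (1) eventually_elim2, simp)

lemma extends_mult: "extends \<phi> g \<Longrightarrow> extends \<psi> h \<Longrightarrow> extends (\<phi> * \<psi>) (\<lambda>q. g q * h q)"
  by transfer (erule (1) eventually_elim2, simp)

lemma extends_const: "extends (const_germ (of_real c)) (\<lambda>_. c)"
  by transfer simp

lemma extends_one: "extends 1 (\<lambda>_. 1)"
  by transfer simp

lemma extends_coord: "extends coord_x fst" "extends coord_y snd"
  by (transfer, simp add: of_real_pair_def)+

lemma extends_power: "extends \<phi> g \<Longrightarrow> extends (\<phi> ^ n) (\<lambda>q. g q ^ n)"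
  by (induction n) (simp_all add: extends_one extends_mult)

lemma extends_cong:
  "extends \<phi> g \<Longrightarrow> eventually (\<lambda>q. g q = h q) (nhds 0) \<Longrightarrow> extends \<phi> h"
  by transfer (erule (1) eventually_elim2, simp)

section \<open>The curvature coefficients of a graph\<close>

text \<open>Differentiate along the real axis and compare real and imaginary parts; the imaginary part of the
  restriction is constantly zero.\<close>

lemma real_derivative_of_extension:
  fixes u :: "real \<Rightarrow> real" and h :: "complex \<Rightarrow> complex"
  assumes h: "(h has_field_derivative D) (at (of_real x))"
    and ext: "\<And>t. \<bar>t\<bar> < r \<Longrightarrow> h (of_real t) = of_real (u t)" and x: "\<bar>x\<bar> < r"
  shows "(u has_vector_derivative Re D) (at x)" "D = of_real (Re D)"
proof -
  have "((\<lambda>t. h (of_real t)) has_vector_derivative D) (at x)"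
    by (rule has_vector_derivative_real_field[OF h])
  then have D: "((\<lambda>t. of_real (u t)) has_vector_derivative D) (at x)"
    by (rule has_vector_derivative_transform_within_open[of _ _ _ "{-r<..<r}"])
      (use ext x in \<open>auto simp: abs_less_iff\<close>)
  show "(u has_vector_derivative Re D) (at x)"
    using bounded_linear.has_vector_derivative[OF bounded_linear_Re D] by simp
  have "((\<lambda>t. 0::real) has_vector_derivative Im D) (at x)"
    using bounded_linear.has_vector_derivative[OF bounded_linear_Im D] by simp
  then have "Im D = 0"
    using vector_derivative_unique_at[OF has_vector_derivative_const] by metis
  then show "D = of_real (Re D)" by (simp add: complex_eq_iff)
qed

lemma extends_partial_derivatives:
  assumes "holomorphic_germ \<phi>" "extends \<phi> g"
  shows "extends (germ_dx \<phi>) (pdx g)" (is ?x)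
    and "extends (germ_dy \<phi>) (pdy g)" (is ?y)
    and "eventually (\<lambda>q. ((\<lambda>t. g (t, snd q)) has_vector_derivative pdx g q) (at (fst q))) (nhds 0)" (is ?dx)
    and "eventually (\<lambda>q. ((\<lambda>t. g (fst q, t)) has_vector_derivative pdy g q) (at (snd q))) (nhds 0)" (is ?dy)
proof -
  have "?x \<and> ?y \<and> ?dx \<and> ?dy"
    using assms
  proof transfer
    fix F :: "complex \<times> complex \<Rightarrow> complex" and g :: "real \<times> real \<Rightarrow> real"
    assume F: "holomorphic_at_origin F"
      and "\<forall>\<^sub>F q in nhds 0. F (of_real_pair q) = of_real (g q)"
    then obtain s where s: "s > 0"
      "\<forall>x y. norm x < s \<longrightarrow> norm y < s \<longrightarrow> F (of_real_pair (x, y)) = of_real (g (x, y))"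
      unfolding eventually_nhds_0_bidisc by (elim exE conjE)
    obtain r where r: "r > 0" "bidisc_holomorphic r F"
      using F unfolding holomorphic_at_origin_iff_bidisc by blast
    define t where "t = min r s"
    have t: "t > 0" "t \<le> r" "t \<le> s" using r(1) s(1) by (auto simp: t_def)
    have Ft: "bidisc_holomorphic t F" by (rule bidisc_holomorphic_subset[OF r(2) t(2)])
    have ext: "F (of_real x, of_real y) = of_real (g (x, y))" if "\<bar>x\<bar> < t" "\<bar>y\<bar> < t" for x y
      using s(2) that t(3) by (simp add: of_real_pair_def)
    have "pderiv1 F (of_real x, of_real y) = of_real (pdx g (x, y)) \<and>
        pderiv2 F (of_real x, of_real y) = of_real (pdy g (x, y)) \<and>
        ((\<lambda>t. g (t, y)) has_vector_derivative pdx g (x, y)) (at x) \<and>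
        ((\<lambda>t. g (x, t)) has_vector_derivative pdy g (x, y)) (at y)"
      if "norm x < t" "norm y < t" for x y
    proof -
      have xy: "norm (complex_of_real x) < t" "norm (complex_of_real y) < t" "\<bar>x\<bar> < t" "\<bar>y\<bar> < t"
        using that by simp_all
      note 1 = real_derivative_of_extension[OF DERIV_pderiv1[OF Ft xy(1,2)] ext[OF _ xy(4)] xy(3)]
      note 2 = real_derivative_of_extension[OF DERIV_pderiv2[OF Ft xy(1,2)] ext[OF xy(3)] xy(4)]
      have "pdx g (x, y) = Re (pderiv1 F (of_real x, of_real y))"
        using vector_derivative_at[OF 1(1)] by (simp add: pdx_def)
      moreover have "pdy g (x, y) = Re (pderiv2 F (of_real x, of_real y))"
        using vector_derivative_at[OF 2(1)] by (simp add: pdy_def)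
      ultimately show ?thesis using 1 2 by metis
    qed
    then show "(\<forall>\<^sub>F q in nhds 0. pderiv1 F (of_real_pair q) = of_real (pdx g q)) \<and>
        (\<forall>\<^sub>F q in nhds 0. pderiv2 F (of_real_pair q) = of_real (pdy g q)) \<and>
        (\<forall>\<^sub>F q in nhds 0. ((\<lambda>t. g (t, snd q)) has_vector_derivative pdx g q) (at (fst q))) \<and>
        (\<forall>\<^sub>F q in nhds 0. ((\<lambda>t. g (fst q, t)) has_vector_derivative pdy g q) (at (snd q)))"
      unfolding eventually_nhds_0_bidisc of_real_pair_def fst_conv snd_conv using t(1) by blast
  qed
  then show ?x ?y ?dx ?dy by blast+
qed

lemma germ_value_extends:
  assumes "extends \<phi> g"
  shows "germ_value \<phi> = of_real (g 0)"
  using assms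
  by transfer (drule eventually_nhds_x_imp_x, simp add: of_real_pair_def zero_prod_def)

text \<open>The principal branch of the square root is holomorphic near the positive number \<open>g 0\<close>.\<close>

lemma extends_inverse_sqrt:
  assumes \<phi>: "holomorphic_germ \<phi>" "extends \<phi> g" and g: "g 0 > 0"
  obtains \<psi> where "holomorphic_germ \<psi>" "extends \<psi> (\<lambda>q. 1 / sqrt (g q))" "germ_value \<psi> \<noteq> 0"
proof -
  obtain F where [simp]: "\<phi> = abs_germ F"
    by (induction \<phi> rule: germ.abs_induct) simp
  have F: "holomorphic_at_origin F" and ext: "\<forall>\<^sub>F q in nhds 0. F (of_real_pair q) = of_real (g q)"
    using \<phi> by (simp_all add: holomorphic_germ.abs_eq extends.abs_eq)
  have F0: "F 0 = of_real (g 0)"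
    using germ_value_extends[OF \<phi>(2)] by (simp add: germ_value.abs_eq)
  have "(\<lambda>z. inverse (csqrt z)) holomorphic_on - \<real>\<^sub>\<le>\<^sub>0"
    by (intro holomorphic_intros) auto
  moreover have "F 0 \<in> - \<real>\<^sub>\<le>\<^sub>0" using F0 g by simp
  ultimately have hol: "holomorphic_at_origin (\<lambda>p. inverse (csqrt (F p)))"
    by (intro holomorphic_at_origin_compose[OF F]) auto
  have "(F \<longlongrightarrow> F 0) (nhds 0)"
    using holomorphic_at_origin_isCont[OF F] tendsto_at_iff_tendsto_nhds[of F 0] by (simp add: isCont_def)
  then have "((\<lambda>p. Re (F p)) \<longlongrightarrow> g 0) (nhds 0)"
    using tendsto_Re[of F "F 0" "nhds 0"] F0 by simp
  then have "eventually (\<lambda>p. Re (F p) > 0) (nhds 0)"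
    using g by (rule order_tendstoD(1))
  then have "\<forall>\<^sub>F q in nhds 0. Re (F (of_real_pair q)) > 0"
    by (rule eventually_compose_filterlim[OF _ filterlim_of_real_pair])
  then have ext_inv: "\<forall>\<^sub>F q in nhds 0. inverse (csqrt (F (of_real_pair q))) = of_real (1 / sqrt (g q))"
    using ext by eventually_elim (simp add: inverse_eq_divide)
  define \<psi> where "\<psi> = abs_germ (\<lambda>p. inverse (csqrt (F p)))"
  have \<psi>: "holomorphic_germ \<psi>" "extends \<psi> (\<lambda>q. 1 / sqrt (g q))"
    using hol ext_inv by (simp_all add: \<psi>_def holomorphic_germ.abs_eq extends.abs_eq)
  moreover have "germ_value \<psi> \<noteq> 0" using germ_value_extends[OF \<psi>(2)] g by simp
  ultimately show ?thesis using that by blast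
qed

lemma analytic_at_origin_extends:
  assumes "analytic_at_origin f"
  obtains \<phi> where "holomorphic_germ \<phi>" "extends \<phi> f"
proof -
  obtain A r where A: "r > 0" "\<And>x y. \<bar>x\<bar> < r \<Longrightarrow> \<bar>y\<bar> < r \<Longrightarrow>
      ((\<lambda>(i, j). A i j * x ^ i * y ^ j) has_sum f (x, y)) UNIV"
    using assms unfolding analytic_at_origin_def by blast
  obtain F s where s: "s > 0" "bidisc_holomorphic s F"
    "\<And>x y. \<bar>x\<bar> < s \<Longrightarrow> \<bar>y\<bar> < s \<Longrightarrow> F (of_real x, of_real y) = of_real (f (x, y))"
    by (rule real_power_series_extends[OF A]) (assumption | blast intro: that)+
  have "holomorphic_at_origin F" using s(1,2) unfolding holomorphic_at_origin_iff_bidisc by blast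
  moreover have "\<forall>\<^sub>F q in nhds 0. F (of_real_pair q) = of_real (f q)"
    unfolding eventually_nhds_0_bidisc using s(1,3) by (auto simp: of_real_pair_def)
  ultimately show ?thesis
    using that[of "abs_germ F"] by (simp add: holomorphic_germ.abs_eq extends.abs_eq)
qed

text \<open>Reduces derivatives of curves in space to derivatives of their components.\<close>

lemma vector_3_scaleR:
  "(vector [a, b, c] :: real^3) = a *\<^sub>R axis 1 1 + b *\<^sub>R axis 2 1 + c *\<^sub>R axis 3 1"
  by (simp add: vec_eq_iff forall_3 axis_def)

lemma has_vector_derivative_vector_3:
  fixes u v w :: "real \<Rightarrow> real"
  assumes "(u has_vector_derivative u') (at t)" "(v has_vector_derivative v') (at t)"
    "(w has_vector_derivative w') (at t)"
  shows "((\<lambda>t. vector [u t, v t, w t] :: real^3) has_vector_derivative vector [u', v', w']) (at t)"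
  unfolding vector_3_scaleR using assms
  by (auto intro!: derivative_eq_intros simp: has_vector_derivative_def algebra_simps)

lemma pd_eventually_cong:
  assumes "eventually (\<lambda>q. g q = h q) (nhds 0)"
  shows "eventually (\<lambda>q. pdx g q = pdx h q) (nhds 0)"
    and "eventually (\<lambda>q. pdy g q = pdy h q) (nhds 0)"
proof -
  have ev: "eventually (\<lambda>p. eventually (\<lambda>q. g q = h q) (nhds p)) (nhds 0)"
    using assms by (simp add: eventually_eventually)
  have lim1: "filterlim (\<lambda>z. (z, snd p)) (nhds p) (nhds (fst p))"
    and lim2: "filterlim (\<lambda>w. (fst p, w)) (nhds p) (nhds (snd p))" for p :: "real \<times> real"
    by (cases p; intro tendsto_eq_intros filterlim_ident; simp)+
  show "eventually (\<lambda>q. pdx g q = pdx h q) (nhds 0)"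
    using ev unfolding pdx_def
    by (rule eventually_mono)
      (intro vector_derivative_cong_eq refl eventually_mono[OF eventually_compose_filterlim[OF _ lim1]]; simp)
  show "eventually (\<lambda>q. pdy g q = pdy h q) (nhds 0)"
    using ev unfolding pdy_def
    by (rule eventually_mono)
      (intro vector_derivative_cong_eq refl eventually_mono[OF eventually_compose_filterlim[OF _ lim2]]; simp)
qed

text \<open>The classical formulas for the fundamental forms of a graph, at a single point. The parameters
  stand for \<open>f\<^sub>x, f\<^sub>y, f\<^sub>x\<^sub>x, f\<^sub>x\<^sub>y, f\<^sub>y\<^sub>y\<close>.\<close>

lemma curvature_forms_of_jet:
  fixes X :: "real \<times> real \<Rightarrow> real^3"
  assumes "pdx X q = vector [1, 0, p]" "pdy X q = vector [0, 1, s]"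
    "pdx (pdx X) q = vector [0, 0, r]" "pdy (pdx X) q = vector [0, 0, m]" "pdy (pdy X) q = vector [0, 0, t]"
  shows "form1_E X q = 1 + p\<^sup>2" "form1_F X q = p * s" "form1_G X q = 1 + s\<^sup>2"
    "form2_l X q = r / sqrt (1 + p\<^sup>2 + s\<^sup>2)" "form2_m X q = m / sqrt (1 + p\<^sup>2 + s\<^sup>2)"
    "form2_n X q = t / sqrt (1 + p\<^sup>2 + s\<^sup>2)"
proof -
  have "cross3 (vector [1, 0, p]) (vector [0, 1, s]) = (vector [- p, - s, 1] :: real^3)"
    by (simp add: cross3_simps vec_eq_iff forall_3)
  moreover have "norm (vector [- p, - s, 1] :: real^3) = sqrt (1 + p\<^sup>2 + s\<^sup>2)"
    by (simp add: norm_eq_sqrt_inner inner_vec_def sum_3 power2_eq_square add_ac)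
  ultimately have n: "unit_normal X q = (1 / sqrt (1 + p\<^sup>2 + s\<^sup>2)) *\<^sub>R vector [- p, - s, 1]"
    using assms(1,2) by (simp add: unit_normal_def sgn_div_norm inverse_eq_divide)
  show "form1_E X q = 1 + p\<^sup>2" "form1_F X q = p * s" "form1_G X q = 1 + s\<^sup>2"
    using assms by (simp_all add: form1_E_def form1_F_def form1_G_def inner_vec_def sum_3 power2_eq_square)
  show "form2_l X q = r / sqrt (1 + p\<^sup>2 + s\<^sup>2)" "form2_m X q = m / sqrt (1 + p\<^sup>2 + s\<^sup>2)"
    "form2_n X q = t / sqrt (1 + p\<^sup>2 + s\<^sup>2)"
    using assms by (simp_all add: form2_l_def form2_m_def form2_n_def n inner_vec_def sum_3)
qed

lemma pdx_vector_3:
  assumes "((\<lambda>t. h (t, snd q)) has_vector_derivative h') (at (fst q))"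
  shows "pdx (\<lambda>q. vector [a, b, h q] :: real^3) q = vector [0, 0, h']"
  unfolding pdx_def
  by (intro vector_derivative_at has_vector_derivative_vector_3 has_vector_derivative_const assms)

lemma pdy_vector_3:
  assumes "((\<lambda>t. h (fst q, t)) has_vector_derivative h') (at (snd q))"
  shows "pdy (\<lambda>q. vector [a, b, h q] :: real^3) q = vector [0, 0, h']"
  unfolding pdy_def
  by (intro vector_derivative_at has_vector_derivative_vector_3 has_vector_derivative_const assms)

text \<open>All formulas hold on a neighbourhood of the origin, which is why second derivatives may be taken
  by differentiating the formulas for the first ones.\<close>

lemma graph_patch_derivatives:
  assumes \<phi>: "holomorphic_germ \<phi>" "extends \<phi> f"
  shows "\<forall>\<^sub>F q in nhds 0.
    pdx (graph_patch f) q = vector [1, 0, pdx f q] \<and> pdy (graph_patch f) q = vector [0, 1, pdy f q] \<and>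
    pdx (pdx (graph_patch f)) q = vector [0, 0, pdx (pdx f) q] \<and>
    pdy (pdx (graph_patch f)) q = vector [0, 0, pdy (pdx f) q] \<and>
    pdy (pdy (graph_patch f)) q = vector [0, 0, pdy (pdy f) q]"
proof -
  note f = extends_partial_derivatives[OF \<phi>]
  note fx = extends_partial_derivatives[OF holomorphic_germ_dx[OF \<phi>(1)] f(1)]
  note fy = extends_partial_derivatives[OF holomorphic_germ_dy[OF \<phi>(1)] f(2)]
  have x: "\<forall>\<^sub>F q in nhds 0. pdx (graph_patch f) q = vector [1, 0, pdx f q]"
    using f(3)
  proof eventually_elim
    case (elim q)
    from vector_derivative_at[OF has_vector_derivative_vector_3[OF has_vector_derivative_id has_vector_derivative_const elim]]
    show ?case by (simp add: pdx_def[of "graph_patch f"] graph_patch_def)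
  qed
  have y: "\<forall>\<^sub>F q in nhds 0. pdy (graph_patch f) q = vector [0, 1, pdy f q]"
    using f(4)
  proof eventually_elim
    case (elim q)
    from vector_derivative_at[OF has_vector_derivative_vector_3[OF has_vector_derivative_const has_vector_derivative_id elim]]
    show ?case by (simp add: pdy_def[of "graph_patch f"] graph_patch_def)
  qed
  have "\<forall>\<^sub>F q in nhds 0. pdx (\<lambda>q. vector [1, 0, pdx f q] :: real^3) q = vector [0, 0, pdx (pdx f) q]"
    using fx(3) by (rule eventually_mono) (rule pdx_vector_3)
  moreover have "\<forall>\<^sub>F q in nhds 0. pdy (\<lambda>q. vector [1, 0, pdx f q] :: real^3) q = vector [0, 0, pdy (pdx f) q]"
    using fx(4) by (rule eventually_mono) (rule pdy_vector_3)
  moreover have "\<forall>\<^sub>F q in nhds 0. pdy (\<lambda>q. vector [0, 1, pdy f q] :: real^3) q = vector [0, 0, pdy (pdy f) q]"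
    using fy(4) by (rule eventually_mono) (rule pdy_vector_3)
  ultimately show ?thesis
    using x y pd_eventually_cong[OF x] pd_eventually_cong[OF y] by eventually_elim simp
qed

section \<open>Powers of the maximal ideal\<close>

text \<open>The powers of the maximal ideal of the local ring, by recursion on the exponent.\<close>

fun max_power :: "nat \<Rightarrow> germ set" where
  "max_power 0 = Collect holomorphic_germ"
| "max_power (Suc k) = {coord_x * \<phi> + coord_y * \<psi> | \<phi> \<psi>. \<phi> \<in> max_power k \<and> \<psi> \<in> max_power k}"

lemma max_power_SucI:
  "a \<in> max_power k \<Longrightarrow> b \<in> max_power k \<Longrightarrow> coord_x * a + coord_y * b \<in> max_power (Suc k)"
  by auto

lemma max_power_SucE:
  assumes "\<phi> \<in> max_power (Suc k)"
  obtains a b where "\<phi> = coord_x * a + coord_y * b" "a \<in> max_power k" "b \<in> max_power k"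
  using assms by auto

lemma max_power_holomorphic: "\<phi> \<in> max_power k \<Longrightarrow> holomorphic_germ \<phi>"
  by (induction k arbitrary: \<phi>) auto

lemma max_power_add: "\<phi> \<in> max_power k \<Longrightarrow> \<psi> \<in> max_power k \<Longrightarrow> \<phi> + \<psi> \<in> max_power k"
proof (induction k arbitrary: \<phi> \<psi>)
  case (Suc k)
  obtain a b where \<phi>: "\<phi> = coord_x * a + coord_y * b" "a \<in> max_power k" "b \<in> max_power k"
    using Suc.prems(1) by auto
  obtain c d where \<psi>: "\<psi> = coord_x * c + coord_y * d" "c \<in> max_power k" "d \<in> max_power k"
    using Suc.prems(2) by auto
  have "\<phi> + \<psi> = coord_x * (a + c) + coord_y * (b + d)" by (simp add: \<phi> \<psi> algebra_simps)
  moreover have "a + c \<in> max_power k" "b + d \<in> max_power k" using Suc.IH \<phi> \<psi> by blast+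
  ultimately show ?case by auto
qed simp

lemma max_power_mult: "holomorphic_germ \<rho> \<Longrightarrow> \<phi> \<in> max_power k \<Longrightarrow> \<rho> * \<phi> \<in> max_power k"
proof (induction k arbitrary: \<phi>)
  case (Suc k)
  obtain a b where \<phi>: "\<phi> = coord_x * a + coord_y * b" "a \<in> max_power k" "b \<in> max_power k"
    using Suc.prems(2) by auto
  have "\<rho> * \<phi> = coord_x * (\<rho> * a) + coord_y * (\<rho> * b)" by (simp add: \<phi> algebra_simps)
  moreover have "\<rho> * a \<in> max_power k" "\<rho> * b \<in> max_power k" using Suc \<phi> by blast+
  ultimately show ?case by auto
qed simp

lemma max_power_Suc_subset: "max_power (Suc k) \<subseteq> max_power k"
  using max_power_mult max_power_add holomorphic_germ_coord by auto

lemma max_power_antimono: "m \<le> n \<Longrightarrow> max_power n \<subseteq> max_power m"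
  by (rule lift_Suc_antimono_le[of max_power]) (rule max_power_Suc_subset)

lemma max_power_zero: "0 \<in> max_power k"
proof (induction k)
  case (Suc k)
  then have "coord_x * 0 + coord_y * 0 \<in> max_power (Suc k)" by (auto simp del: mult_zero_right)
  then show ?case by simp
qed simp

lemma coord_mult_max_power:
  assumes "\<phi> \<in> max_power k"
  shows "coord_x * \<phi> \<in> max_power (Suc k)" "coord_y * \<phi> \<in> max_power (Suc k)"
proof -
  have "coord_x * \<phi> + coord_y * 0 \<in> max_power (Suc k)" "coord_x * 0 + coord_y * \<phi> \<in> max_power (Suc k)"
    using assms max_power_zero[of k] by (auto simp del: mult_zero_right)
  then show "coord_x * \<phi> \<in> max_power (Suc k)" "coord_y * \<phi> \<in> max_power (Suc k)" by simp_all
qed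

lemma max_power_times: "\<phi> \<in> max_power j \<Longrightarrow> \<psi> \<in> max_power k \<Longrightarrow> \<phi> * \<psi> \<in> max_power (j + k)"
proof (induction j arbitrary: \<phi>)
  case 0
  then show ?case using max_power_mult by simp
next
  case (Suc j)
  obtain a b where \<phi>: "\<phi> = coord_x * a + coord_y * b" "a \<in> max_power j" "b \<in> max_power j"
    using Suc.prems(1) by auto
  have "\<phi> * \<psi> = coord_x * (a * \<psi>) + coord_y * (b * \<psi>)" by (simp add: \<phi> algebra_simps)
  moreover have "a * \<psi> \<in> max_power (j + k)" "b * \<psi> \<in> max_power (j + k)" using Suc \<phi> by blast+
  ultimately show ?case by auto
qed

text \<open>By the product rule, differentiating \<open>x \<alpha> + y \<beta>\<close> gives \<open>\<alpha>\<close> plus terms that keep a coordinate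
  factor.\<close>

lemma germ_dx_max_power: "\<phi> \<in> max_power (Suc k) \<Longrightarrow> germ_dx \<phi> \<in> max_power k"
proof (induction k arbitrary: \<phi>)
  case 0
  then show ?case using max_power_holomorphic[of \<phi> "Suc 0"] by simp
next
  case (Suc k)
  obtain a b where \<phi>: "\<phi> = coord_x * a + coord_y * b" "a \<in> max_power (Suc k)" "b \<in> max_power (Suc k)"
    using Suc.prems by (rule max_power_SucE)
  have hol: "holomorphic_germ a" "holomorphic_germ b" using \<phi> max_power_holomorphic by blast+
  have "germ_dx \<phi> = a + (coord_x * germ_dx a + coord_y * germ_dx b)"
    using hol by (simp add: \<phi>(1) algebra_simps)
  moreover have "coord_x * germ_dx a + coord_y * germ_dx b \<in> max_power (Suc k)"
    by (rule max_power_SucI[OF Suc.IH[OF \<phi>(2)] Suc.IH[OF \<phi>(3)]])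
  ultimately show ?case using max_power_add[OF \<phi>(2)] by metis
qed

lemma germ_dy_max_power: "\<phi> \<in> max_power (Suc k) \<Longrightarrow> germ_dy \<phi> \<in> max_power k"
proof (induction k arbitrary: \<phi>)
  case 0
  then show ?case using max_power_holomorphic[of \<phi> "Suc 0"] by simp
next
  case (Suc k)
  obtain a b where \<phi>: "\<phi> = coord_x * a + coord_y * b" "a \<in> max_power (Suc k)" "b \<in> max_power (Suc k)"
    using Suc.prems by (rule max_power_SucE)
  have hol: "holomorphic_germ a" "holomorphic_germ b" using \<phi> max_power_holomorphic by blast+
  have "germ_dy \<phi> = b + (coord_x * germ_dy a + coord_y * germ_dy b)"
    using hol by (simp add: \<phi>(1) algebra_simps)
  moreover have "coord_x * germ_dy a + coord_y * germ_dy b \<in> max_power (Suc k)"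
    by (rule max_power_SucI[OF Suc.IH[OF \<phi>(2)] Suc.IH[OF \<phi>(3)]])
  ultimately show ?case using max_power_add[OF \<phi>(3)] by metis
qed

lift_definition vanishing_order_ge :: "germ \<Rightarrow> nat \<Rightarrow> bool" is
  "\<lambda>F k. \<exists>C. eventually (\<lambda>p. norm (F p) \<le> C * norm p ^ k) (nhds 0)"
proof -
  fix F G :: "complex \<times> complex \<Rightarrow> complex"
  assume "eventually (\<lambda>p. F p = G p) (nhds 0)"
  then have "eventually (\<lambda>p. norm (F p) \<le> C * norm p ^ k) (nhds 0) \<longleftrightarrow>
      eventually (\<lambda>p. norm (G p) \<le> C * norm p ^ k) (nhds 0)" for C k
    by (rule eventually_subst[OF eventually_mono]) simp
  then show "(\<lambda>k. \<exists>C. eventually (\<lambda>p. norm (F p) \<le> C * norm p ^ k) (nhds 0)) =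
      (\<lambda>k. \<exists>C. eventually (\<lambda>p. norm (G p) \<le> C * norm p ^ k) (nhds 0))" by simp
qed

lemma max_power_vanishing_order: "\<phi> \<in> max_power k \<Longrightarrow> vanishing_order_ge \<phi> k"
proof (induction k arbitrary: \<phi>)
  case 0
  then have "holomorphic_germ \<phi>" by simp
  then show ?case
  proof transfer
    fix F :: "complex \<times> complex \<Rightarrow> complex" assume "holomorphic_at_origin F"
    then have "(F \<longlongrightarrow> F 0) (nhds 0)"
      using holomorphic_at_origin_isCont[of F] tendsto_at_iff_tendsto_nhds[of F 0] by (simp add: isCont_def)
    then have "eventually (\<lambda>p. norm (F p) < norm (F 0) + 1) (nhds 0)"
      by (intro order_tendstoD(2)[OF tendsto_norm]) auto
    then have "eventually (\<lambda>p. norm (F p) \<le> (norm (F 0) + 1) * norm p ^ 0) (nhds 0)"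
      by (rule eventually_mono) simp
    then show "\<exists>C. eventually (\<lambda>p. norm (F p) \<le> C * norm p ^ 0) (nhds 0)" by blast
  qed
next
  case (Suc k)
  obtain a b where \<phi>: "\<phi> = coord_x * a + coord_y * b" "a \<in> max_power k" "b \<in> max_power k"
    using Suc.prems by (rule max_power_SucE)
  have "vanishing_order_ge (coord_x * a + coord_y * b) (Suc k)"
    if "vanishing_order_ge a k" "vanishing_order_ge b k" for a b
    using that
  proof transfer
    fix F G :: "complex \<times> complex \<Rightarrow> complex" and k
    assume "\<exists>C. eventually (\<lambda>p. norm (F p) \<le> C * norm p ^ k) (nhds 0)"
      and "\<exists>C. eventually (\<lambda>p. norm (G p) \<le> C * norm p ^ k) (nhds 0)"
    then obtain C D where "eventually (\<lambda>p. norm (F p) \<le> C * norm p ^ k) (nhds 0)"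
      and "eventually (\<lambda>p. norm (G p) \<le> D * norm p ^ k) (nhds 0)" by (elim exE)
    then have "eventually (\<lambda>p. norm (fst p * F p + snd p * G p) \<le> (C + D) * norm p ^ Suc k) (nhds 0)"
    proof eventually_elim
      case (elim p)
      have "norm (fst p * F p) \<le> norm p * (C * norm p ^ k)"
        unfolding norm_mult using elim(1) norm_fst_le[of "fst p" "snd p"] by (intro mult_mono) auto
      moreover have "norm (snd p * G p) \<le> norm p * (D * norm p ^ k)"
        unfolding norm_mult using elim(2) norm_snd_le[of "snd p" "fst p"] by (intro mult_mono) auto
      ultimately show ?case
        using norm_triangle_ineq[of "fst p * F p" "snd p * G p"] by (simp add: algebra_simps)
    qed
    then show "\<exists>C. eventually (\<lambda>p. norm (fst p * F p + snd p * G p) \<le> C * norm p ^ Suc k) (nhds 0)"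
      by blast
  qed
  then show ?case using Suc.IH \<phi> by simp
qed

text \<open>Replace the coefficients of the monomials of degree \<open>k\<close> by their values at the origin. Only
  the homogeneity of the leading form is recorded, since this determines its vanishing.\<close>

lemma max_power_leading_form:
  assumes "\<phi> \<in> max_power k"
  shows "\<exists>h. holomorphic_germ (abs_germ h) \<and> (\<forall>t z w. h (t * z, t * w) = t ^ k * h (z, w)) \<and>
    \<phi> - abs_germ h \<in> max_power (Suc k)"
  using assms
proof (induction k arbitrary: \<phi>)
  case 0
  then have "holomorphic_germ \<phi>" by simp
  then obtain \<alpha> \<beta> where \<alpha>: "holomorphic_germ \<alpha>" "holomorphic_germ \<beta>"
    "\<phi> = const_germ (germ_value \<phi>) + coord_x * \<alpha> + coord_y * \<beta>"
    by (rule germ_hadamard)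
  have "\<phi> - const_germ (germ_value \<phi>) = coord_x * \<alpha> + coord_y * \<beta>"
    by (subst \<alpha>(3)) simp
  then have "\<phi> - const_germ (germ_value \<phi>) \<in> max_power (Suc 0)" using \<alpha> by auto
  then show ?case
    using holomorphic_germ_const[of "germ_value \<phi>"] unfolding const_germ.abs_eq
    by (intro exI[of _ "\<lambda>_. germ_value \<phi>"]) simp
next
  case (Suc k)
  obtain a b where \<phi>: "\<phi> = coord_x * a + coord_y * b" "a \<in> max_power k" "b \<in> max_power k"
    using Suc.prems by auto
  obtain f where f: "holomorphic_germ (abs_germ f)" "\<And>t z w. f (t * z, t * w) = t ^ k * f (z, w)"
    "a - abs_germ f \<in> max_power (Suc k)"
    using Suc.IH[OF \<phi>(2)] by blast
  obtain g where g: "holomorphic_germ (abs_germ g)" "\<And>t z w. g (t * z, t * w) = t ^ k * g (z, w)"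
    "b - abs_germ g \<in> max_power (Suc k)"
    using Suc.IH[OF \<phi>(3)] by blast
  let ?h = "\<lambda>p. fst p * f p + snd p * g p"
  have h: "abs_germ ?h = coord_x * abs_germ f + coord_y * abs_germ g"
    by (simp add: coord_x.abs_eq coord_y.abs_eq times_germ.abs_eq plus_germ.abs_eq)
  have "\<phi> - abs_germ ?h = coord_x * (a - abs_germ f) + coord_y * (b - abs_germ g)"
    unfolding h \<phi>(1) by (simp add: algebra_simps)
  then have "\<phi> - abs_germ ?h \<in> max_power (Suc (Suc k))"
    using max_power_SucI[OF f(3) g(3)] by metis
  moreover have "holomorphic_germ (abs_germ ?h)" using f(1) g(1) by (simp add: h)
  moreover have "\<forall>t z w. ?h (t * z, t * w) = t ^ Suc k * ?h (z, w)"
    using f(2) g(2) by (simp add: algebra_simps)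
  ultimately show ?case by (intro exI[of _ ?h] conjI)
qed

text \<open>Compare both sides along the ray through \<open>q\<close>: after division by \<open>t\<^sup>k\<close> the bound tends to zero.\<close>

lemma homogeneous_bound_imp_zero:
  fixes H :: "real \<times> real \<Rightarrow> complex"
  assumes hom: "\<And>t x y. H (t * x, t * y) = of_real t ^ k * H (x, y)"
    and C: "eventually (\<lambda>q. norm (H q) \<le> C * norm q ^ Suc k) (nhds 0)"
  shows "H q = 0"
proof -
  have "((\<lambda>t. t *\<^sub>R q) \<longlongrightarrow> 0 *\<^sub>R q) (at_right 0)"
    by (intro tendsto_intros)
  then have "filterlim (\<lambda>t. t *\<^sub>R q) (nhds 0) (at_right (0::real))" by simp
  from eventually_compose_filterlim[OF C this]
  have "eventually (\<lambda>t. norm (H (t *\<^sub>R q)) \<le> C * norm (t *\<^sub>R q) ^ Suc k) (at_right 0)" .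
  then have "eventually (\<lambda>t. norm (H q) \<le> C * norm q ^ Suc k * t) (at_right 0)"
    using eventually_at_right_less[of 0]
  proof eventually_elim
    case (elim t)
    have "H (t *\<^sub>R q) = of_real t ^ k * H q"
      using hom[of t "fst q" "snd q"] by (simp add: scaleR_prod_def)
    then have "t ^ k * norm (H q) \<le> C * (t * norm q) ^ Suc k"
      using elim by (simp add: norm_mult norm_power)
    also have "\<dots> = t ^ k * (C * norm q ^ Suc k * t)" by (simp add: power_mult_distrib)
    finally show ?case using elim(2) by simp
  qed
  moreover have "((\<lambda>t. C * norm q ^ Suc k * t) \<longlongrightarrow> C * norm q ^ Suc k * 0) (at_right 0)"
    by (intro tendsto_intros)
  ultimately have "norm (H q) \<le> C * norm q ^ Suc k * 0"
    by (intro tendsto_lowerbound) auto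
  then show ?thesis by simp
qed

lemma norm_of_real_pair: "norm (of_real_pair q) = norm q"
  by (simp add: of_real_pair_def norm_prod_def)

text \<open>Suppose the germ lies in the \<open>k\<close>-th power of the maximal ideal for some \<open>k < n\<close>. On the real
  plane its leading form of degree \<open>k\<close> is bounded by a multiple of \<open>|q|\<^sup>k\<^sup>+\<^sup>1\<close>, so it vanishes there, and by
  the identity theorem it vanishes as a germ. Hence \<open>k\<close> can be raised up to \<open>n\<close>.\<close>

lemma extends_bigo_imp_max_power:
  assumes \<phi>: "holomorphic_germ \<phi>" "extends \<phi> g" and g: "g \<in> O[nhds 0](\<lambda>q. norm q ^ n)"
  shows "\<phi> \<in> max_power n"
proof -
  have "\<phi> \<in> max_power k" if "k \<le> n" for k
    using that
  proof (induction k)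
    case 0
    then show ?case using \<phi>(1) by simp
  next
    case (Suc k)
    then have "\<phi> \<in> max_power k" by simp
    from max_power_leading_form[OF this]
    obtain h where h: "holomorphic_germ (abs_germ h)" "\<And>t z w. h (t * z, t * w) = t ^ k * h (z, w)"
      "\<phi> - abs_germ h \<in> max_power (Suc k)" by blast
    obtain F where F: "\<phi> = abs_germ F"
      by (induction \<phi> rule: germ.abs_induct) simp
    obtain C where C: "eventually (\<lambda>p. norm (F p - h p) \<le> C * norm p ^ Suc k) (nhds 0)"
      using max_power_vanishing_order[OF h(3)]
      unfolding F minus_germ.abs_eq vanishing_order_ge.abs_eq by (elim exE)
    obtain D where D: "D > 0" "eventually (\<lambda>q. norm (g q) \<le> D * norm (norm q ^ n)) (nhds 0)"
      by (rule landau_o.bigE[OF g])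
    have "eventually (\<lambda>q. F (of_real_pair q) = of_real (g q)) (nhds 0)"
      using \<phi>(2) by (simp add: F extends.abs_eq)
    moreover have "eventually (\<lambda>q :: real \<times> real. norm q < 1) (nhds 0)"
      using eventually_nhds_in_open[of "ball (0 :: real \<times> real) 1" 0] by simp
    ultimately have "eventually (\<lambda>q. norm (h (of_real_pair q)) \<le> (C + D) * norm q ^ Suc k) (nhds 0)"
      using D(2) eventually_compose_filterlim[OF C filterlim_of_real_pair]
    proof eventually_elim
      case (elim q)
      have "norm (h (of_real_pair q)) \<le>
          norm (F (of_real_pair q)) + norm (F (of_real_pair q) - h (of_real_pair q))"
        using norm_triangle_ineq4[of "F (of_real_pair q)" "F (of_real_pair q) - h (of_real_pair q)"] by simp
      also have "norm (F (of_real_pair q)) \<le> D * norm q ^ n" using elim(1,3) by simp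
      also have "norm q ^ n \<le> norm q ^ Suc k" using elim(2) Suc.prems by (intro power_decreasing) auto
      finally show ?case using elim(4) D(1) by (simp add: norm_of_real_pair algebra_simps)
    qed
    then have "h (of_real_pair q) = 0" for q
      by (intro homogeneous_bound_imp_zero[of "\<lambda>q. h (of_real_pair q)" k])
        (simp_all add: of_real_pair_def h(2))
    then have "extends (abs_germ h) (\<lambda>_. 0)" by (simp add: extends.abs_eq)
    moreover have "extends 0 (\<lambda>_. 0)" by transfer simp
    ultimately have "abs_germ h = 0"
      using extends_unique[OF h(1) holomorphic_germ_0] by blast
    then show ?case using h(3) by simp
  qed
  then show ?thesis by simp
qed

section \<open>Jets of the curvature coefficients\<close>

definition monomial :: "complex \<Rightarrow> nat \<Rightarrow> nat \<Rightarrow> germ" where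
  "monomial z i j = const_germ z * coord_x ^ i * coord_y ^ j"

lemma abs_germ_power: "abs_germ F ^ n = abs_germ (\<lambda>p. F p ^ n)"
  by (induction n) (simp_all add: one_germ.abs_eq times_germ.abs_eq)

lemma monomial_abs_germ: "monomial z i j = abs_germ (\<lambda>p. z * fst p ^ i * snd p ^ j)"
  by (simp add: monomial_def const_germ.abs_eq coord_x.abs_eq coord_y.abs_eq abs_germ_power times_germ.abs_eq)

text \<open>Turn an identity between polynomial expressions in germs into one between functions, where
  the coefficients can be compared by field arithmetic.\<close>

lemmas polynomial_germ_simps = monomial_abs_germ plus_germ.abs_eq minus_germ.abs_eq times_germ.abs_eq

lemma holomorphic_monomial [simp]: "holomorphic_germ (monomial z i j)"
  by (simp add: monomial_def)

lemma germ_value_monomial [simp]: "germ_value (monomial z i j) = (if i = 0 \<and> j = 0 then z else 0)"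
  by (simp add: monomial_def)

lemma monomial_zero [simp]: "monomial 0 i j = 0"
  by (simp add: monomial_abs_germ zero_germ.abs_eq)

lemma monomial_mult: "monomial z i j * monomial w k l = monomial (z * w) (i + k) (j + l)"
  by (simp add: polynomial_germ_simps power_add ac_simps)

lemma extends_monomial:
  assumes "z = of_real c"
  shows "extends (monomial z i j) (\<lambda>q. c * fst q ^ i * snd q ^ j)"
  unfolding monomial_def assms
  by (intro extends_mult extends_const extends_power extends_coord)

lemma monomial_x: "monomial z i 0 = const_germ z * coord_x ^ i"
  by (simp add: monomial_def)

lemma germ_deriv_monomial [simp]:
  "germ_dx (monomial z i j) = monomial (of_nat i * z) (i - 1) j"
  "germ_dy (monomial z i j) = monomial (of_nat j * z) i (j - 1)"
proof -
  have "pderiv1 (\<lambda>p. z * fst p ^ i * snd p ^ j) = (\<lambda>p. of_nat i * z * fst p ^ (i - 1) * snd p ^ j)"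
    unfolding pderiv1_def by (intro ext DERIV_imp_deriv) (auto intro!: derivative_eq_intros)
  then show "germ_dx (monomial z i j) = monomial (of_nat i * z) (i - 1) j"
    by (simp add: monomial_abs_germ germ_dx.abs_eq)
  have "pderiv2 (\<lambda>p. z * fst p ^ i * snd p ^ j) = (\<lambda>p. of_nat j * z * fst p ^ i * snd p ^ (j - 1))"
    unfolding pderiv2_def by (intro ext DERIV_imp_deriv) (auto intro!: derivative_eq_intros)
  then show "germ_dy (monomial z i j) = monomial (of_nat j * z) i (j - 1)"
    by (simp add: monomial_abs_germ germ_dy.abs_eq)
qed

lemma monomial_max_power:
  assumes "n \<le> i + j"
  shows "monomial z i j \<in> max_power n"
proof -
  have x: "coord_x ^ i \<in> max_power i" for i
    by (induction i) (simp_all del: max_power.simps(2) add: coord_mult_max_power)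
  have y: "coord_y ^ j \<in> max_power j" for j
    by (induction j) (simp_all del: max_power.simps(2) add: coord_mult_max_power)
  have "const_germ z * (coord_x ^ i * coord_y ^ j) \<in> max_power (i + j)"
    by (intro max_power_mult max_power_times x y) simp
  then show ?thesis
    using max_power_antimono[OF assms] by (auto simp: monomial_def mult.assoc)
qed

text \<open>The ideal generated by \<open>x\<^sup>4, x\<^sup>2 y, x y\<^sup>2, y\<^sup>3\<close>. Assigning weight one to \<open>x\<close> and weight two to
  \<open>y\<close>, as is natural on the parabola \<open>y = \<alpha> x\<^sup>2\<close>, these are monomials of weight at least four; a
  function modulo this ideal thus keeps all the information about its restriction to the parabola
  up to order three.\<close>

definition jet_ideal :: "germ set" where
  "jet_ideal = {monomial 1 4 0 * a + monomial 1 2 1 * b + monomial 1 1 2 * c + monomial 1 0 3 * d | a b c d.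
    holomorphic_germ a \<and> holomorphic_germ b \<and> holomorphic_germ c \<and> holomorphic_germ d}"

lemma jet_idealI:
  "holomorphic_germ a \<Longrightarrow> holomorphic_germ b \<Longrightarrow> holomorphic_germ c \<Longrightarrow> holomorphic_germ d \<Longrightarrow>
    monomial 1 4 0 * a + monomial 1 2 1 * b + monomial 1 1 2 * c + monomial 1 0 3 * d \<in> jet_ideal"
  unfolding jet_ideal_def by blast

lemma jet_idealE:
  assumes "\<phi> \<in> jet_ideal"
  obtains a b c d where "holomorphic_germ a" "holomorphic_germ b" "holomorphic_germ c" "holomorphic_germ d"
    "\<phi> = monomial 1 4 0 * a + monomial 1 2 1 * b + monomial 1 1 2 * c + monomial 1 0 3 * d"
  using assms unfolding jet_ideal_def by blast

lemma jet_ideal_add: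
  assumes "\<phi> \<in> jet_ideal" "\<psi> \<in> jet_ideal"
  shows "\<phi> + \<psi> \<in> jet_ideal"
proof -
  obtain a b c d where 1: "holomorphic_germ a" "holomorphic_germ b" "holomorphic_germ c" "holomorphic_germ d"
    "\<phi> = monomial 1 4 0 * a + monomial 1 2 1 * b + monomial 1 1 2 * c + monomial 1 0 3 * d"
    using assms(1) by (rule jet_idealE)
  obtain a' b' c' d' where 2: "holomorphic_germ a'" "holomorphic_germ b'" "holomorphic_germ c'" "holomorphic_germ d'"
    "\<psi> = monomial 1 4 0 * a' + monomial 1 2 1 * b' + monomial 1 1 2 * c' + monomial 1 0 3 * d'"
    using assms(2) by (rule jet_idealE)
  have "\<phi> + \<psi> = monomial 1 4 0 * (a + a') + monomial 1 2 1 * (b + b') + monomial 1 1 2 * (c + c') +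
      monomial 1 0 3 * (d + d')"
    by (simp add: 1 2 algebra_simps)
  also have "\<dots> \<in> jet_ideal" using 1 2 by (intro jet_idealI holomorphic_germ_add)
  finally show ?thesis .
qed

lemma jet_ideal_mult:
  assumes "holomorphic_germ \<rho>" "\<phi> \<in> jet_ideal"
  shows "\<rho> * \<phi> \<in> jet_ideal" "\<phi> * \<rho> \<in> jet_ideal"
proof -
  obtain a b c d where 1: "holomorphic_germ a" "holomorphic_germ b" "holomorphic_germ c" "holomorphic_germ d"
    "\<phi> = monomial 1 4 0 * a + monomial 1 2 1 * b + monomial 1 1 2 * c + monomial 1 0 3 * d"
    using assms(2) by (rule jet_idealE)
  have "\<rho> * \<phi> = monomial 1 4 0 * (\<rho> * a) + monomial 1 2 1 * (\<rho> * b) + monomial 1 1 2 * (\<rho> * c) +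
      monomial 1 0 3 * (\<rho> * d)"
    by (simp add: 1 algebra_simps)
  also have "\<dots> \<in> jet_ideal" using 1 assms(1) by (intro jet_idealI holomorphic_germ_mult)
  finally show "\<rho> * \<phi> \<in> jet_ideal" .
  then show "\<phi> * \<rho> \<in> jet_ideal" by (simp add: mult.commute)
qed

lemma jet_ideal_uminus: "\<phi> \<in> jet_ideal \<Longrightarrow> - \<phi> \<in> jet_ideal"
  using jet_ideal_mult(1)[of "- 1" \<phi>] by simp

lemma jet_ideal_diff: "\<phi> \<in> jet_ideal \<Longrightarrow> \<psi> \<in> jet_ideal \<Longrightarrow> \<phi> - \<psi> \<in> jet_ideal"
  using jet_ideal_add[of \<phi> "- \<psi>"] jet_ideal_uminus by simp

lemma monomial_jet_ideal:
  assumes "4 \<le> i \<or> (2 \<le> i \<and> 1 \<le> j) \<or> (1 \<le> i \<and> 2 \<le> j) \<or> 3 \<le> j"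
  shows "monomial z i j \<in> jet_ideal"
proof -
  have "monomial 1 4 0 * 1 + monomial 1 2 1 * 0 + monomial 1 1 2 * 0 + monomial 1 0 3 * 0 \<in> jet_ideal"
    "monomial 1 4 0 * 0 + monomial 1 2 1 * 1 + monomial 1 1 2 * 0 + monomial 1 0 3 * 0 \<in> jet_ideal"
    "monomial 1 4 0 * 0 + monomial 1 2 1 * 0 + monomial 1 1 2 * 1 + monomial 1 0 3 * 0 \<in> jet_ideal"
    "monomial 1 4 0 * 0 + monomial 1 2 1 * 0 + monomial 1 1 2 * 0 + monomial 1 0 3 * 1 \<in> jet_ideal"
    by (intro jet_idealI holomorphic_germ_0 holomorphic_germ_1)+
  then have gen: "monomial 1 4 0 \<in> jet_ideal" "monomial 1 2 1 \<in> jet_ideal"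
    "monomial 1 1 2 \<in> jet_ideal" "monomial 1 0 3 \<in> jet_ideal" by simp_all
  have shift: "monomial z i j \<in> jet_ideal" if "monomial 1 k l \<in> jet_ideal" "k \<le> i" "l \<le> j" for k l
    using jet_ideal_mult(1)[OF _ that(1), of "monomial z (i - k) (j - l)"] that(2,3)
    by (simp add: monomial_mult)
  from assms show ?thesis using gen shift by auto
qed

text \<open>The induction peels off coordinate factors into a monomial until the total degree is carried by
  the monomial.\<close>

lemma max_power_4_subset: "max_power 4 \<subseteq> jet_ideal"
proof -
  have "monomial 1 i j * \<phi> \<in> jet_ideal" if "\<phi> \<in> max_power k" "4 \<le> i + j + k" for \<phi> i j k
    using that
  proof (induction k arbitrary: \<phi> i j)
    case 0
    then have "4 \<le> i \<or> (2 \<le> i \<and> 1 \<le> j) \<or> (1 \<le> i \<and> 2 \<le> j) \<or> 3 \<le> j" by auto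
    then show ?case using 0 by (intro jet_ideal_mult(2) monomial_jet_ideal) simp_all
  next
    case (Suc k)
    obtain a b where \<phi>: "\<phi> = coord_x * a + coord_y * b" "a \<in> max_power k" "b \<in> max_power k"
      using Suc.prems(1) by (rule max_power_SucE)
    have "monomial 1 i j * \<phi> = monomial 1 (Suc i) j * a + monomial 1 i (Suc j) * b"
      by (simp add: \<phi> monomial_def algebra_simps)
    moreover have "monomial 1 (Suc i) j * a \<in> jet_ideal" "monomial 1 i (Suc j) * b \<in> jet_ideal"
      using Suc.IH \<phi>(2,3) Suc.prems(2) by simp_all
    ultimately show ?case by (simp add: jet_ideal_add)
  qed
  moreover have "monomial 1 0 0 = 1" by (simp add: monomial_abs_germ one_germ.abs_eq)
  ultimately show ?thesis by (metis add_0 add_cancel_right_left le_refl mult_1 subsetI)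
qed

lemma jet_ideal_cong_mult:
  assumes "\<phi> - \<phi>' \<in> jet_ideal" "\<psi> - \<psi>' \<in> jet_ideal" "holomorphic_germ \<phi>'" "holomorphic_germ \<psi>"
  shows "\<phi> * \<psi> - \<phi>' * \<psi>' \<in> jet_ideal"
proof -
  have "\<phi> * \<psi> - \<phi>' * \<psi>' = (\<phi> - \<phi>') * \<psi> + \<phi>' * (\<psi> - \<psi>')" by (simp add: algebra_simps)
  then show ?thesis using assms by (simp add: jet_ideal_add jet_ideal_mult)
qed

lemma jet_ideal_trans:
  "\<phi> - \<psi> \<in> jet_ideal \<Longrightarrow> \<psi> - \<rho> \<in> jet_ideal \<Longrightarrow> \<phi> - \<rho> \<in> jet_ideal"
  using jet_ideal_add[of "\<phi> - \<psi>" "\<psi> - \<rho>"] by simp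

text \<open>The Taylor polynomial of the surface at the umbilic point; there is no linear part and the
  quadratic part is a multiple of the first fundamental form at that point.\<close>

definition quintic :: "complex \<Rightarrow> complex \<Rightarrow> complex \<Rightarrow> complex \<Rightarrow> complex \<Rightarrow> complex \<Rightarrow> complex \<Rightarrow> complex \<Rightarrow>
    complex \<Rightarrow> complex \<Rightarrow> complex \<Rightarrow> complex \<Rightarrow> complex \<Rightarrow> complex \<Rightarrow> complex \<Rightarrow> germ" where
  "quintic k a b c d40 d31 d22 d13 d04 d50 d41 d32 d23 d14 d05 =
    monomial (k / 2) 2 0 + monomial (k / 2) 0 2
    + monomial (a / 6) 3 0 + monomial (b / 2) 1 2 + monomial (c / 6) 0 3
    + monomial (d40 / 24) 4 0 + monomial (d31 / 6) 3 1 + monomial (d22 / 4) 2 2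
    + monomial (d13 / 6) 1 3 + monomial (d04 / 24) 0 4
    + monomial (d50 / 120) 5 0 + monomial (d41 / 24) 4 1 + monomial (d32 / 12) 3 2
    + monomial (d23 / 12) 2 3 + monomial (d14 / 24) 1 4 + monomial (d05 / 120) 0 5"

text \<open>The coefficients are complex so that identities between jets are field identities free of
  coercions.\<close>

locale umbilic_jet =
  fixes \<phi> :: germ and k a b c d40 d31 d22 d13 d04 d50 d41 d32 d23 d14 d05 :: complex
  assumes hol: "holomorphic_germ \<phi>"
    and jet: "\<phi> - quintic k a b c d40 d31 d22 d13 d04 d50 d41 d32 d23 d14 d05 \<in> max_power 6"
begin

definition "fx = germ_dx \<phi>"
definition "fy = germ_dy \<phi>"
definition "fxx = germ_dx (germ_dx \<phi>)"
definition "fxy = germ_dy (germ_dx \<phi>)"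
definition "fyy = germ_dy (germ_dy \<phi>)"

definition "curv_b_germ = (1 + fx\<^sup>2) * fyy - (1 + fy\<^sup>2) * fxx"
definition "curv_c_germ = (1 + fx\<^sup>2) * fxy - fx * fy * fxx"

definition "qx = monomial k 1 0 + monomial (a / 2) 2 0 + monomial (b / 2) 0 2"
definition "qy = monomial k 0 1 + monomial b 1 1 + monomial (c / 2) 0 2"
definition "qxx = monomial k 0 0 + monomial a 1 0 + monomial (d40 / 2) 2 0 + monomial d31 1 1
  + monomial (d22 / 2) 0 2 + monomial (d50 / 6) 3 0"
definition "qxy = monomial b 0 1 + monomial (d31 / 2) 2 0 + monomial d22 1 1
  + monomial (d13 / 2) 0 2 + monomial (d41 / 6) 3 0"
definition "qyy = monomial k 0 0 + monomial b 1 0 + monomial c 0 1 + monomial (d22 / 2) 2 0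
  + monomial d13 1 1 + monomial (d04 / 2) 0 2 + monomial (d32 / 6) 3 0"

lemma hol_derivs [simp]: "holomorphic_germ fx" "holomorphic_germ fy" "holomorphic_germ fxx"
  "holomorphic_germ fxy" "holomorphic_germ fyy" "holomorphic_germ qx" "holomorphic_germ qy"
  "holomorphic_germ qxx" "holomorphic_germ qxy" "holomorphic_germ qyy"
  using hol by (simp_all add: fx_def fy_def fxx_def fxy_def fyy_def qx_def qy_def qxx_def qxy_def qyy_def)

definition "rest = \<phi> - quintic k a b c d40 d31 d22 d13 d04 d50 d41 d32 d23 d14 d05"

lemma rest: "rest \<in> max_power (Suc (Suc 4))" "holomorphic_germ rest"
  "quintic k a b c d40 d31 d22 d13 d04 d50 d41 d32 d23 d14 d05 + rest = \<phi>"
  using jet max_power_holomorphic[OF jet] by (simp_all add: rest_def del: max_power.simps(2))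

abbreviation "Q \<equiv> quintic k a b c d40 d31 d22 d13 d04 d50 d41 d32 d23 d14 d05"

lemma hol_quintic [simp]: "holomorphic_germ Q"
  by (simp add: quintic_def)

lemma dx_quintic: "germ_dx Q = qx
    + monomial (d40 / 6) 3 0 + monomial (d31 / 2) 2 1 + monomial (d22 / 2) 1 2
    + monomial (d13 / 6) 0 3 + monomial (d50 / 24) 4 0 + monomial (d41 / 6) 3 1 + monomial (d32 / 4) 2 2
    + monomial (d23 / 6) 1 3 + monomial (d14 / 24) 0 4"
  by (simp add: quintic_def qx_def)

lemma dy_quintic: "germ_dy Q = qy
    + monomial (d31 / 6) 3 0 + monomial (d22 / 2) 2 1 + monomial (d13 / 2) 1 2
    + monomial (d04 / 6) 0 3 + monomial (d41 / 24) 4 0 + monomial (d32 / 6) 3 1 + monomial (d23 / 4) 2 2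
    + monomial (d14 / 6) 1 3 + monomial (d05 / 24) 0 4"
  by (simp add: quintic_def qy_def)

lemma dxx_quintic: "germ_dx (germ_dx Q) = qxx
    + monomial (d41 / 2) 2 1 + monomial (d32 / 2) 1 2 + monomial (d23 / 6) 0 3"
  by (simp add: dx_quintic qx_def qxx_def)

lemma dxy_quintic: "germ_dy (germ_dx Q) = qxy
    + monomial (d32 / 2) 2 1 + monomial (d23 / 2) 1 2 + monomial (d14 / 6) 0 3"
  by (simp add: dx_quintic qx_def qxy_def)

lemma dyy_quintic: "germ_dy (germ_dy Q) = qyy
    + monomial (d23 / 2) 2 1 + monomial (d14 / 2) 1 2 + monomial (d05 / 6) 0 3"
  by (simp add: dy_quintic qy_def qyy_def)

lemma derivs_split:
  "fx = germ_dx Q + germ_dx rest" "fy = germ_dy Q + germ_dy rest"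
  "fxx = germ_dx (germ_dx Q) + germ_dx (germ_dx rest)"
  "fxy = germ_dy (germ_dx Q) + germ_dy (germ_dx rest)"
  "fyy = germ_dy (germ_dy Q) + germ_dy (germ_dy rest)"
proof -
  show x: "fx = germ_dx Q + germ_dx rest" and y: "fy = germ_dy Q + germ_dy rest"
    using germ_deriv_add[OF hol_quintic rest(2)] by (simp_all only: rest(3) fx_def fy_def)
  show "fxx = germ_dx (germ_dx Q) + germ_dx (germ_dx rest)" "fxy = germ_dy (germ_dx Q) + germ_dy (germ_dx rest)"
    using germ_deriv_add[OF holomorphic_germ_dx[OF hol_quintic] holomorphic_germ_dx[OF rest(2)]]
    by (simp_all only: x[symmetric]) (simp_all only: fx_def fxx_def fxy_def)
  show "fyy = germ_dy (germ_dy Q) + germ_dy (germ_dy rest)"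
    using germ_deriv_add(2)[OF holomorphic_germ_dy[OF hol_quintic] holomorphic_germ_dy[OF rest(2)]]
    by (simp only: y[symmetric]) (simp only: fy_def fyy_def)
qed

lemma fx_jet: "fx - qx \<in> max_power 3"
proof -
  have "fx - qx = monomial (d40 / 6) 3 0 + monomial (d31 / 2) 2 1 + monomial (d22 / 2) 1 2 + monomial (d13 / 6) 0 3 + monomial (d50 / 24) 4 0 + monomial (d41 / 6) 3 1 + monomial (d32 / 4) 2 2 + monomial (d23 / 6) 1 3 + monomial (d14 / 24) 0 4 + germ_dx rest"
    unfolding derivs_split dx_quintic by (simp only: add.assoc add_diff_cancel_left')
  also have "\<dots> \<in> max_power 3"
    using germ_dx_max_power[OF rest(1)] max_power_antimono[of 3 "Suc 4"]
    by (intro max_power_add monomial_max_power) (auto simp del: max_power.simps(2))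
  finally show ?thesis .
qed

lemma fy_jet: "fy - qy \<in> max_power 3"
proof -
  have "fy - qy = monomial (d31 / 6) 3 0 + monomial (d22 / 2) 2 1 + monomial (d13 / 2) 1 2 + monomial (d04 / 6) 0 3 + monomial (d41 / 24) 4 0 + monomial (d32 / 6) 3 1 + monomial (d23 / 4) 2 2 + monomial (d14 / 6) 1 3 + monomial (d05 / 24) 0 4 + germ_dy rest"
    unfolding derivs_split dy_quintic by (simp only: add.assoc add_diff_cancel_left')
  also have "\<dots> \<in> max_power 3"
    using germ_dy_max_power[OF rest(1)] max_power_antimono[of 3 "Suc 4"]
    by (intro max_power_add monomial_max_power) (auto simp del: max_power.simps(2))
  finally show ?thesis .
qed

lemma fxx_jet: "fxx - qxx \<in> jet_ideal"
proof -
  have "fxx - qxx = monomial (d41 / 2) 2 1 + monomial (d32 / 2) 1 2 + monomial (d23 / 6) 0 3 + germ_dx (germ_dx rest)"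
    unfolding derivs_split dxx_quintic by (simp only: add.assoc add_diff_cancel_left')
  also have "\<dots> \<in> jet_ideal"
    using germ_dx_max_power[OF germ_dx_max_power[OF rest(1)]] max_power_4_subset
    by (intro jet_ideal_add monomial_jet_ideal) auto
  finally show ?thesis .
qed

lemma fxy_jet: "fxy - qxy \<in> jet_ideal"
proof -
  have "fxy - qxy = monomial (d32 / 2) 2 1 + monomial (d23 / 2) 1 2 + monomial (d14 / 6) 0 3 + germ_dy (germ_dx rest)"
    unfolding derivs_split dxy_quintic by (simp only: add.assoc add_diff_cancel_left')
  also have "\<dots> \<in> jet_ideal"
    using germ_dy_max_power[OF germ_dx_max_power[OF rest(1)]] max_power_4_subset
    by (intro jet_ideal_add monomial_jet_ideal) auto
  finally show ?thesis .
qed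

lemma fyy_jet: "fyy - qyy \<in> jet_ideal"
proof -
  have "fyy - qyy = monomial (d23 / 2) 2 1 + monomial (d14 / 2) 1 2 + monomial (d05 / 6) 0 3 + germ_dy (germ_dy rest)"
    unfolding derivs_split dyy_quintic by (simp only: add.assoc add_diff_cancel_left')
  also have "\<dots> \<in> jet_ideal"
    using germ_dy_max_power[OF germ_dy_max_power[OF rest(1)]] max_power_4_subset
    by (intro jet_ideal_add monomial_jet_ideal) auto
  finally show ?thesis .
qed

lemma qx_qy_max_power: "qx \<in> max_power 1" "qy \<in> max_power 1"
  unfolding qx_def qy_def by (intro max_power_add monomial_max_power; simp)+

lemma fx_fy_max_power: "fx \<in> max_power 1" "fy \<in> max_power 1"
proof -
  have sub: "max_power 3 \<subseteq> max_power 1" by (rule max_power_antimono) simp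
  have "(fx - qx) + qx \<in> max_power 1"
    by (rule max_power_add[OF subsetD[OF sub fx_jet] qx_qy_max_power(1)])
  moreover have "(fy - qy) + qy \<in> max_power 1"
    by (rule max_power_add[OF subsetD[OF sub fy_jet] qx_qy_max_power(2)])
  ultimately show "fx \<in> max_power 1" "fy \<in> max_power 1" by simp_all
qed

text \<open>An error of third order in one factor is multiplied by a factor that vanishes at the origin,
  so the error of the product has order four.\<close>

lemma product_jet:
  assumes "\<alpha> - \<alpha>' \<in> max_power 3" "\<beta> - \<beta>' \<in> max_power 3" "\<alpha>' \<in> max_power 1" "\<beta> \<in> max_power 1"
  shows "\<alpha> * \<beta> - \<alpha>' * \<beta>' \<in> jet_ideal"
proof -
  have "(\<alpha> - \<alpha>') * \<beta> \<in> max_power (3 + 1)" by (rule max_power_times[OF assms(1,4)])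
  moreover have "\<alpha>' * (\<beta> - \<beta>') \<in> max_power (1 + 3)" by (rule max_power_times[OF assms(3,2)])
  ultimately have "(\<alpha> - \<alpha>') * \<beta> + \<alpha>' * (\<beta> - \<beta>') \<in> jet_ideal"
    using max_power_4_subset by (intro jet_ideal_add) auto
  moreover have "(\<alpha> - \<alpha>') * \<beta> + \<alpha>' * (\<beta> - \<beta>') = \<alpha> * \<beta> - \<alpha>' * \<beta>'" by (simp only: algebra_simps)
  ultimately show ?thesis by simp
qed

lemma fx_sq_jet: "fx * fx - (monomial (k * k) 2 0 + monomial (k * a) 3 0) \<in> jet_ideal"
proof (rule jet_ideal_trans)
  show "fx * fx - qx * qx \<in> jet_ideal"
    by (rule product_jet[OF fx_jet fx_jet qx_qy_max_power(1) fx_fy_max_power(1)])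
  have "qx * qx - (monomial (k * k) 2 0 + monomial (k * a) 3 0) =
      monomial (a * a / 4) 4 0 + monomial (k * b) 1 2 + monomial (a * b / 2) 2 2 + monomial (b * b / 4) 0 4"
    unfolding qx_def polynomial_germ_simps
    by (rule arg_cong[where f = abs_germ], rule ext) (simp add: field_simps power2_eq_square eval_nat_numeral)
  also have "\<dots> \<in> jet_ideal" by (intro jet_ideal_add monomial_jet_ideal) simp_all
  finally show "qx * qx - (monomial (k * k) 2 0 + monomial (k * a) 3 0) \<in> jet_ideal" .
qed

lemma fy_sq_jet: "fy * fy - monomial (k * k) 0 2 \<in> jet_ideal"
proof (rule jet_ideal_trans)
  show "fy * fy - qy * qy \<in> jet_ideal"
    by (rule product_jet[OF fy_jet fy_jet qx_qy_max_power(2) fx_fy_max_power(2)])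
  have "qy * qy - monomial (k * k) 0 2 =
      monomial (2 * k * b) 1 2 + monomial (k * c) 0 3 + monomial (b * b) 2 2 + monomial (b * c) 1 3
      + monomial (c * c / 4) 0 4"
    unfolding qy_def polynomial_germ_simps
    by (rule arg_cong[where f = abs_germ], rule ext) (simp add: field_simps eval_nat_numeral)
  also have "\<dots> \<in> jet_ideal" by (intro jet_ideal_add monomial_jet_ideal) simp_all
  finally show "qy * qy - monomial (k * k) 0 2 \<in> jet_ideal" .
qed

lemma fx_fy_jet: "fx * fy - monomial (k * k) 1 1 \<in> jet_ideal"
proof (rule jet_ideal_trans)
  show "fx * fy - qx * qy \<in> jet_ideal"
    by (rule product_jet[OF fx_jet fy_jet qx_qy_max_power(1) fx_fy_max_power(2)])
  have "qx * qy - monomial (k * k) 1 1 =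
      monomial (k * b + k * a / 2) 2 1 + monomial (k * c / 2) 1 2 + monomial (a * b / 2) 3 1
      + monomial (a * c / 4) 2 2 + monomial (k * b / 2) 0 3 + monomial (b * b / 2) 1 3
      + monomial (b * c / 4) 0 4"
    unfolding qx_def qy_def polynomial_germ_simps
    by (rule arg_cong[where f = abs_germ], rule ext) (simp add: field_simps eval_nat_numeral)
  also have "\<dots> \<in> jet_ideal" by (intro jet_ideal_add monomial_jet_ideal) simp_all
  finally show "qx * qy - monomial (k * k) 1 1 \<in> jet_ideal" .
qed

lemma fx_sq_fyy_jet:
  "fx * fx * fyy - (monomial (k * k * k) 2 0 + monomial (k * k * (a + b)) 3 0) \<in> jet_ideal"
proof (rule jet_ideal_trans)
  show "fx * fx * fyy - (monomial (k * k) 2 0 + monomial (k * a) 3 0) * qyy \<in> jet_ideal"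
    by (rule jet_ideal_cong_mult[OF fx_sq_jet fyy_jet]) simp_all
  have "(monomial (k * k) 2 0 + monomial (k * a) 3 0) * qyy -
      (monomial (k * k * k) 2 0 + monomial (k * k * (a + b)) 3 0) =
      monomial (k * k * c) 2 1 + monomial (k * k * d22 / 2 + k * a * b) 4 0 + monomial (k * k * d13 + k * a * c) 3 1
      + monomial (k * k * d04 / 2) 2 2 + monomial (k * k * d32 / 6 + k * a * d22 / 2) 5 0
      + monomial (k * a * d13) 4 1 + monomial (k * a * d04 / 2) 3 2 + monomial (k * a * d32 / 6) 6 0"
    unfolding qyy_def polynomial_germ_simps
    by (rule arg_cong[where f = abs_germ], rule ext) (simp add: field_simps eval_nat_numeral)
  also have "\<dots> \<in> jet_ideal" by (intro jet_ideal_add monomial_jet_ideal) simp_all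
  finally show "(monomial (k * k) 2 0 + monomial (k * a) 3 0) * qyy -
      (monomial (k * k * k) 2 0 + monomial (k * k * (a + b)) 3 0) \<in> jet_ideal" .
qed

lemma fy_sq_fxx_jet: "fy * fy * fxx - monomial (k * k * k) 0 2 \<in> jet_ideal"
proof (rule jet_ideal_trans)
  show "fy * fy * fxx - monomial (k * k) 0 2 * qxx \<in> jet_ideal"
    by (rule jet_ideal_cong_mult[OF fy_sq_jet fxx_jet]) simp_all
  have "monomial (k * k) 0 2 * qxx - monomial (k * k * k) 0 2 =
      monomial (k * k * a) 1 2 + monomial (k * k * d40 / 2) 2 2 + monomial (k * k * d31) 1 3
      + monomial (k * k * d22 / 2) 0 4 + monomial (k * k * d50 / 6) 3 2"
    unfolding qxx_def polynomial_germ_simps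
    by (rule arg_cong[where f = abs_germ], rule ext) (simp add: field_simps eval_nat_numeral)
  also have "\<dots> \<in> jet_ideal" by (intro jet_ideal_add monomial_jet_ideal) simp_all
  finally show "monomial (k * k) 0 2 * qxx - monomial (k * k * k) 0 2 \<in> jet_ideal" .
qed

lemma fx_sq_fxy_jet: "fx * fx * fxy \<in> jet_ideal"
proof -
  have "fx * fx * fxy - (monomial (k * k) 2 0 + monomial (k * a) 3 0) * qxy \<in> jet_ideal"
    by (rule jet_ideal_cong_mult[OF fx_sq_jet fxy_jet]) simp_all
  moreover have "(monomial (k * k) 2 0 + monomial (k * a) 3 0) * qxy =
      monomial (k * k * b) 2 1 + monomial (k * k * d31 / 2) 4 0 + monomial (k * k * d22 + k * a * b) 3 1
      + monomial (k * k * d13 / 2) 2 2 + monomial (k * k * d41 / 6 + k * a * d31 / 2) 5 0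
      + monomial (k * a * d22) 4 1 + monomial (k * a * d13 / 2) 3 2 + monomial (k * a * d41 / 6) 6 0"
    unfolding qxy_def polynomial_germ_simps
    by (rule arg_cong[where f = abs_germ], rule ext) (simp add: field_simps eval_nat_numeral)
  moreover have "\<dots> \<in> jet_ideal" by (intro jet_ideal_add monomial_jet_ideal) simp_all
  ultimately show ?thesis using jet_ideal_add by (metis diff_add_cancel)
qed

lemma fx_fy_fxx_jet: "fx * fy * fxx - monomial (k * k * k) 1 1 \<in> jet_ideal"
proof (rule jet_ideal_trans)
  show "fx * fy * fxx - monomial (k * k) 1 1 * qxx \<in> jet_ideal"
    by (rule jet_ideal_cong_mult[OF fx_fy_jet fxx_jet]) simp_all
  have "monomial (k * k) 1 1 * qxx - monomial (k * k * k) 1 1 =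
      monomial (k * k * a) 2 1 + monomial (k * k * d40 / 2) 3 1 + monomial (k * k * d31) 2 2
      + monomial (k * k * d22 / 2) 1 3 + monomial (k * k * d50 / 6) 4 1"
    unfolding qxx_def polynomial_germ_simps
    by (rule arg_cong[where f = abs_germ], rule ext) (simp add: field_simps eval_nat_numeral)
  also have "\<dots> \<in> jet_ideal" by (intro jet_ideal_add monomial_jet_ideal) simp_all
  finally show "monomial (k * k) 1 1 * qxx - monomial (k * k * k) 1 1 \<in> jet_ideal" .
qed

text \<open>Modulo the jet ideal, \<open>f\<^sub>x\<^sup>2 f\<^sub>y\<^sub>y\<close> contributes \<open>k\<^sup>3 x\<^sup>2 + k\<^sup>2 (a + b) x\<^sup>3\<close> and \<open>f\<^sub>y\<^sup>2 f\<^sub>x\<^sub>x\<close>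
  contributes \<open>k\<^sup>3 y\<^sup>2\<close>; the rest is \<open>f\<^sub>y\<^sub>y - f\<^sub>x\<^sub>x\<close>.\<close>

lemma curv_b_jet:
  "curv_b_germ - (monomial (b - a) 1 0 + monomial c 0 1 + monomial ((d22 - d40) / 2 + k ^ 3) 2 0
    + monomial (d13 - d31) 1 1 + monomial ((d04 - d22) / 2 - k ^ 3) 0 2
    + monomial ((d32 - d50) / 6 + k\<^sup>2 * (a + b)) 3 0) \<in> jet_ideal"
proof -
  let ?J = "monomial (b - a) 1 0 + monomial c 0 1 + monomial ((d22 - d40) / 2 + k ^ 3) 2 0
    + monomial (d13 - d31) 1 1 + monomial ((d04 - d22) / 2 - k ^ 3) 0 2
    + monomial ((d32 - d50) / 6 + k\<^sup>2 * (a + b)) 3 0"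
  let ?P = "monomial (k * k * k) 2 0 + monomial (k * k * (a + b)) 3 0"
  have J: "?J = (qyy - qxx) + (?P - monomial (k * k * k) 0 2)"
    unfolding qxx_def qyy_def polynomial_germ_simps
    by (rule arg_cong[where f = abs_germ], rule ext) (simp add: field_simps eval_nat_numeral)
  have "curv_b_germ - ?J = ((fyy - qyy) - (fxx - qxx))
      + ((fx * fx * fyy - ?P) - (fy * fy * fxx - monomial (k * k * k) 0 2))"
    unfolding J unfolding curv_b_germ_def power2_eq_square by (simp only: algebra_simps mult_1)
  also have "\<dots> \<in> jet_ideal"
    by (intro jet_ideal_add jet_ideal_diff fxx_jet fyy_jet fx_sq_fyy_jet fy_sq_fxx_jet)
  finally show ?thesis .
qed

text \<open>Here \<open>f\<^sub>x\<^sup>2 f\<^sub>x\<^sub>y\<close> lies in the jet ideal, and \<open>f\<^sub>x f\<^sub>y f\<^sub>x\<^sub>x\<close> contributes \<open>k\<^sup>3 x y\<close>.\<close>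

lemma curv_c_jet:
  "curv_c_germ - (monomial b 0 1 + monomial (d31 / 2) 2 0 + monomial (d22 - k ^ 3) 1 1
    + monomial (d13 / 2) 0 2 + monomial (d41 / 6) 3 0) \<in> jet_ideal"
proof -
  let ?J = "monomial b 0 1 + monomial (d31 / 2) 2 0 + monomial (d22 - k ^ 3) 1 1
    + monomial (d13 / 2) 0 2 + monomial (d41 / 6) 3 0"
  have J: "?J = qxy - monomial (k * k * k) 1 1"
    unfolding qxy_def polynomial_germ_simps
    by (rule arg_cong[where f = abs_germ], rule ext) (simp add: field_simps eval_nat_numeral)
  have "curv_c_germ - ?J = (fxy - qxy) + fx * fx * fxy - (fx * fy * fxx - monomial (k * k * k) 1 1)"
    unfolding J unfolding curv_c_germ_def power2_eq_square by (simp only: algebra_simps mult_1)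
  also have "\<dots> \<in> jet_ideal"
    by (intro jet_ideal_add jet_ideal_diff fxy_jet fx_sq_fxy_jet fx_fy_fxx_jet)
  finally show ?thesis .
qed

end

section \<open>Dimensions of quotients by regular ideals\<close>

lemma O2_a_inv:
  assumes "holomorphic_germ \<phi>"
  shows "\<ominus>\<^bsub>O2\<^esub> \<phi> = - \<phi>"
proof -
  interpret cring O2 by (rule cring_O2)
  show ?thesis using assms by (intro sum_zero_eq_neg[symmetric, of "- \<phi>" \<phi>, simplified]) simp_all
qed

lemma const_germ_ring_hom:
  "const_germ (z + w) = const_germ z + const_germ w" "const_germ (z * w) = const_germ z * const_germ w"
  "const_germ 0 = 0" "const_germ 1 = 1" "const_germ (- z) = - const_germ z"
  by (transfer, simp)+

lemma const_germ_eq_0_iff [simp]: "const_germ z = 0 \<longleftrightarrow> z = 0"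
  by (metis const_germ_ring_hom(3) germ_value_simps(7))

text \<open>The scalars of the quotient algebra are the image of this subfield under the quotient map.\<close>

lemma subfield_const_germ: "subfield (range const_germ) O2"
proof -
  interpret cring O2 by (rule cring_O2)
  let ?K = "range const_germ"
  have "subring ?K O2"
  proof (rule subringI)
    show "?K \<subseteq> carrier O2" by auto
    show "\<one>\<^bsub>O2\<^esub> \<in> ?K" using const_germ_ring_hom(4) by (auto intro: range_eqI[of _ _ 1])
    show "\<ominus>\<^bsub>O2\<^esub> h \<in> ?K" if "h \<in> ?K" for h
      using that by (auto simp: O2_a_inv const_germ_ring_hom(5)[symmetric])
  qed (auto simp: const_germ_ring_hom[symmetric])
  then have "subcring ?K O2" by (rule subcringI) (auto simp: mult.commute)
  then show ?thesis
  proof (rule subfieldI)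
    show "Units (O2\<lparr>carrier := ?K\<rparr>) = ?K - {\<zero>\<^bsub>O2\<^esub>}"
    proof (intro equalityI subsetI)
      fix \<phi> assume "\<phi> \<in> Units (O2\<lparr>carrier := ?K\<rparr>)"
      then obtain \<psi> where "\<phi> \<in> ?K" "\<psi> * \<phi> = 1" by (auto simp: Units_def)
      then show "\<phi> \<in> ?K - {\<zero>\<^bsub>O2\<^esub>}" by auto
    next
      fix \<phi> assume "\<phi> \<in> ?K - {\<zero>\<^bsub>O2\<^esub>}"
      then obtain z where z: "\<phi> = const_germ z" "z \<noteq> 0" by (auto simp: const_germ_ring_hom(3))
      have "const_germ (inverse z) * const_germ z = 1" "const_germ z * const_germ (inverse z) = 1"
        using z(2) by (simp_all add: const_germ_ring_hom(2)[symmetric] const_germ_ring_hom(4))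
      then show "\<phi> \<in> Units (O2\<lparr>carrier := ?K\<rparr>)"
        by (auto simp: Units_def z(1) intro!: bexI[of _ "const_germ (inverse z)"])
    qed
  qed
qed

text \<open>A filtration of the quotient by the spans of \<open>1, u, \<dots>, u\<^sup>m\<^sup>-\<^sup>1\<close> matches the inductive
  definition of dimension: each step adds one vector outside the previous span.\<close>

lemma quot_dim_eqI:
  fixes u :: germ and n :: nat
  assumes I: "ideal I O2" and u: "holomorphic_germ u"
    and span: "\<And>\<phi>. holomorphic_germ \<phi> \<Longrightarrow> \<exists>c. \<phi> - (\<Sum>i<n. const_germ (c i) * u ^ i) \<in> I"
    and indep: "\<And>m c. m < n \<Longrightarrow> u ^ m - (\<Sum>i<m. const_germ (c i) * u ^ i) \<notin> I"
    and n: "n > 0"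
  shows "quot_dim I = enat n"
proof -
  interpret O2: cring O2 by (rule cring_O2)
  interpret I: ideal I O2 by (rule I)
  let ?Q = "O2 Quot I" and ?h = "\<lambda>\<phi>. I +>\<^bsub>O2\<^esub> \<phi>"
  interpret Q: ring ?Q by (rule I.quotient_is_ring)
  interpret h: ring_hom_ring O2 ?Q ?h by (rule I.rcos_ring_hom_ring)
  define P where "P m = {\<Sum>i<m. const_germ (c i) * u ^ i | c. True}" for m
  have hol_sum: "holomorphic_germ (\<Sum>i<m. const_germ (c i) * u ^ i)" for m c
    by (induction m) (simp_all add: u)
  have eq_iff: "?h \<phi> = ?h \<psi> \<longleftrightarrow> \<phi> - \<psi> \<in> I" if "holomorphic_germ \<phi>" "holomorphic_germ \<psi>" for \<phi> \<psi>
    using O2.quotient_eq_iff_same_a_r_cos[OF I, of \<phi> \<psi>] that by (simp add: a_minus_def O2_a_inv)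
  have add: "?h (\<phi> + \<psi>) = ?h \<phi> \<oplus>\<^bsub>?Q\<^esub> ?h \<psi>" and mult: "?h (\<phi> * \<psi>) = ?h \<phi> \<otimes>\<^bsub>?Q\<^esub> ?h \<psi>"
    if "holomorphic_germ \<phi>" "holomorphic_germ \<psi>" for \<phi> \<psi>
    using h.hom_add[of \<phi> \<psi>] h.hom_mult[of \<phi> \<psi>] that by simp_all
  have carr: "carrier ?Q = ?h ` carrier O2"
    by (auto simp: FactRing_def A_RCOSETS_def')
  have K: "const_cosets I = ?h ` range const_germ"
    by (auto simp: const_cosets_def)
  have "1 \<notin> I" using indep[OF n, of "\<lambda>_. 0"] by simp
  then have "?h 1 \<noteq> ?h 0" using eq_iff[of 1 0] by simp
  then have "\<one>\<^bsub>?Q\<^esub> \<noteq> \<zero>\<^bsub>?Q\<^esub>" using h.hom_one h.hom_zero by simp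
  then have sub: "subfield (const_cosets I) ?Q"
    unfolding K by (rule h.img_is_subfield(2)[OF subfield_const_germ])
  have dim: "Q.dimension m (const_cosets I) (?h ` P m)" if "m \<le> n" for m
    using that
  proof (induction m)
    case 0
    have "?h ` P 0 = {\<zero>\<^bsub>?Q\<^esub>}" using h.hom_zero by (auto simp: P_def)
    then show ?case by simp
  next
    case (Suc m)
    have "?h (u ^ m) \<in> carrier ?Q" using h.hom_closed[of "u ^ m"] u by simp
    moreover have "?h (u ^ m) \<notin> ?h ` P m"
    proof
      assume "?h (u ^ m) \<in> ?h ` P m"
      then obtain c where "?h (u ^ m) = ?h (\<Sum>i<m. const_germ (c i) * u ^ i)" by (auto simp: P_def)
      then have "u ^ m - (\<Sum>i<m. const_germ (c i) * u ^ i) \<in> I"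
        using eq_iff hol_sum u by simp
      then show False using indep[of m c] Suc.prems by simp
    qed
    moreover have "Q.dimension m (const_cosets I) (?h ` P m)" using Suc by simp
    ultimately have "Q.dimension (Suc m) (const_cosets I) (Q.line_extension (const_cosets I) (?h (u ^ m)) (?h ` P m))"
      by (rule Q.Suc_dim)
    moreover have "Q.line_extension (const_cosets I) (?h (u ^ m)) (?h ` P m) = ?h ` P (Suc m)"
    proof (intro equalityI subsetI)
      fix x assume "x \<in> Q.line_extension (const_cosets I) (?h (u ^ m)) (?h ` P m)"
      then obtain z c where "x = ?h (const_germ z) \<otimes>\<^bsub>?Q\<^esub> ?h (u ^ m) \<oplus>\<^bsub>?Q\<^esub> ?h (\<Sum>i<m. const_germ (c i) * u ^ i)"
        unfolding Q.line_extension_mem_iff K P_def by auto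
      also have "\<dots> = ?h (const_germ z * u ^ m + (\<Sum>i<m. const_germ (c i) * u ^ i))"
        using u hol_sum by (simp add: add mult)
      also have "const_germ z * u ^ m + (\<Sum>i<m. const_germ (c i) * u ^ i) =
          (\<Sum>i<Suc m. const_germ ((c(m := z)) i) * u ^ i)"
        by (simp add: add.commute)
      also have "?h \<dots> \<in> ?h ` P (Suc m)" unfolding P_def by blast
      finally show "x \<in> ?h ` P (Suc m)" .
    next
      fix x assume "x \<in> ?h ` P (Suc m)"
      then obtain c where "x = ?h (\<Sum>i<Suc m. const_germ (c i) * u ^ i)" by (auto simp: P_def)
      also have "(\<Sum>i<Suc m. const_germ (c i) * u ^ i) =
          const_germ (c m) * u ^ m + (\<Sum>i<m. const_germ (c i) * u ^ i)"
        by (simp add: add.commute)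
      also have "?h \<dots> = ?h (const_germ (c m)) \<otimes>\<^bsub>?Q\<^esub> ?h (u ^ m) \<oplus>\<^bsub>?Q\<^esub> ?h (\<Sum>i<m. const_germ (c i) * u ^ i)"
        using u hol_sum by (simp add: add mult)
      finally show "x \<in> Q.line_extension (const_cosets I) (?h (u ^ m)) (?h ` P m)"
        unfolding Q.line_extension_mem_iff K P_def by blast
    qed
    ultimately show ?case by simp
  qed
  have "carrier ?Q = ?h ` P n"
  proof (intro equalityI subsetI)
    fix x assume "x \<in> carrier ?Q"
    then obtain \<phi> where \<phi>: "holomorphic_germ \<phi>" "x = ?h \<phi>" by (auto simp: carr)
    obtain c where "\<phi> - (\<Sum>i<n. const_germ (c i) * u ^ i) \<in> I" using span[OF \<phi>(1)] by blast
    then have "x = ?h (\<Sum>i<n. const_germ (c i) * u ^ i)" using eq_iff \<phi> hol_sum by simp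
    then show "x \<in> ?h ` P n" unfolding P_def by blast
  next
    fix x assume "x \<in> ?h ` P n"
    then show "x \<in> carrier ?Q" using hol_sum by (auto simp: carr P_def)
  qed
  then have d: "Q.dimension n (const_cosets I) (carrier ?Q)" using dim[of n] by simp
  then show ?thesis
    using Q.finite_dimensionI[OF d] Q.dimI[OF sub d] by (simp add: quot_dim_def over_def)
qed

text \<open>A polynomial of degree at most \<open>n\<close> that vanishes at zero to order \<open>n + 1\<close> is zero. The lowest
  coefficient is the limit at zero; then divide by \<open>t\<close>.\<close>

lemma power_sum_eq_higher_order_imp_zero:
  fixes c :: "nat \<Rightarrow> complex"
  assumes "\<forall>\<^sub>F t in at 0. (\<Sum>i\<le>n. c i * t ^ i) = t ^ Suc n * H t" "(H \<longlongrightarrow> L) (at 0)" "i \<le> n"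
  shows "c i = 0"
  using assms(1,3)
proof (induction n arbitrary: c i)
  case (0 c i)
  have "((\<lambda>t. t ^ Suc 0 * H t) \<longlongrightarrow> 0 ^ Suc 0 * L) (at 0)"
    by (intro tendsto_intros assms(2))
  moreover have "((\<lambda>t. \<Sum>i\<le>0. c i * t ^ i) \<longlongrightarrow> (\<Sum>i\<le>0. c i * 0 ^ i)) (at 0)"
    by (intro tendsto_intros)
  then have "((\<lambda>t. t ^ Suc 0 * H t) \<longlongrightarrow> (\<Sum>i\<le>0. c i * 0 ^ i)) (at 0)"
    using 0(1) by (rule Lim_transform_eventually)
  ultimately have "(\<Sum>i\<le>0. c i * 0 ^ i) = 0 ^ Suc 0 * L"
    by (intro tendsto_unique[OF _ \<open>((\<lambda>t. t ^ Suc 0 * H t) \<longlongrightarrow> (\<Sum>i\<le>0. c i * 0 ^ i)) (at 0)\<close>]) simp_all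
  then show ?case using 0(2) by simp
next
  case (Suc n c i)
  have "((\<lambda>t. t ^ Suc (Suc n) * H t) \<longlongrightarrow> 0 ^ Suc (Suc n) * L) (at 0)"
    by (intro tendsto_intros assms(2))
  moreover have "((\<lambda>t. \<Sum>i\<le>Suc n. c i * t ^ i) \<longlongrightarrow> (\<Sum>i\<le>Suc n. c i * 0 ^ i)) (at 0)"
    by (intro tendsto_intros)
  then have *: "((\<lambda>t. t ^ Suc (Suc n) * H t) \<longlongrightarrow> (\<Sum>i\<le>Suc n. c i * 0 ^ i)) (at 0)"
    using Suc.prems(1) by (rule Lim_transform_eventually)
  ultimately have "(\<Sum>i\<le>Suc n. c i * 0 ^ i) = 0 ^ Suc (Suc n) * L"
    by (intro tendsto_unique[OF _ *]) simp_all
  then have c0: "c 0 = 0" by (simp add: sum.atMost_Suc_shift del: sum.atMost_Suc)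
  have "\<forall>\<^sub>F t in at 0. (\<Sum>i\<le>n. c (Suc i) * t ^ i) = t ^ Suc n * H t"
    using Suc.prems(1) eventually_neq_at_within[of 0 0 UNIV]
  proof eventually_elim
    case (elim t)
    have "t * (\<Sum>i\<le>n. c (Suc i) * t ^ i) = (\<Sum>i\<le>Suc n. c i * t ^ i)"
      using c0 by (simp add: sum.atMost_Suc_shift sum_distrib_left mult_ac del: sum.atMost_Suc)
    then have "t * (\<Sum>i\<le>n. c (Suc i) * t ^ i) = t * (t ^ Suc n * H t)"
      using elim(1) by (simp only: power_Suc mult.assoc)
    then show ?case by (rule mult_left_cancel[THEN iffD1, OF elim(2)])
  qed
  from Suc.IH[OF this] show ?case using c0 Suc.prems(2) by (cases i) simp_all
qed

lemma abs_germ_power_sum: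
  "(\<Sum>i<m. const_germ (c i) * abs_germ F ^ i) = abs_germ (\<lambda>p. \<Sum>i<m. c i * F p ^ i)"
  by (induction m) (simp_all add: zero_germ.abs_eq const_germ.abs_eq abs_germ_power times_germ.abs_eq plus_germ.abs_eq)

definition ideal_of_pair :: "germ \<Rightarrow> germ \<Rightarrow> germ set" where
  "ideal_of_pair T V = {p * T + q * V | p q. holomorphic_germ p \<and> holomorphic_germ q}"

lemma ideal_of_pair_ideal:
  assumes "holomorphic_germ T" "holomorphic_germ V"
  shows "ideal (ideal_of_pair T V) O2"
proof -
  interpret cring O2 by (rule cring_O2)
  let ?J = "ideal_of_pair T V"
  have sub: "?J \<subseteq> carrier O2" using assms by (auto simp: ideal_of_pair_def)
  have mem: "p * T + q * V \<in> ?J" if "holomorphic_germ p" "holomorphic_germ q" for p q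
    using that unfolding ideal_of_pair_def by blast
  have mult: "x * a \<in> ?J" if "a \<in> ?J" "holomorphic_germ x" for a x
  proof -
    obtain p q where pq: "a = p * T + q * V" "holomorphic_germ p" "holomorphic_germ q"
      using \<open>a \<in> ?J\<close> unfolding ideal_of_pair_def by blast
    have "x * a = (x * p) * T + (x * q) * V" by (simp add: pq algebra_simps)
    then show ?thesis using mem[of "x * p" "x * q"] pq \<open>holomorphic_germ x\<close> by simp
  qed
  show ?thesis
  proof (rule idealI[OF ring_axioms])
    show "subgroup ?J (add_monoid O2)"
    proof (rule add.subgroupI[OF sub])
      show "?J \<noteq> {}" using mem[of 0 0] by auto
      show "\<ominus>\<^bsub>O2\<^esub> a \<in> ?J" if "a \<in> ?J" for a
        using mult[OF that, of "- 1"] that sub by (auto simp: O2_a_inv)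
      show "a \<oplus>\<^bsub>O2\<^esub> b \<in> ?J" if ab: "a \<in> ?J" "b \<in> ?J" for a b
      proof -
        obtain p q where pq: "a = p * T + q * V" "holomorphic_germ p" "holomorphic_germ q"
          using ab(1) unfolding ideal_of_pair_def by blast
        obtain r s where rs: "b = r * T + s * V" "holomorphic_germ r" "holomorphic_germ s"
          using ab(2) unfolding ideal_of_pair_def by blast
        have "a \<oplus>\<^bsub>O2\<^esub> b = (p + r) * T + (q + s) * V" by (simp add: pq rs algebra_simps)
        then show ?thesis using mem[of "p + r" "q + s"] pq rs by simp
      qed
    qed
    show "x \<otimes>\<^bsub>O2\<^esub> a \<in> ?J" "a \<otimes>\<^bsub>O2\<^esub> x \<in> ?J" if "a \<in> ?J" "x \<in> carrier O2" for a x
      using mult[of a x] that by (simp_all add: mult.commute)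
  qed
qed

text \<open>The two generating pairs are related by a matrix of germs whose determinant is a unit.\<close>

lemma genideal_eq_ideal_of_pair:
  assumes hol: "holomorphic_germ T" "holomorphic_germ V"
    "holomorphic_germ s" "holomorphic_germ t" "holomorphic_germ u" "holomorphic_germ v"
    and det: "germ_value s * germ_value v \<noteq> germ_value t * germ_value u"
  shows "Idl\<^bsub>O2\<^esub> {s * T + t * V, u * T + v * V} = ideal_of_pair T V"
proof -
  interpret cring O2 by (rule cring_O2)
  let ?B = "s * T + t * V" and ?C = "u * T + v * V"
  have BC: "{?B, ?C} \<subseteq> carrier O2" using hol by simp
  interpret I: ideal "Idl\<^bsub>O2\<^esub> {?B, ?C}" O2 by (rule genideal_ideal[OF BC])
  show ?thesis
  proof
    show "Idl\<^bsub>O2\<^esub> {?B, ?C} \<subseteq> ideal_of_pair T V"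
    proof (rule genideal_minimal[OF ideal_of_pair_ideal[OF hol(1,2)]])
      show "{?B, ?C} \<subseteq> ideal_of_pair T V" using hol unfolding ideal_of_pair_def by blast
    qed
  next
    obtain w where w: "holomorphic_germ w" "(s * v - t * u) * w = 1"
      using holomorphic_germ_unit[of "s * v - t * u"] hol det by auto
    have mem: "x * ?B + y * ?C \<in> Idl\<^bsub>O2\<^esub> {?B, ?C}" if "holomorphic_germ x" "holomorphic_germ y" for x y
    proof -
      have "?B \<in> Idl\<^bsub>O2\<^esub> {?B, ?C}" "?C \<in> Idl\<^bsub>O2\<^esub> {?B, ?C}" using genideal_self[OF BC] by auto
      then show ?thesis using I.I_l_closed[of ?B x] I.I_l_closed[of ?C y] I.a_closed that by simp
    qed
    show "ideal_of_pair T V \<subseteq> Idl\<^bsub>O2\<^esub> {?B, ?C}"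
    proof
      fix \<phi> assume "\<phi> \<in> ideal_of_pair T V"
      then obtain p q where pq: "\<phi> = p * T + q * V" "holomorphic_germ p" "holomorphic_germ q"
        unfolding ideal_of_pair_def by blast
      \<comment> \<open>Cramer's rule for the combination of the generators that gives \<open>p T + q V\<close>.\<close>
      let ?x = "w * (p * v - q * u)" and ?y = "w * (q * s - p * t)"
      have "?x * ?B + ?y * ?C = ((s * v - t * u) * w) * \<phi>"
        by (simp add: pq(1) algebra_simps)
      then have "\<phi> = ?x * ?B + ?y * ?C" by (simp add: w(2))
      also have "\<dots> \<in> Idl\<^bsub>O2\<^esub> {?B, ?C}" using hol w pq by (intro mem) simp_all
      finally show "\<phi> \<in> Idl\<^bsub>O2\<^esub> {?B, ?C}" .
    qed
  qed
qed

text \<open>The curve \<open>T = 0\<close> is parametrised by \<open>\<gamma>\<close> with parameter \<open>U\<close>. Restriction to the curve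
  shows independence of the powers of \<open>U\<close>. Stating this for abstract coordinates \<open>U, V\<close> covers curves
  that are graphs over either axis.\<close>

lemma quot_dim_curve:
  fixes U V T :: germ and \<alpha> :: complex and n :: nat
  assumes hol: "holomorphic_germ U" "holomorphic_germ V"
    and coords: "\<And>\<phi>. holomorphic_germ \<phi> \<Longrightarrow> \<exists>\<phi>1 \<phi>2. holomorphic_germ \<phi>1 \<and> holomorphic_germ \<phi>2 \<and>
      \<phi> = const_germ (germ_value \<phi>) + U * \<phi>1 + V * \<phi>2"
    and T: "T = V - const_germ \<alpha> * U\<^sup>2"
    and Uf: "U = abs_germ Uf" and Tf: "T = abs_germ Tf"
    and \<gamma>: "isCont \<gamma> 0" "\<gamma> 0 = 0" "\<And>t. Uf (\<gamma> t) = t" "\<And>t. Tf (\<gamma> t) = 0"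
    and n: "n > 0"
  shows "quot_dim (ideal_of_pair T (U ^ n)) = enat n"
proof (rule quot_dim_eqI[OF _ hol(1) _ _ n])
  have holT: "holomorphic_germ T" using hol by (simp add: T)
  then show "ideal (ideal_of_pair T (U ^ n)) O2" using hol by (simp add: ideal_of_pair_ideal)
  show "\<exists>c. \<phi> - (\<Sum>i<n. const_germ (c i) * U ^ i) \<in> ideal_of_pair T (U ^ n)"
    if \<phi>: "holomorphic_germ \<phi>" for \<phi>
  proof -
    have "\<exists>c p q. holomorphic_germ p \<and> holomorphic_germ q \<and>
        \<phi> - (\<Sum>i<m. const_germ (c i) * U ^ i) = p * T + q * U ^ m" for m
    proof (induction m)
      case 0
      show ?case using \<phi> by (intro exI[of _ "\<lambda>_. 0"] exI[of _ 0] exI[of _ \<phi>]) simp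
    next
      case (Suc m)
      obtain c p q where IH: "holomorphic_germ p" "holomorphic_germ q"
        "\<phi> - (\<Sum>i<m. const_germ (c i) * U ^ i) = p * T + q * U ^ m" using Suc by blast
      obtain q1 q2 where q: "holomorphic_germ q1" "holomorphic_germ q2"
        "q = const_germ (germ_value q) + U * q1 + V * q2" using coords[OF IH(2)] by blast
      let ?c = "c(m := germ_value q)"
      have sum: "(\<Sum>i<Suc m. const_germ (?c i) * U ^ i) =
          (\<Sum>i<m. const_germ (c i) * U ^ i) + const_germ (germ_value q) * U ^ m" by simp
      \<comment> \<open>Eliminate \<open>V\<close> by \<open>V = T + \<alpha> U\<^sup>2\<close>.\<close>
      have "q * U ^ m = (const_germ (germ_value q) + U * q1 + V * q2) * U ^ m"
        by (rule arg_cong[OF q(3)])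
      also have "\<dots> = const_germ (germ_value q) * U ^ m + (q2 * U ^ m) * T +
          (q1 + const_germ \<alpha> * U * q2) * U ^ Suc m"
        by (simp add: T algebra_simps power2_eq_square)
      finally have "\<phi> - (\<Sum>i<Suc m. const_germ (?c i) * U ^ i) =
          (p + q2 * U ^ m) * T + (q1 + const_germ \<alpha> * U * q2) * U ^ Suc m"
        unfolding sum diff_diff_eq[symmetric] IH(3) by (simp only: algebra_simps)
      moreover have "holomorphic_germ (p + q2 * U ^ m)" "holomorphic_germ (q1 + const_germ \<alpha> * U * q2)"
        using IH q hol by simp_all
      ultimately show ?case by blast
    qed
    then show ?thesis unfolding ideal_of_pair_def by blast
  qed
  show "U ^ m - (\<Sum>i<m. const_germ (c i) * U ^ i) \<notin> ideal_of_pair T (U ^ n)" if m: "m < n" for m c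
  proof
    assume "U ^ m - (\<Sum>i<m. const_germ (c i) * U ^ i) \<in> ideal_of_pair T (U ^ n)"
    then obtain p q where pq: "holomorphic_germ p" "holomorphic_germ q"
      "U ^ m - (\<Sum>i<m. const_germ (c i) * U ^ i) = p * T + q * U ^ n"
      unfolding ideal_of_pair_def by blast
    obtain P where P: "p = abs_germ P" by (induction p rule: germ.abs_induct) simp
    obtain Q where Q: "q = abs_germ Q" by (induction q rule: germ.abs_induct) simp
    have "holomorphic_at_origin Q" using pq(2) by (simp add: Q holomorphic_germ.abs_eq)
    then have contQ: "isCont Q (\<gamma> 0)" using holomorphic_at_origin_isCont \<gamma>(2) by simp
    have "abs_germ (\<lambda>z. Uf z ^ m - (\<Sum>i<m. c i * Uf z ^ i)) = abs_germ (\<lambda>z. P z * Tf z + Q z * Uf z ^ n)"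
      using pq(3) unfolding P Q Uf Tf abs_germ_power_sum
      by (simp add: abs_germ_power times_germ.abs_eq plus_germ.abs_eq minus_germ.abs_eq)
    then have ev: "\<forall>\<^sub>F z in nhds 0. Uf z ^ m - (\<Sum>i<m. c i * Uf z ^ i) = P z * Tf z + Q z * Uf z ^ n"
      by (simp add: germ.abs_eq_iff)
    have "filterlim \<gamma> (nhds 0) (nhds 0)"
      using \<gamma>(1,2) tendsto_at_iff_tendsto_nhds[of \<gamma> 0] by (simp add: isCont_def)
    from eventually_compose_filterlim[OF ev this]
    have "\<forall>\<^sub>F t in nhds 0. t ^ m - (\<Sum>i<m. c i * t ^ i) = Q (\<gamma> t) * t ^ n"
      by (simp add: \<gamma>(3,4))
    then have "\<forall>\<^sub>F t in at 0. t ^ m - (\<Sum>i<m. c i * t ^ i) = Q (\<gamma> t) * t ^ n"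
      by (rule filter_leD[OF at_within_le_nhds])
    then have "\<forall>\<^sub>F t in at 0. (\<Sum>i\<le>m. (if i = m then 1 else - c i) * t ^ i) =
        t ^ Suc m * (t ^ (n - Suc m) * Q (\<gamma> t))"
    proof (rule eventually_mono)
      fix t assume *: "t ^ m - (\<Sum>i<m. c i * t ^ i) = Q (\<gamma> t) * t ^ n"
      have "(\<Sum>i\<le>m. (if i = m then 1 else - c i) * t ^ i) = (\<Sum>i<m. (if i = m then 1 else - c i) * t ^ i) + t ^ m"
        by (simp add: lessThan_Suc_atMost[symmetric])
      also have "(\<Sum>i<m. (if i = m then 1 else - c i) * t ^ i) = - (\<Sum>i<m. c i * t ^ i)"
        by (simp add: sum_negf[symmetric])
      finally have "(\<Sum>i\<le>m. (if i = m then 1 else - c i) * t ^ i) = Q (\<gamma> t) * t ^ n" using * by simp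
      also have "t ^ n = t ^ Suc m * t ^ (n - Suc m)"
        using m by (simp only: power_add[symmetric]) simp
      finally show "(\<Sum>i\<le>m. (if i = m then 1 else - c i) * t ^ i) = t ^ Suc m * (t ^ (n - Suc m) * Q (\<gamma> t))"
        by (simp add: mult_ac)
    qed
    moreover have "((\<lambda>t. t ^ (n - Suc m) * Q (\<gamma> t)) \<longlongrightarrow> 0 ^ (n - Suc m) * Q (\<gamma> 0)) (at 0)"
      using isCont_o2[OF \<gamma>(1) contQ] by (intro tendsto_intros) (simp add: isCont_def)
    ultimately have "(if m = m then 1 else - c m) = 0"
      by (rule power_sum_eq_higher_order_imp_zero[where i = m]) simp
    then show False by simp
  qed
qed

lemma quot_dim_parabola:
  assumes "n > 0"
  shows "quot_dim (ideal_of_pair (coord_y - const_germ \<alpha> * coord_x\<^sup>2) (coord_x ^ n)) = enat n"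
proof (rule quot_dim_curve[OF _ _ _ refl coord_x.abs_eq _ _ _ _ _ assms])
  show "coord_y - const_germ \<alpha> * coord_x\<^sup>2 = abs_germ (\<lambda>p. snd p - \<alpha> * fst p ^ 2)"
    by (simp add: coord_x.abs_eq coord_y.abs_eq const_germ.abs_eq abs_germ_power times_germ.abs_eq minus_germ.abs_eq)
  show "isCont (\<lambda>t. (t, \<alpha> * t ^ 2)) 0" by (intro continuous_intros)
  show "(0, \<alpha> * 0 ^ 2) = (0 :: complex \<times> complex)" by (simp add: zero_prod_def)
  show "\<exists>\<phi>1 \<phi>2. holomorphic_germ \<phi>1 \<and> holomorphic_germ \<phi>2 \<and>
      \<phi> = const_germ (germ_value \<phi>) + coord_x * \<phi>1 + coord_y * \<phi>2" if "holomorphic_germ \<phi>" for \<phi>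
    using germ_hadamard[OF that] by metis
qed simp_all

lemma quot_dim_vertical_line:
  assumes "n > 0"
  shows "quot_dim (ideal_of_pair coord_x (coord_y ^ n)) = enat n"
proof (rule quot_dim_curve[where \<alpha> = 0, OF _ _ _ _ coord_y.abs_eq coord_x.abs_eq _ _ _ _ assms])
  show "isCont (\<lambda>t. (0 :: complex, t :: complex)) 0" by (intro continuous_intros)
  show "(0, 0) = (0 :: complex \<times> complex)" by (simp add: zero_prod_def)
  show "coord_x = coord_x - const_germ 0 * coord_y\<^sup>2" by (simp add: const_germ_ring_hom)
  show "\<exists>\<phi>1 \<phi>2. holomorphic_germ \<phi>1 \<and> holomorphic_germ \<phi>2 \<and>
      \<phi> = const_germ (germ_value \<phi>) + coord_y * \<phi>1 + coord_x * \<phi>2" if \<phi>: "holomorphic_germ \<phi>" for \<phi>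
  proof -
    obtain \<phi>1 \<phi>2 where "holomorphic_germ \<phi>1" "holomorphic_germ \<phi>2"
      "\<phi> = const_germ (germ_value \<phi>) + coord_x * \<phi>1 + coord_y * \<phi>2" by (rule germ_hadamard[OF \<phi>])
    then show ?thesis by (intro exI[of _ \<phi>2] exI[of _ \<phi>1]) (simp add: algebra_simps)
  qed
qed simp_all

text \<open>Substitute \<open>y = T + \<alpha> x\<^sup>2\<close>, where \<open>T = y - \<alpha> x\<^sup>2\<close>, and collect the multiples of \<open>T\<close> and of \<open>x\<^sup>3\<close>. The
  generators of the jet ideal affect the two cofactors only by germs vanishing at the origin.\<close>

lemma jet_parabola_decomposition:
  assumes jet: "\<phi> - (monomial l10 1 0 + monomial l01 0 1 + monomial q20 2 0 + monomial q11 1 1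
      + monomial q02 0 2 + monomial r30 3 0) \<in> jet_ideal"
  obtains u v where "holomorphic_germ u" "holomorphic_germ v" "germ_value u = l01"
    "germ_value v = r30 + \<alpha> * q11"
    "\<phi> = u * (coord_y - const_germ \<alpha> * coord_x\<^sup>2) + (monomial l10 1 0 + monomial (q20 + \<alpha> * l01) 2 0 + v * coord_x ^ 3)"
proof -
  obtain a b c d where hol: "holomorphic_germ a" "holomorphic_germ b" "holomorphic_germ c" "holomorphic_germ d"
    and eq: "\<phi> - (monomial l10 1 0 + monomial l01 0 1 + monomial q20 2 0 + monomial q11 1 1
      + monomial q02 0 2 + monomial r30 3 0) =
      monomial 1 4 0 * a + monomial 1 2 1 * b + monomial 1 1 2 * c + monomial 1 0 3 * d"
    using jet by (rule jet_idealE)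
  define u where "u = monomial l01 0 0 + monomial q11 1 0 + monomial q02 0 1 + monomial (q02 * \<alpha>) 2 0 +
    (monomial 1 2 0 * b + monomial 1 1 1 * c + monomial 1 0 2 * d + monomial \<alpha> 2 1 * d)"
  define v where "v = monomial (r30 + \<alpha> * q11) 0 0 + monomial (q02 * \<alpha>\<^sup>2) 1 0 +
    (monomial 1 1 0 * a + monomial \<alpha> 1 0 * b + monomial \<alpha> 0 1 * c + monomial (\<alpha>\<^sup>2) 1 1 * d)"
  have "\<phi> = (monomial l10 1 0 + monomial l01 0 1 + monomial q20 2 0 + monomial q11 1 1
      + monomial q02 0 2 + monomial r30 3 0) +
      (monomial 1 4 0 * a + monomial 1 2 1 * b + monomial 1 1 2 * c + monomial 1 0 3 * d)"
    using eq unfolding diff_eq_eq by (simp only: add.commute)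
  also have "\<dots> = u * (coord_y - const_germ \<alpha> * coord_x\<^sup>2) +
      (monomial l10 1 0 + monomial (q20 + \<alpha> * l01) 2 0 + v * coord_x ^ 3)"
  proof -
    obtain A where A: "a = abs_germ A" by (induction a rule: germ.abs_induct) simp
    obtain B where B: "b = abs_germ B" by (induction b rule: germ.abs_induct) simp
    obtain C where C: "c = abs_germ C" by (induction c rule: germ.abs_induct) simp
    obtain D where D: "d = abs_germ D" by (induction d rule: germ.abs_induct) simp
    show ?thesis
      unfolding u_def v_def A B C D polynomial_germ_simps coord_x.abs_eq coord_y.abs_eq const_germ.abs_eq abs_germ_power
      by (rule arg_cong[where f = abs_germ], rule ext) (simp add: algebra_simps eval_nat_numeral)
  qed
  finally show ?thesis
    using hol by (intro that[of u v]) (simp_all add: u_def v_def)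
qed

text \<open>The analogue for the \<open>y\<close>-axis: collect the multiples of \<open>x\<close>, and of \<open>y\<^sup>2\<close> among the remaining terms.\<close>

lemma jet_vertical_decomposition:
  assumes jet: "\<phi> - (monomial l10 1 0 + monomial l01 0 1 + monomial q20 2 0 + monomial q11 1 1
      + monomial q02 0 2 + monomial r30 3 0) \<in> jet_ideal" and l01: "l01 = 0"
  obtains u v where "holomorphic_germ u" "holomorphic_germ v" "germ_value u = l10" "germ_value v = q02"
    "\<phi> = u * coord_x + v * coord_y ^ 2"
proof -
  obtain a b c d where hol: "holomorphic_germ a" "holomorphic_germ b" "holomorphic_germ c" "holomorphic_germ d"
    and eq: "\<phi> - (monomial l10 1 0 + monomial l01 0 1 + monomial q20 2 0 + monomial q11 1 1
      + monomial q02 0 2 + monomial r30 3 0) =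
      monomial 1 4 0 * a + monomial 1 2 1 * b + monomial 1 1 2 * c + monomial 1 0 3 * d"
    using jet by (rule jet_idealE)
  define u where "u = monomial l10 0 0 + monomial q20 1 0 + monomial q11 0 1 + monomial r30 2 0 +
    (monomial 1 3 0 * a + monomial 1 1 1 * b + monomial 1 0 2 * c)"
  define v where "v = monomial q02 0 0 + monomial 1 0 1 * d"
  have "\<phi> = (monomial l10 1 0 + monomial l01 0 1 + monomial q20 2 0 + monomial q11 1 1
      + monomial q02 0 2 + monomial r30 3 0) +
      (monomial 1 4 0 * a + monomial 1 2 1 * b + monomial 1 1 2 * c + monomial 1 0 3 * d)"
    using eq unfolding diff_eq_eq by (simp only: add.commute)
  also have "\<dots> = u * coord_x + v * coord_y ^ 2"
  proof -
    obtain A where A: "a = abs_germ A" by (induction a rule: germ.abs_induct) simp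
    obtain B where B: "b = abs_germ B" by (induction b rule: germ.abs_induct) simp
    obtain C where C: "c = abs_germ C" by (induction c rule: germ.abs_induct) simp
    obtain D where D: "d = abs_germ D" by (induction d rule: germ.abs_induct) simp
    show ?thesis
      unfolding u_def v_def A B C D polynomial_germ_simps coord_x.abs_eq coord_y.abs_eq const_germ.abs_eq abs_germ_power
      by (rule arg_cong[where f = abs_germ], rule ext) (simp add: l01 algebra_simps eval_nat_numeral)
  qed
  finally show ?thesis
    using hol by (intro that[of u v]) (simp_all add: u_def v_def)
qed

section \<open>Multiplicity of the umbilic point\<close>

context umbilic_jet
begin

text \<open>The factor \<open>w\<close> is the reciprocal of the length of the unnormalised normal vector.\<close>

lemma curvature_extends:
  assumes ext: "extends \<phi> f"
  obtains w where "holomorphic_germ w" "germ_value w \<noteq> 0"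
    "extends (w * curv_b_germ) (curv_b (graph_patch f))" "extends (w * curv_c_germ) (curv_c (graph_patch f))"
proof -
  note d = extends_partial_derivatives[OF hol ext]
  have fx: "extends fx (pdx f)" and fy: "extends fy (pdy f)"
    using d unfolding fx_def fy_def by blast+
  have fxx: "extends fxx (pdx (pdx f))" and fxy: "extends fxy (pdy (pdx f))"
    using extends_partial_derivatives[OF holomorphic_germ_dx[OF hol] d(1)] unfolding fxx_def fxy_def by blast+
  have fyy: "extends fyy (pdy (pdy f))"
    using extends_partial_derivatives[OF holomorphic_germ_dy[OF hol] d(2)] unfolding fyy_def by blast
  define S where "S q = 1 + (pdx f q)\<^sup>2 + (pdy f q)\<^sup>2" for q
  have S: "extends (1 + fx\<^sup>2 + fy\<^sup>2) S"
    unfolding S_def by (intro extends_add extends_one extends_power fx fy)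
  have S0: "S 0 > 0" unfolding S_def by (intro add_pos_nonneg) simp_all
  have holS: "holomorphic_germ (1 + fx\<^sup>2 + fy\<^sup>2)" by simp
  obtain w where w: "holomorphic_germ w" "extends w (\<lambda>q. 1 / sqrt (S q))" "germ_value w \<noteq> 0"
    by (rule extends_inverse_sqrt[OF holS S S0])
  have "extends (w * curv_b_germ)
      (\<lambda>q. 1 / sqrt (S q) * ((1 + (pdx f q)\<^sup>2) * pdy (pdy f) q - (1 + (pdy f q)\<^sup>2) * pdx (pdx f) q))"
    unfolding curv_b_germ_def
    by (intro extends_mult extends_diff extends_add extends_one extends_power w fx fy fxx fyy)
  moreover have "\<forall>\<^sub>F q in nhds 0. 1 / sqrt (S q) *
      ((1 + (pdx f q)\<^sup>2) * pdy (pdy f) q - (1 + (pdy f q)\<^sup>2) * pdx (pdx f) q) = curv_b (graph_patch f) q"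
    using graph_patch_derivatives[OF hol ext]
  proof (rule eventually_mono, elim conjE)
    fix q
    assume "pdx (graph_patch f) q = vector [1, 0, pdx f q]" "pdy (graph_patch f) q = vector [0, 1, pdy f q]"
      "pdx (pdx (graph_patch f)) q = vector [0, 0, pdx (pdx f) q]"
      "pdy (pdx (graph_patch f)) q = vector [0, 0, pdy (pdx f) q]"
      "pdy (pdy (graph_patch f)) q = vector [0, 0, pdy (pdy f) q]"
    note forms = curvature_forms_of_jet[OF this]
    show "1 / sqrt (S q) * ((1 + (pdx f q)\<^sup>2) * pdy (pdy f) q - (1 + (pdy f q)\<^sup>2) * pdx (pdx f) q)
        = curv_b (graph_patch f) q"
      unfolding curv_b_def forms S_def by (simp add: diff_divide_distrib)
  qed
  ultimately have b: "extends (w * curv_b_germ) (curv_b (graph_patch f))" by (rule extends_cong)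
  have "extends (w * curv_c_germ)
      (\<lambda>q. 1 / sqrt (S q) * ((1 + (pdx f q)\<^sup>2) * pdy (pdx f) q - pdx f q * pdy f q * pdx (pdx f) q))"
    unfolding curv_c_germ_def
    by (intro extends_mult extends_diff extends_add extends_one extends_power w fx fy fxx fxy)
  moreover have "\<forall>\<^sub>F q in nhds 0. 1 / sqrt (S q) *
      ((1 + (pdx f q)\<^sup>2) * pdy (pdx f) q - pdx f q * pdy f q * pdx (pdx f) q) = curv_c (graph_patch f) q"
    using graph_patch_derivatives[OF hol ext]
  proof (rule eventually_mono, elim conjE)
    fix q
    assume "pdx (graph_patch f) q = vector [1, 0, pdx f q]" "pdy (graph_patch f) q = vector [0, 1, pdy f q]"
      "pdx (pdx (graph_patch f)) q = vector [0, 0, pdx (pdx f) q]"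
      "pdy (pdx (graph_patch f)) q = vector [0, 0, pdy (pdx f) q]"
      "pdy (pdy (graph_patch f)) q = vector [0, 0, pdy (pdy f) q]"
    note forms = curvature_forms_of_jet[OF this]
    show "1 / sqrt (S q) * ((1 + (pdx f q)\<^sup>2) * pdy (pdx f) q - pdx f q * pdy f q * pdx (pdx f) q)
        = curv_c (graph_patch f) q"
      unfolding curv_c_def forms S_def by (simp add: diff_divide_distrib)
  qed
  ultimately have c: "extends (w * curv_c_germ) (curv_c (graph_patch f))" by (rule extends_cong)
  show ?thesis by (rule that[OF w(1,3) b c])
qed

text \<open>The determinant criterion for the curvature coefficients themselves: the unit factor \<open>w\<close> scales the
  determinant by the square of its value.\<close>

lemma umbilic_mult_eqI:
  assumes ext: "extends \<phi> f"
    and hols: "holomorphic_germ T" "holomorphic_germ V"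
      "holomorphic_germ s" "holomorphic_germ t" "holomorphic_germ u" "holomorphic_germ v"
    and B: "curv_b_germ = s * T + t * V" and C: "curv_c_germ = u * T + v * V"
    and det: "germ_value s * germ_value v \<noteq> germ_value t * germ_value u"
  shows "umbilic_mult (graph_patch f) = quot_dim (ideal_of_pair T V)"
proof -
  obtain w where w: "holomorphic_germ w" "germ_value w \<noteq> 0"
    "extends (w * curv_b_germ) (curv_b (graph_patch f))" "extends (w * curv_c_germ) (curv_c (graph_patch f))"
    by (rule curvature_extends[OF ext])
  have "holomorphic_germ (w * curv_b_germ)" "holomorphic_germ (w * curv_c_germ)"
    using w(1) hols by (simp_all add: B C)
  then have "complexification (curv_b (graph_patch f)) = w * curv_b_germ"
    "complexification (curv_c (graph_patch f)) = w * curv_c_germ"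
    using w(3,4) by (simp_all add: complexification_eqI)
  moreover have "w * curv_b_germ = (w * s) * T + (w * t) * V" "w * curv_c_germ = (w * u) * T + (w * v) * V"
    by (simp_all add: B C algebra_simps)
  moreover have "Idl\<^bsub>O2\<^esub> {(w * s) * T + (w * t) * V, (w * u) * T + (w * v) * V} = ideal_of_pair T V"
    using w(1,2) hols det by (intro genideal_eq_ideal_of_pair) simp_all
  ultimately show ?thesis by (simp add: umbilic_mult_def)
qed

lemma umbilic_origin:
  assumes ext: "extends \<phi> f" and k: "k = of_real \<kappa>"
  shows "umbilic (graph_patch f) 0"
proof -
  note d = extends_partial_derivatives[OF hol ext]
  have v0: "germ_value \<psi> = 0" if "\<psi> \<in> max_power 1" for \<psi>
    using that by auto
  have n0: "germ_value \<psi> = 0" if "\<psi> \<in> jet_ideal" for \<psi>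
    using that by (auto elim: jet_idealE)
  have "pdx f 0 = 0" "pdy f 0 = 0"
    using v0[OF fx_fy_max_power(1)] v0[OF fx_fy_max_power(2)] germ_value_extends[OF d(1)] germ_value_extends[OF d(2)]
    by (simp_all add: fx_def fy_def)
  moreover have "germ_value fxx = k" "germ_value fxy = 0" "germ_value fyy = k"
    using n0[OF fxx_jet] n0[OF fxy_jet] n0[OF fyy_jet] by (simp_all add: qxx_def qxy_def qyy_def)
  then have "pdx (pdx f) 0 = \<kappa>" "pdy (pdx f) 0 = 0" "pdy (pdy f) 0 = \<kappa>"
    using extends_partial_derivatives(1,2)[OF holomorphic_germ_dx[OF hol] d(1), THEN germ_value_extends]
      extends_partial_derivatives(2)[OF holomorphic_germ_dy[OF hol] d(2), THEN germ_value_extends]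
    by (simp_all add: fxx_def fxy_def fyy_def k)
  ultimately show ?thesis
    using curvature_forms_of_jet[of "graph_patch f" 0] eventually_nhds_x_imp_x[OF graph_patch_derivatives[OF hol ext]]
    by (auto simp: umbilic_def)
qed

lemma curv_decomposition:
  obtains s t u v where "holomorphic_germ s" "holomorphic_germ t" "holomorphic_germ u" "holomorphic_germ v"
    "germ_value s = c" "germ_value t = (d32 - d50) / 6 + k\<^sup>2 * (a + b) + \<alpha> * (d13 - d31)"
    "germ_value u = b" "germ_value v = d41 / 6 + \<alpha> * (d22 - k ^ 3)"
    "curv_b_germ = s * (coord_y - const_germ \<alpha> * coord_x\<^sup>2) +
      (monomial (b - a) 1 0 + monomial ((d22 - d40) / 2 + k ^ 3 + \<alpha> * c) 2 0 + t * coord_x ^ 3)"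
    "curv_c_germ = u * (coord_y - const_germ \<alpha> * coord_x\<^sup>2) +
      (monomial (d31 / 2 + \<alpha> * b) 2 0 + v * coord_x ^ 3)"
proof -
  obtain s t where st: "holomorphic_germ s" "holomorphic_germ t" "germ_value s = c"
    "germ_value t = (d32 - d50) / 6 + k\<^sup>2 * (a + b) + \<alpha> * (d13 - d31)"
    "curv_b_germ = s * (coord_y - const_germ \<alpha> * coord_x\<^sup>2) +
      (monomial (b - a) 1 0 + monomial ((d22 - d40) / 2 + k ^ 3 + \<alpha> * c) 2 0 + t * coord_x ^ 3)"
    by (rule jet_parabola_decomposition[OF curv_b_jet])
  have "curv_c_germ - (monomial 0 1 0 + monomial b 0 1 + monomial (d31 / 2) 2 0 + monomial (d22 - k ^ 3) 1 1
      + monomial (d13 / 2) 0 2 + monomial (d41 / 6) 3 0) \<in> jet_ideal"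
    using curv_c_jet by simp
  then obtain u v where uv: "holomorphic_germ u" "holomorphic_germ v" "germ_value u = b"
    "germ_value v = d41 / 6 + \<alpha> * (d22 - k ^ 3)"
    "curv_c_germ = u * (coord_y - const_germ \<alpha> * coord_x\<^sup>2) +
      (monomial 0 1 0 + monomial (d31 / 2 + \<alpha> * b) 2 0 + v * coord_x ^ 3)"
    by (rule jet_parabola_decomposition)
  then show ?thesis using that[OF st(1,2) uv(1,2) st(3,4) uv(3,4) st(5)] by simp
qed

text \<open>The linear parts of the two numerators are \<open>(b - a) x + c y\<close> and \<open>b y\<close>, so the numerators are local
  coordinates.\<close>

lemma umbilic_mult_eq_1:
  assumes ext: "extends \<phi> f" and b: "b \<noteq> 0" "a \<noteq> b"
  shows "umbilic_mult (graph_patch f) = 1"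
proof -
  let ?T = "coord_y - const_germ 0 * coord_x\<^sup>2"
  obtain s t u v where hols: "holomorphic_germ s" "holomorphic_germ t" "holomorphic_germ u" "holomorphic_germ v"
    and vals: "germ_value s = c" "germ_value u = b"
    and B: "curv_b_germ = s * ?T +
      (monomial (b - a) 1 0 + monomial ((d22 - d40) / 2 + k ^ 3 + 0 * c) 2 0 + t * coord_x ^ 3)"
    and C: "curv_c_germ = u * ?T + (monomial (d31 / 2 + 0 * b) 2 0 + v * coord_x ^ 3)"
    by (rule curv_decomposition)
  let ?t = "const_germ (b - a) + const_germ ((d22 - d40) / 2 + k ^ 3) * coord_x + t * coord_x\<^sup>2"
  let ?v = "const_germ (d31 / 2) * coord_x + v * coord_x\<^sup>2"
  have "umbilic_mult (graph_patch f) = quot_dim (ideal_of_pair ?T (coord_x ^ 1))"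
  proof (rule umbilic_mult_eqI[OF ext])
    show "curv_b_germ = s * ?T + ?t * coord_x ^ 1" "curv_c_germ = u * ?T + ?v * coord_x ^ 1"
      unfolding B C monomial_x by (simp_all add: algebra_simps eval_nat_numeral)
    show "germ_value s * germ_value ?v \<noteq> germ_value ?t * germ_value u"
      using b by (simp add: vals)
  qed (use hols in simp_all)
  then show ?thesis by (simp add: quot_dim_parabola[of 1 0, simplified] one_enat_def)
qed

text \<open>The leading terms are \<open>c y\<close> and \<open>d\<^sub>3\<^sub>1 x\<^sup>2 / 2\<close>, up to multiples of \<open>x\<^sup>2\<close> and, respectively, multiples
  of \<open>y\<close> with cofactor vanishing at the origin.\<close>

lemma umbilic_mult_eq_2_if_ab_zero:
  assumes ext: "extends \<phi> f" and ab: "a = 0" "b = 0" and c: "c \<noteq> 0" "d31 \<noteq> 0"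
  shows "umbilic_mult (graph_patch f) = 2"
proof -
  let ?T = "coord_y - const_germ 0 * coord_x\<^sup>2"
  obtain s t u v where hols: "holomorphic_germ s" "holomorphic_germ t" "holomorphic_germ u" "holomorphic_germ v"
    and vals: "germ_value s = c" "germ_value u = b"
    and B: "curv_b_germ = s * ?T +
      (monomial (b - a) 1 0 + monomial ((d22 - d40) / 2 + k ^ 3 + 0 * c) 2 0 + t * coord_x ^ 3)"
    and C: "curv_c_germ = u * ?T + (monomial (d31 / 2 + 0 * b) 2 0 + v * coord_x ^ 3)"
    by (rule curv_decomposition)
  let ?t = "const_germ ((d22 - d40) / 2 + k ^ 3) + t * coord_x"
  let ?v = "const_germ (d31 / 2) + v * coord_x"
  have "umbilic_mult (graph_patch f) = quot_dim (ideal_of_pair ?T (coord_x ^ 2))"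
  proof (rule umbilic_mult_eqI[OF ext])
    show "curv_b_germ = s * ?T + ?t * coord_x ^ 2" "curv_c_germ = u * ?T + ?v * coord_x ^ 2"
      unfolding B C monomial_x by (simp_all add: ab const_germ_ring_hom algebra_simps eval_nat_numeral)
    show "germ_value s * germ_value ?v \<noteq> germ_value ?t * germ_value u"
      using c by (simp add: vals ab)
  qed (use hols in simp_all)
  then show ?thesis using quot_dim_parabola[of 2 0] by (simp add: numeral_eq_enat)
qed

text \<open>The leading terms are \<open>- a x\<close> and \<open>d\<^sub>1\<^sub>3 y\<^sup>2 / 2\<close>, up to multiples of \<open>y\<^sup>2\<close> and, respectively, multiples
  of \<open>x\<close> with cofactor vanishing at the origin.\<close>

lemma umbilic_mult_eq_2_if_bc_zero:
  assumes ext: "extends \<phi> f" and bc: "b = 0" "c = 0" and a: "a \<noteq> 0" "d13 \<noteq> 0"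
  shows "umbilic_mult (graph_patch f) = 2"
proof -
  obtain s t where st: "holomorphic_germ s" "holomorphic_germ t" "germ_value s = b - a"
    "curv_b_germ = s * coord_x + t * coord_y ^ 2"
    by (rule jet_vertical_decomposition[OF curv_b_jet bc(2)])
  have "curv_c_germ - (monomial 0 1 0 + monomial b 0 1 + monomial (d31 / 2) 2 0 + monomial (d22 - k ^ 3) 1 1
      + monomial (d13 / 2) 0 2 + monomial (d41 / 6) 3 0) \<in> jet_ideal"
    using curv_c_jet by simp
  from jet_vertical_decomposition[OF this bc(1)]
  obtain u v where uv: "holomorphic_germ u" "holomorphic_germ v" "germ_value u = 0" "germ_value v = d13 / 2"
    "curv_c_germ = u * coord_x + v * coord_y ^ 2" by metis
  have "umbilic_mult (graph_patch f) = quot_dim (ideal_of_pair coord_x (coord_y ^ 2))"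
    using a by (intro umbilic_mult_eqI[OF ext _ _ st(1,2) uv(1,2) st(4) uv(5)])
      (simp_all add: st(3) uv(3,4) bc)
  then show ?thesis using quot_dim_vertical_line[of 2] by (simp add: numeral_eq_enat)
qed

text \<open>Both quadratic terms in \<open>x\<close> vanish along the chosen parabola: for the second numerator by the
  choice of \<open>\<alpha>\<close>, for the first one because of the vanishing of \<open>\<chi>\<close>. The cubic terms then enter
  through the determinant, which is a multiple of \<open>\<xi>\<close>.\<close>

lemma umbilic_mult_eq_3:
  assumes ext: "extends \<phi> f" and b: "a = b" "b \<noteq> 0"
    and chi: "c * d31 - (d22 - d40 + 2 * k ^ 3) * b = 0"
    and xi: "12 * k\<^sup>2 * b ^ 3 + (d32 - d50) * b\<^sup>2 + (3 * d31\<^sup>2 - 3 * d31 * d13 - c * d41) * b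
      + 3 * c * d31 * (d22 - k ^ 3) \<noteq> 0"
  shows "umbilic_mult (graph_patch f) = 3"
proof -
  \<comment> \<open>The parabola that osculates the zero set of the second numerator.\<close>
  define \<alpha> where "\<alpha> = - d31 / (2 * b)"
  let ?T = "coord_y - const_germ \<alpha> * coord_x\<^sup>2"
  obtain s t u v where hols: "holomorphic_germ s" "holomorphic_germ t" "holomorphic_germ u" "holomorphic_germ v"
    and vals: "germ_value s = c" "germ_value t = (d32 - d50) / 6 + k\<^sup>2 * (a + b) + \<alpha> * (d13 - d31)"
      "germ_value u = b" "germ_value v = d41 / 6 + \<alpha> * (d22 - k ^ 3)"
    and B: "curv_b_germ = s * ?T +
      (monomial (b - a) 1 0 + monomial ((d22 - d40) / 2 + k ^ 3 + \<alpha> * c) 2 0 + t * coord_x ^ 3)"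
    and C: "curv_c_germ = u * ?T + (monomial (d31 / 2 + \<alpha> * b) 2 0 + v * coord_x ^ 3)"
    by (rule curv_decomposition)
  have "d31 / 2 + \<alpha> * b = 0" using b(2) by (simp add: \<alpha>_def field_simps)
  moreover have "(d22 - d40) / 2 + k ^ 3 + \<alpha> * c = - (c * d31 - (d22 - d40 + 2 * k ^ 3) * b) / (2 * b)"
    using b(2) by (simp add: \<alpha>_def field_simps)
  then have "(d22 - d40) / 2 + k ^ 3 + \<alpha> * c = 0" by (simp add: chi)
  ultimately have BC: "curv_b_germ = s * ?T + t * coord_x ^ 3" "curv_c_germ = u * ?T + v * coord_x ^ 3"
    using B C b(1) by simp_all
  have "germ_value t * germ_value u - germ_value s * germ_value v =
      (12 * k\<^sup>2 * b ^ 3 + (d32 - d50) * b\<^sup>2 + (3 * d31\<^sup>2 - 3 * d31 * d13 - c * d41) * b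
      + 3 * c * d31 * (d22 - k ^ 3)) / (6 * b)"
    using b by (simp add: vals \<alpha>_def field_simps power2_eq_square power3_eq_cube)
  then have "germ_value s * germ_value v \<noteq> germ_value t * germ_value u" using xi b(2) by auto
  then have "umbilic_mult (graph_patch f) = quot_dim (ideal_of_pair ?T (coord_x ^ 3))"
    using hols by (intro umbilic_mult_eqI[OF ext _ _ hols BC]) simp_all
  then show ?thesis using quot_dim_parabola[of 3 \<alpha>] by (simp add: numeral_eq_enat)
qed

end

theorem proposition4p2:
  fixes f :: "real \<times> real \<Rightarrow> real"
    and \<kappa> a b c d40 d31 d22 d13 d04 d50 d41 d32 d23 d14 d05 chi xi :: real
  assumes analytic: "analytic_at_origin f"
    and expansion:
      "(\<lambda>(x, y). f (x, y) -
          (\<kappa> / 2 * (x^2 + y^2)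
           + a / 6 * x^3 + b / 2 * x * y^2 + c / 6 * y^3
           + d40 / 24 * x^4 + d31 / 6 * x^3 * y + d22 / 4 * x^2 * y^2
           + d13 / 6 * x * y^3 + d04 / 24 * y^4
           + d50 / 120 * x^5 + d41 / 24 * x^4 * y + d32 / 12 * x^3 * y^2
           + d23 / 12 * x^2 * y^3 + d14 / 24 * x * y^4 + d05 / 120 * y^5))
        \<in> O[nhds (0, 0)](\<lambda>p. norm p ^ 6)"
    and chi_def: "chi = c * d31 - (d22 - d40 + 2 * \<kappa>^3) * b"
    and xi_def: "xi = 12 * \<kappa>^2 * b^3 + (d32 - d50) * b^2
               + (3 * d31^2 - 3 * d31 * d13 - c * d41) * b + 3 * c * d31 * (d22 - \<kappa>^3)"
  shows "umbilic (graph_patch f) (0, 0) \<and>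
    (c = 0 \<and> a = 2 * b \<and> 2 * b \<noteq> 0 \<longrightarrow>
       umbilic_mult (graph_patch f) = 1) \<and>
    (a = b \<and> b \<noteq> 0 \<and> chi = 0 \<and> xi \<noteq> 0 \<and> xi * b < 0 \<longrightarrow>
       umbilic_mult (graph_patch f) = 3) \<and>
    (a = b \<and> b \<noteq> 0 \<and> chi = 0 \<and> xi \<noteq> 0 \<and> xi * b > 0 \<longrightarrow>
       umbilic_mult (graph_patch f) = 3) \<and>
    ((a = 0 \<and> b = 0 \<and> c * d31 \<noteq> 0) \<or> (b = 0 \<and> c = 0 \<and> a * d13 \<noteq> 0) \<longrightarrow>
       umbilic_mult (graph_patch f) = 2)"
proof -
  obtain \<phi> where \<phi>: "holomorphic_germ \<phi>" "extends \<phi> f"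
    by (rule analytic_at_origin_extends[OF analytic])
  let ?Q = "quintic (of_real \<kappa>) (of_real a) (of_real b) (of_real c) (of_real d40) (of_real d31) (of_real d22)
    (of_real d13) (of_real d04) (of_real d50) (of_real d41) (of_real d32) (of_real d23) (of_real d14) (of_real d05)"
  define P where "P = (\<lambda>q::real \<times> real.
    \<kappa> / 2 * fst q ^ 2 * snd q ^ 0 + \<kappa> / 2 * fst q ^ 0 * snd q ^ 2
    + a / 6 * fst q ^ 3 * snd q ^ 0 + b / 2 * fst q ^ 1 * snd q ^ 2 + c / 6 * fst q ^ 0 * snd q ^ 3
    + d40 / 24 * fst q ^ 4 * snd q ^ 0 + d31 / 6 * fst q ^ 3 * snd q ^ 1 + d22 / 4 * fst q ^ 2 * snd q ^ 2
    + d13 / 6 * fst q ^ 1 * snd q ^ 3 + d04 / 24 * fst q ^ 0 * snd q ^ 4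
    + d50 / 120 * fst q ^ 5 * snd q ^ 0 + d41 / 24 * fst q ^ 4 * snd q ^ 1 + d32 / 12 * fst q ^ 3 * snd q ^ 2
    + d23 / 12 * fst q ^ 2 * snd q ^ 3 + d14 / 24 * fst q ^ 1 * snd q ^ 4 + d05 / 120 * fst q ^ 0 * snd q ^ 5)"
  have "extends ?Q P"
    unfolding quintic_def P_def by (intro extends_add extends_monomial) simp_all
  then have "extends (\<phi> - ?Q) (\<lambda>q. f q - P q)" by (rule extends_diff[OF \<phi>(2)])
  moreover have "(\<lambda>q. f q - P q) \<in> O[nhds 0](\<lambda>q. norm q ^ 6)"
    using expansion by (simp add: P_def case_prod_unfold zero_prod_def distrib_left)
  moreover have "holomorphic_germ (\<phi> - ?Q)"
    using \<phi>(1) by (simp add: quintic_def)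
  ultimately have "\<phi> - ?Q \<in> max_power 6" by (intro extends_bigo_imp_max_power)
  then interpret umbilic_jet \<phi> "of_real \<kappa>" "of_real a" "of_real b" "of_real c" "of_real d40" "of_real d31"
    "of_real d22" "of_real d13" "of_real d04" "of_real d50" "of_real d41" "of_real d32" "of_real d23"
    "of_real d14" "of_real d05"
    by (rule umbilic_jet.intro[OF \<phi>(1)])
  have "umbilic_mult (graph_patch f) = 3" if "a = b" "b \<noteq> 0" "chi = 0" "xi \<noteq> 0"
  proof (rule umbilic_mult_eq_3[OF \<phi>(2)])
    have "complex_of_real chi = 0" "complex_of_real xi \<noteq> 0" using that by simp_all
    then show "of_real c * of_real d31 - (of_real d22 - of_real d40 + 2 * of_real \<kappa> ^ 3) * of_real b = (0 :: complex)"
      "12 * (of_real \<kappa>)\<^sup>2 * of_real b ^ 3 + (of_real d32 - of_real d50) * (of_real b)\<^sup>2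
        + (3 * (of_real d31)\<^sup>2 - 3 * of_real d31 * of_real d13 - of_real c * of_real d41) * of_real b
        + 3 * of_real c * of_real d31 * (of_real d22 - of_real \<kappa> ^ 3) \<noteq> (0 :: complex)"
      by (simp_all add: chi_def xi_def)
  qed (use that in simp_all)
  moreover have "umbilic_mult (graph_patch f) = 1" if "a = 2 * b" "2 * b \<noteq> 0"
    using that by (intro umbilic_mult_eq_1[OF \<phi>(2)]) auto
  moreover have "umbilic_mult (graph_patch f) = 2" if "a = 0" "b = 0" "c * d31 \<noteq> 0"
    using that by (intro umbilic_mult_eq_2_if_ab_zero[OF \<phi>(2)]) auto
  moreover have "umbilic_mult (graph_patch f) = 2" if "b = 0" "c = 0" "a * d13 \<noteq> 0"
    using that by (intro umbilic_mult_eq_2_if_bc_zero[OF \<phi>(2)]) auto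
  moreover have "umbilic (graph_patch f) (0, 0)"
    using umbilic_origin[OF \<phi>(2) refl] by (simp add: zero_prod_def)
  ultimately show ?thesis by blast
qed

end
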